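(* Let $(F,G,B)$ be a solution of the $G^1_{m,n}$-system II, and $X=(X_1,\dots,X_{n+1})$ the $(n+1)$-tuple in $\mathbb R^m$ of type $O(n,1)$ corresponding to $(F,G,B)$, with associated $O(m)$-valued map $A$. Let $q_{s,\pi}$ be the rational map defined in the context for some constant $0\ne s\in\mathbb R$ and unit vectors $W$ in $\mathbb R^m$ and $Z$ in $\mathbb R^{n,1}$, and let $(\tilde F,\tilde G,\tilde B,\tilde A)=q_{s,\pi}\cdot(F,G,B,A)$ and $\hat W,\hat Z$ be as in the context. Let $$\tilde X=X+\frac2sA\hat W\hat Z^tB^tJ=(\tilde X_1,\dots,\tilde X_{n+1}),\qquad J=I_{n,1}.$$ Then: (i) $\tilde X$ is an $(n+1)$-tuple in $\mathbb R^m$ of type $O(n,1)$. (ii) The solution of the $G^1_{m,n}$-system II corresponding to $\tilde X$ is $(\tilde F,\tilde G,\tilde B)=q_{s,\pi}\cdot(F,G,B)$. (iii) Write $A=(e_1,\dots,e_m)$, $\tilde A=(\tilde e_1,\dots,\tilde e_m)$. Then $\{e_i\}_{i=1}^{n+1}$ and $\{\tilde e_i\}_{i=1}^{n+1}$ are principal curvature frames, and $\{e_\alpha\}_{\alpha=n+2}^m$ and $\{\tilde e_\alpha\}_{\alpha=n+2}^m$ are parallel normal frames, of $X_j$ and $\tilde X_j$ respectively. (iv) The bundle morphism $P(e_\alpha(x))=\tilde e_\alpha(x)$ for $n+2\le\alpha\le m$ is a Ribaucour transformation covering the map $X_j(x)\mapsto\tilde X_j(x)$ for each $1\le j\le n+1$.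 (v) There exist smooth functions $\phi_{ij}$ such that $X_j+\phi_{ij}e_i=\tilde X_j+\phi_{ij}\tilde e_i$ for all $1\le j\le n+1$ and $1\le i\le n+1$.
   Context: $J=I_{n,1}=\mathrm{diag}(1,\dots,1,-1)$ of size $n+1$; $O(n,1)=\{B:B^tJB=J\}$; $\mathbb R^{n,1}$ is $\mathbb R^{n+1}$ with the form $Z^tJZ$, $\|Z\|_{n,1}=\sqrt{Z^tJZ}$ (unit: $Z^tJZ=1$); $\mathcal M_{p\times q}$: real $p\times q$ matrices; $gl_*(n+1)$: real matrices with zero diagonal; $C_i$: the $(n+1)\times(n+1)$ matrix whose only non-zero entry is a $1$ at $(i,i)$; $D_i=\begin{pmatrix}C_i\\0\end{pmatrix}\in\mathcal M_{m\times(n+1)}$; $I_{m,n+1}=\mathrm{diag}(I_m,-I_{n+1})$, $I_{m+n,1}=\mathrm{diag}(I_{m+n},-1)$. $G^1_{m,n}$-system II for $(F,G,B)$ with values in $gl_*(n+1)\times\mathcal M_{(m-n-1)\times(n+1)}\times O(n,1)$: $(f_{ij})_{x_i}+(f_{ji})_{x_j}+\sum_kf_{ki}f_{kj}+\sum_kg_{ki}g_{kj}=0$ ($i\ne j$); $(f_{ij})_{x_k}=f_{ik}f_{kj}$ ($i,j,k$ distinct); $(b_{ij})_{x_k}=f_{kj}b_{ik}$, $(g_{ij})_{x_k}=f_{kj}g_{ik}$ ($j\ne k$). $X$ corresponds to a solution $(F,G,B)$, with associated $A$, if $A=(A_1,A_2)$ is $O(m)$-valued, $A_1\in\mathcal M_{m\times(n+1)}$,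 $A^{-1}dA=\sum_i\begin{pmatrix}-FC_i+C_iF^t&C_iG^t\\-GC_i&0\end{pmatrix}dx_i$ and $dX=-\sum_iA_1C_iB^tJ\,dx_i$. Action of $q_{s,\pi}$: $\pi$ is the projection onto $\mathbb C\binom W{iZ}$ orthogonal with respect to $\langle u,v\rangle_1=\sum_{i\le n+m}\bar u_iv_i-\bar u_{n+m+1}v_{n+m+1}$, and $q_{s,\pi}(\lambda)=\left(\pi+\frac{\lambda-is}{\lambda+is}(I-\pi)\right)\left(\bar\pi+\frac{\lambda+is}{\lambda-is}(I-\bar\pi)\right)$. With $\xi=\binom FG$, let $E(x,\lambda)$ be a frame of $\xi$, i.e. $$E^{-1}dE=\sum_{i=1}^{n+1}\left\{\lambda\begin{pmatrix}0&-D_iJ\\ D_i^t&0\end{pmatrix}+\begin{pmatrix}D_i\xi^t-\xi D_i^t&0\\0&-J\xi^tD_iJ+D_i^t\xi\end{pmatrix}\right\}dx_i,$$ satisfying $\overline{E(x,\bar\lambda)}=E(x,\lambda)$, $I_{m,n+1}E(x,\lambda)I_{m,n+1}=E(x,-\lambda)$, $E^tI_{m+n,1}E=I_{m+n,1}$, with $E(x,0)=\begin{pmatrix}A&0\\0&B\end{pmatrix}$. Put $\binom{\tilde W}{i\tilde Z}(x)=E(x,-is)^{-1}\binom W{iZ}$, $\hat W=\tilde W/\|\tilde W\|$, $\hat Z=\tilde Z/\|\tilde Z\|_{n,1}$. Then $\binom{\tilde F}{\tilde G}=\binom FG-2s(\hat W\hat Z^tJ)_*$, where $(\cdot)_*$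 sets the $(i,i)$ entries to zero, $\tilde A=A(I-2\hat W\hat W^t)$, $\tilde B=B(I-2\hat Z\hat Z^tJ)$. $(n+1)$-tuple of type $O(n,1)$: let $m>n+1$, $\mathcal O$ a domain in $\mathbb R^{n+1}$, $X_i:\mathcal O\to\mathbb R^m$ ($1\le i\le n+1$) immersions with flat and non-degenerate normal bundle. $(X_1,\dots,X_{n+1})$ is an $(n+1)$-tuple in $\mathbb R^m$ of type $O(n,1)$ if the normal planes of $X_i(x)$ and $X_j(x)$ are parallel for all $i,j,x$; there is a common parallel normal frame $e_{n+2},\dots,e_m$; and $x$ is a hyperbolic line of curvature coordinate system for each $X_j$ with fundamental forms $I_j=\sum_i\beta_{ji}^2dx_i^2$, $II_j=\sum_{i,k}\beta_{ji}\gamma_{ki}dx_i^2e_{n+1+k}$ for some $O(n,1)$-valued $(\beta_{ij})$ and $\mathcal M_{(m-n-1)\times(n+1)}$-valued $(\gamma_{ij})$. (Hyperbolic: $\beta_{j1}^2+\dots+\beta_{jn}^2-\beta_{j,n+1}^2=\pm1$.) Non-degenerate: the space of shape operators at each point has dimension $n+1$, the dimension of the submanifold. $I=\sum\omega_i^2$, $II=\sum\omega_{i\alpha}\omega_ie_\alpha$ with $\omega_i=\langle dX,e_i\rangle$, $\omega_{i\alpha}=\langle e_i,de_\alpha\rangle$. Ribaucour transformation: for submanifolds $M,\tilde M$ of the same dimension in a space form, let $\gamma_{x,v}(t)=\exp_x(tv)$ (straight lines in Euclidean space). A sphere congruence is a vector bundle isomorphism $P:\nu(M)\to\nu(\tilde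 M)$ of normal bundles covering a diffeomorphism $\ell:M\to\tilde M$ such that (a) if $\zeta$ is a parallel normal field of $M$, then $P\circ\zeta\circ\ell^{-1}$ is a parallel normal field of $\tilde M$; (b) for any non-zero $\zeta\in\nu_x(M)$, the geodesics $\gamma_{x,\zeta}$ and $\gamma_{\ell(x),P(\zeta)}$ intersect at a point equidistant from $x$ and $\ell(x)$ (the distance depends on $x$). It is a Ribaucour transformation if in addition (c) if $e$ is an eigenvector of the shape operator $A_\zeta$ of $M$, then $\ell_*(e)$ is an eigenvector of the shape operator $A_{P(\zeta)}$ of $\tilde M$; (d) the geodesics $\gamma_{x,e}$ and $\gamma_{\ell(x),\ell_*(e)}$ intersect at a point equidistant from $x$ and $\ell(x)$.
   Formalization: Ŵ, Ẑ are assumed defined; the X̃ parts of (i), (iii), (iv) hold on subdomains where the B̃ entries are nonzero (for (i) also rank G̃=n+1); in (iv) parallel lines may meet at infinity and eigenvectors are common to all shape operators; in (v) φ_ij is defined where ẽ_i≠e_i. *)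

theory Defs
  imports "HOL-Analysis.Analysis"
begin

(* Conventions.  The index set {1..n+1} is the type 'n option with CARD('n) = n, and None is the
   last index n+1, the one carrying the minus sign of J.  The index set {1..m} is the type
   'n option + 'k with CARD('k) = m-n-1, so that m > n+1 holds by construction;
   Inl i stands for i <= n+1, and Inr k for n+1+k.  The index set {1..m+n+1} is
   ('n option + 'k) + 'n option.  As in the library, 'a^'q^'p is the type of matrices with rows
   indexed by 'p and columns indexed by 'q. *)

section \<open>Smooth functions on open sets\<close>

primrec Ck_on :: "nat \<Rightarrow> 'a::euclidean_space set \<Rightarrow> ('a \<Rightarrow> 'b::real_normed_vector) \<Rightarrow> bool" where
  "Ck_on 0 U f \<longleftrightarrow> continuous_on U f"
| "Ck_on (Suc k) U f \<longleftrightarrow>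
     f differentiable_on U \<and> (\<forall>v. Ck_on k U (\<lambda>x. frechet_derivative f (at x) v))"

definition smooth_on :: "'a::euclidean_space set \<Rightarrow> ('a \<Rightarrow> 'b::real_normed_vector) \<Rightarrow> bool" where
  "smooth_on U f \<longleftrightarrow> (\<forall>k. Ck_on k U f)"

definition open_domain :: "'a::euclidean_space set \<Rightarrow> bool" where
  "open_domain U \<longleftrightarrow> open U \<and> connected U \<and> U \<noteq> {}"

definition pderiv_at :: "'p::finite \<Rightarrow> (real^'p \<Rightarrow> 'b::real_normed_vector) \<Rightarrow> real^'p \<Rightarrow> 'b" where
  "pderiv_at a f x = frechet_derivative f (at x) (axis a 1)"


section \<open>Immersed submanifolds of Euclidean space\<close>

(* A submanifold is given by an immersion X of an open subset of R^p.  Tangent vectors of the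
   submanifold are written dX u with u in R^p. *)

definition differential :: "(real^'p::finite \<Rightarrow> real^'q::finite) \<Rightarrow> real^'p \<Rightarrow> real^'p \<Rightarrow> real^'q" where
  "differential X x = frechet_derivative X (at x)"

definition immersion_on :: "(real^'p::finite) set \<Rightarrow> (real^'p \<Rightarrow> real^'q::finite) \<Rightarrow> bool" where
  "immersion_on U X \<longleftrightarrow> smooth_on U X \<and> (\<forall>x\<in>U. inj (differential X x))"

definition tangent_space :: "(real^'p::finite \<Rightarrow> real^'q::finite) \<Rightarrow> real^'p \<Rightarrow> (real^'q) set" where
  "tangent_space X x = range (differential X x)"

definition normal_space :: "(real^'p::finite \<Rightarrow> real^'q::finite) \<Rightarrow> real^'p \<Rightarrow> (real^'q) set" where
  "normal_space X x = orthogonal_comp (tangent_space X x)"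

definition normal_part ::
    "(real^'p::finite \<Rightarrow> real^'q::finite) \<Rightarrow> real^'p \<Rightarrow> real^'q \<Rightarrow> real^'q" where
  "normal_part X x v = (THE w. w \<in> normal_space X x \<and> v - w \<in> tangent_space X x)"

definition normal_field_on ::
    "(real^'p::finite) set \<Rightarrow> (real^'p \<Rightarrow> real^'q::finite) \<Rightarrow> (real^'p \<Rightarrow> real^'q) \<Rightarrow> bool" where
  "normal_field_on U X \<zeta> \<longleftrightarrow> smooth_on U \<zeta> \<and> (\<forall>x\<in>U. \<zeta> x \<in> normal_space X x)"

definition normal_connection ::
    "(real^'p::finite \<Rightarrow> real^'q::finite) \<Rightarrow> 'p \<Rightarrow> (real^'p \<Rightarrow> real^'q) \<Rightarrow> real^'p \<Rightarrow> real^'q" where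
  "normal_connection X a \<zeta> x = normal_part X x (pderiv_at a \<zeta> x)"

(* Vanishing curvature of the normal connection; the coordinate fields commute. *)
definition flat_normal_bundle_on ::
    "(real^'p::finite) set \<Rightarrow> (real^'p \<Rightarrow> real^'q::finite) \<Rightarrow> bool" where
  "flat_normal_bundle_on U X \<longleftrightarrow>
     (\<forall>\<zeta>. normal_field_on U X \<zeta> \<longrightarrow> (\<forall>x\<in>U. \<forall>a b.
        normal_connection X a (normal_connection X b \<zeta>) x =
        normal_connection X b (normal_connection X a \<zeta>) x))"

definition parallel_normal_field_on ::
    "(real^'p::finite) set \<Rightarrow> (real^'p \<Rightarrow> real^'q::finite) \<Rightarrow> (real^'p \<Rightarrow> real^'q) \<Rightarrow> bool" where
  "parallel_normal_field_on U X \<zeta> \<longleftrightarrow>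
     normal_field_on U X \<zeta> \<and> (\<forall>x\<in>U. \<forall>a. normal_connection X a \<zeta> x = 0)"

definition parallel_normal_frame_on ::
    "(real^'p::finite) set \<Rightarrow> (real^'p \<Rightarrow> real^'q::finite) \<Rightarrow> ('k \<Rightarrow> real^'p \<Rightarrow> real^'q) \<Rightarrow> bool" where
  "parallel_normal_frame_on U X e \<longleftrightarrow>
     (\<forall>k. parallel_normal_field_on U X (e k)) \<and>
     (\<forall>x\<in>U. (\<forall>k l. e k x \<bullet> e l x = (if k = l then 1 else 0)) \<and>
        span (range (\<lambda>k. e k x)) = normal_space X x)"

definition first_fund :: "(real^'p::finite \<Rightarrow> real^'q::finite) \<Rightarrow> real^'p \<Rightarrow> real^'p^'p" where
  "first_fund X x = (\<chi> a b. pderiv_at a X x \<bullet> pderiv_at b X x)"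

(* The coefficient of II along a unit normal field e of an orthonormal normal frame.  With
   omega_i = <dX, e_i> and omega_ia = <e_i, de>, the form Sum_i omega_i * omega_ia equals
   <dX, de>, because dX is tangent.  This sign convention is opposite to <d dX, e>. *)
definition second_fund ::
    "(real^'p::finite \<Rightarrow> real^'q::finite) \<Rightarrow> (real^'p \<Rightarrow> real^'q) \<Rightarrow> real^'p \<Rightarrow> real^'p^'p" where
  "second_fund X e x = (\<chi> a b. pderiv_at a X x \<bullet> pderiv_at b e x)"

(* The shape operator A_v of a single normal vector v at x, as a matrix acting on the parameter
   space R^p (identified with the tangent space through dX).  For a normal field e with e x = v,
   the symmetric matrix (- v . d_a d_b X) is second_fund X e x, by differentiating
   <d_a X, e> = 0. *)
definition shape_operator ::
    "(real^'p::finite \<Rightarrow> real^'q::finite) \<Rightarrow> real^'p \<Rightarrow> real^'q \<Rightarrow> real^'p^'p" where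
  "shape_operator X x v =
     matrix_inv (first_fund X x) ** (\<chi> a b. - (v \<bullet> pderiv_at b (pderiv_at a X) x))"

definition nondegenerate_normal_bundle_on ::
    "(real^'p::finite) set \<Rightarrow> (real^'p \<Rightarrow> real^'q::finite) \<Rightarrow> bool" where
  "nondegenerate_normal_bundle_on U X \<longleftrightarrow>
     (\<forall>x\<in>U. dim (shape_operator X x ` normal_space X x) = CARD('p))"

definition eigenvector :: "real^'p^'p::finite \<Rightarrow> real^'p \<Rightarrow> bool" where
  "eigenvector S u \<longleftrightarrow> u \<noteq> 0 \<and> (\<exists>\<kappa>. S *v u = \<kappa> *\<^sub>R u)"

(* The tangent vector dX u is an eigenvector of all shape operators at x. *)
definition principal_direction ::
    "(real^'p::finite \<Rightarrow> real^'q::finite) \<Rightarrow> real^'p \<Rightarrow> real^'p \<Rightarrow> bool" where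
  "principal_direction X x u \<longleftrightarrow> (\<forall>v\<in>normal_space X x. eigenvector (shape_operator X x v) u)"

definition principal_frame_on ::
    "(real^'p::finite) set \<Rightarrow> (real^'p \<Rightarrow> real^'q::finite) \<Rightarrow> ('i \<Rightarrow> real^'p \<Rightarrow> real^'q) \<Rightarrow> bool" where
  "principal_frame_on U X e \<longleftrightarrow>
     (\<forall>i. smooth_on U (e i)) \<and>
     (\<forall>x\<in>U. (\<forall>i j. e i x \<bullet> e j x = (if i = j then 1 else 0)) \<and>
        span (range (\<lambda>i. e i x)) = tangent_space X x \<and>
        (\<forall>i. \<exists>u. e i x = differential X x u \<and> principal_direction X x u))"


section \<open>Ribaucour transformations\<close>

definition geodesic :: "'a::real_vector \<Rightarrow> 'a \<Rightarrow> real \<Rightarrow> 'a" where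
  "geodesic p v t = p + t *\<^sub>R v"

(* The straight lines through p, q with directions u, v meet at a point equidistant from p and q.
   Parallel lines are taken to meet at infinity.  The sphere through p and q with that centre is
   then a hyperplane orthogonal to the common direction, which must contain both p and q. *)
definition meet_equidistant :: "'a::euclidean_space \<Rightarrow> 'a \<Rightarrow> 'a \<Rightarrow> 'a \<Rightarrow> bool" where
  "meet_equidistant p u q v \<longleftrightarrow>
     (\<exists>c. c \<in> range (geodesic p u) \<and> c \<in> range (geodesic q v) \<and> dist c p = dist c q) \<or>
     ((\<exists>r. r \<noteq> 0 \<and> v = r *\<^sub>R u) \<and> (q - p) \<bullet> u = 0)"

definition diffeomorphism_on :: "'a::euclidean_space set \<Rightarrow> 'a set \<Rightarrow> ('a \<Rightarrow> 'a) \<Rightarrow> bool" where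
  "diffeomorphism_on U V l \<longleftrightarrow>
     bij_betw l U V \<and> smooth_on U l \<and> smooth_on V (inv_into U l)"

(* P x maps the normal space of X at x to the normal space of Y at l x.  Only its values on the
   normal space matter.  The map covered by P is X x |-> Y (l x). *)
definition normal_bundle_iso ::
    "(real^'p::finite) set \<Rightarrow> (real^'p \<Rightarrow> real^'q::finite) \<Rightarrow> (real^'p) set \<Rightarrow> (real^'p \<Rightarrow> real^'q) \<Rightarrow>
     (real^'p \<Rightarrow> real^'p) \<Rightarrow> (real^'p \<Rightarrow> real^'q \<Rightarrow> real^'q) \<Rightarrow> bool" where
  "normal_bundle_iso U X V Y l P \<longleftrightarrow>
     (\<forall>x\<in>U. bij_betw (P x) (normal_space X x) (normal_space Y (l x)) \<and>
        (\<forall>v\<in>normal_space X x. \<forall>w\<in>normal_space X x. \<forall>a b.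
           P x (a *\<^sub>R v + b *\<^sub>R w) = a *\<^sub>R P x v + b *\<^sub>R P x w)) \<and>
     (\<forall>\<zeta>. normal_field_on U X \<zeta> \<longrightarrow>
        smooth_on V (\<lambda>y. P (inv_into U l y) (\<zeta> (inv_into U l y))))"

definition sphere_congruence ::
    "(real^'p::finite) set \<Rightarrow> (real^'p \<Rightarrow> real^'q::finite) \<Rightarrow> (real^'p) set \<Rightarrow> (real^'p \<Rightarrow> real^'q) \<Rightarrow>
     (real^'p \<Rightarrow> real^'p) \<Rightarrow> (real^'p \<Rightarrow> real^'q \<Rightarrow> real^'q) \<Rightarrow> bool" where
  "sphere_congruence U X V Y l P \<longleftrightarrow>
     open U \<and> open V \<and> immersion_on U X \<and> immersion_on V Y \<and>
     diffeomorphism_on U V l \<and> normal_bundle_iso U X V Y l P \<and>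
     (\<forall>\<zeta>. parallel_normal_field_on U X \<zeta> \<longrightarrow>
        parallel_normal_field_on V Y (\<lambda>y. P (inv_into U l y) (\<zeta> (inv_into U l y)))) \<and>
     (\<forall>x\<in>U. \<forall>v\<in>normal_space X x. v \<noteq> 0 \<longrightarrow> meet_equidistant (X x) v (Y (l x)) (P x v))"

(* An eigenvector e of the shape operators means a principal direction, i.e. a common eigenvector:
   special normals have coinciding principal curvatures, and their further eigenvectors
   are not meant. *)
definition ribaucour_transformation ::
    "(real^'p::finite) set \<Rightarrow> (real^'p \<Rightarrow> real^'q::finite) \<Rightarrow> (real^'p) set \<Rightarrow> (real^'p \<Rightarrow> real^'q) \<Rightarrow>
     (real^'p \<Rightarrow> real^'p) \<Rightarrow> (real^'p \<Rightarrow> real^'q \<Rightarrow> real^'q) \<Rightarrow> bool" where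
  "ribaucour_transformation U X V Y l P \<longleftrightarrow>
     sphere_congruence U X V Y l P \<and>
     (\<forall>x\<in>U. \<forall>u. principal_direction X x u \<longrightarrow>
        (\<forall>v\<in>normal_space X x.
           eigenvector (shape_operator Y (l x) (P x v)) (differential l x u)) \<and>
        meet_equidistant (X x) (differential X x u)
          (Y (l x)) (differential Y (l x) (differential l x u)))"

definition frame_morphism ::
    "('k::finite \<Rightarrow> 'x \<Rightarrow> 'a::euclidean_space) \<Rightarrow> ('k \<Rightarrow> 'x \<Rightarrow> 'a) \<Rightarrow> 'x \<Rightarrow> 'a \<Rightarrow> 'a" where
  "frame_morphism e e' x v = (\<Sum>k\<in>UNIV. (v \<bullet> e k x) *\<^sub>R e' k x)"


section \<open>Matrices\<close>

definition J :: "real^'n::finite option^'n option" where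
  "J = (\<chi> i j. if i = j then (if i = None then -1 else 1) else 0)"

definition O_n1 :: "(real^'n::finite option^'n option) set" where
  "O_n1 = {B. transpose B ** J ** B = J}"

definition form_n1 :: "real^'n::finite option \<Rightarrow> real" where
  "form_n1 Z = Z \<bullet> (J *v Z)"

definition norm_n1 :: "real^'n::finite option \<Rightarrow> real" where
  "norm_n1 Z = sqrt (form_n1 Z)"

definition outer :: "'a::semiring_1^'p::finite \<Rightarrow> 'a^'q::finite \<Rightarrow> 'a^'q^'p" where
  "outer u v = (columnvector u :: 'a^1^'p) ** (rowvector v :: 'a^'q^1)"

definition stack ::
    "'a^'q::finite^'p::finite \<Rightarrow> 'a^'q^'r::finite \<Rightarrow> 'a^'q^('p + 'r)" where
  "stack P Q = (\<chi> a j. case a of Inl i \<Rightarrow> P $ i $ j | Inr i \<Rightarrow> Q $ i $ j)"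

definition block ::
    "'a^'q::finite^'p::finite \<Rightarrow> 'a^'s::finite^'p \<Rightarrow> 'a^'q^'r::finite \<Rightarrow> 'a^'s^'r \<Rightarrow>
     'a^('q + 's)^('p + 'r)" where
  "block P Q R S = (\<chi> a b. case a of
       Inl i \<Rightarrow> (case b of Inl j \<Rightarrow> P $ i $ j | Inr j \<Rightarrow> Q $ i $ j)
     | Inr i \<Rightarrow> (case b of Inl j \<Rightarrow> R $ i $ j | Inr j \<Rightarrow> S $ i $ j))"

definition left_block :: "'a^('q::finite + 's::finite)^'p::finite \<Rightarrow> 'a^'q^'p" where
  "left_block A = (\<chi> a j. A $ a $ Inl j)"

definition C :: "'i::finite \<Rightarrow> real^'i^'i" where
  "C i = (\<chi> a b. if a = i \<and> b = i then 1 else 0)"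

definition D :: "'i::finite \<Rightarrow> real^'i^('i + 'k::finite)" where
  "D i = stack (C i) 0"

definition off_diag :: "real^'i::finite^('i + 'k::finite) \<Rightarrow> real^'i^('i + 'k)" where
  "off_diag M = (\<chi> a j. if a = Inl j then 0 else M $ a $ j)"

definition I_m_n1 ::
    "real^(('n::finite option + 'k::finite) + 'n option)^(('n option + 'k) + 'n option)" where
  "I_m_n1 = block (mat 1) 0 0 (- mat 1)"

definition I_mn_1 ::
    "real^(('n::finite option + 'k::finite) + 'n option)^(('n option + 'k) + 'n option)" where
  "I_mn_1 = block (mat 1) 0 0 J"

definition cmat :: "real^'q::finite^'p::finite \<Rightarrow> complex^'q^'p" where
  "cmat M = map_matrix complex_of_real M"

definition cscale :: "complex \<Rightarrow> complex^'q::finite^'p::finite \<Rightarrow> complex^'q^'p" where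
  "cscale c M = map_matrix (\<lambda>z. c * z) M"


section \<open>The system, its solutions and the associated tuples\<close>

definition solution_system_II ::
    "(real^'n::finite option) set \<Rightarrow> (real^'n option \<Rightarrow> real^'n option^'n option) \<Rightarrow>
     (real^'n option \<Rightarrow> real^'n option^'k::finite) \<Rightarrow> (real^'n option \<Rightarrow> real^'n option^'n option) \<Rightarrow>
     bool" where
  "solution_system_II U F G B \<longleftrightarrow>
     smooth_on U F \<and> smooth_on U G \<and> smooth_on U B \<and>
     (\<forall>x\<in>U. (\<forall>i. F x $ i $ i = 0) \<and> B x \<in> O_n1 \<and>
        (\<forall>i j. i \<noteq> j \<longrightarrow>
           pderiv_at i (\<lambda>y. F y $ i $ j) x + pderiv_at j (\<lambda>y. F y $ j $ i) x
           + (\<Sum>k\<in>UNIV. F x $ k $ i * F x $ k $ j) + (\<Sum>k\<in>UNIV. G x $ k $ i * G x $ k $ j) = 0) \<and>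
        (\<forall>i j k. i \<noteq> j \<and> j \<noteq> k \<and> i \<noteq> k \<longrightarrow>
           pderiv_at k (\<lambda>y. F y $ i $ j) x = F x $ i $ k * F x $ k $ j) \<and>
        (\<forall>i j k. j \<noteq> k \<longrightarrow> pderiv_at k (\<lambda>y. B y $ i $ j) x = F x $ k $ j * B x $ i $ k) \<and>
        (\<forall>i j k. j \<noteq> k \<longrightarrow> pderiv_at k (\<lambda>y. G y $ i $ j) x = F x $ k $ j * G x $ i $ k))"

definition corresponds ::
    "(real^'n::finite option) set \<Rightarrow>
     (real^'n option \<Rightarrow> real^'n option^('n option + 'k::finite)) \<Rightarrow>
     (real^'n option \<Rightarrow> real^'n option^'n option) \<Rightarrow>
     (real^'n option \<Rightarrow> real^'n option^'k) \<Rightarrow>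
     (real^'n option \<Rightarrow> real^'n option^'n option) \<Rightarrow>
     (real^'n option \<Rightarrow> real^('n option + 'k)^('n option + 'k)) \<Rightarrow> bool" where
  "corresponds U X F G B A \<longleftrightarrow>
     solution_system_II U F G B \<and> smooth_on U A \<and> smooth_on U X \<and>
     (\<forall>x\<in>U. orthogonal_matrix (A x) \<and>
        (\<forall>i. matrix_inv (A x) ** pderiv_at i A x =
               block (- (F x ** C i) + C i ** transpose (F x)) (C i ** transpose (G x))
                     (- (G x ** C i)) 0) \<and>
        (\<forall>i. pderiv_at i X x = - (left_block (A x) ** C i ** transpose (B x) ** J)))"

(* The components X_j of the tuple are the columns of X. *)
definition tuple_type_O_n1 ::
    "(real^'n::finite option) set \<Rightarrow>
     (real^'n option \<Rightarrow> real^'n option^('n option + 'k::finite)) \<Rightarrow> bool" where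
  "tuple_type_O_n1 U X \<longleftrightarrow>
     open_domain U \<and>
     (\<forall>j. immersion_on U (\<lambda>x. column j (X x)) \<and>
          flat_normal_bundle_on U (\<lambda>x. column j (X x)) \<and>
          nondegenerate_normal_bundle_on U (\<lambda>x. column j (X x))) \<and>
     (\<forall>i j. \<forall>x\<in>U. normal_space (\<lambda>x. column i (X x)) x = normal_space (\<lambda>x. column j (X x)) x) \<and>
     (\<exists>(e :: 'k \<Rightarrow> real^'n option \<Rightarrow> real^('n option + 'k))
        (\<beta> :: real^'n option \<Rightarrow> real^'n option^'n option)
        (\<gamma> :: real^'n option \<Rightarrow> real^'n option^'k).
        smooth_on U \<beta> \<and> smooth_on U \<gamma> \<and> (\<forall>x\<in>U. \<beta> x \<in> O_n1) \<and>
        (\<forall>j. parallel_normal_frame_on U (\<lambda>x. column j (X x)) e \<and>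
             (\<forall>x\<in>U.
                first_fund (\<lambda>x. column j (X x)) x =
                  (\<chi> a b. if a = b then (\<beta> x $ j $ a)\<^sup>2 else 0) \<and>
                (\<forall>k. second_fund (\<lambda>x. column j (X x)) (e k) x =
                  (\<chi> a b. if a = b then \<beta> x $ j $ a * \<gamma> x $ k $ a else 0))) \<and>
             (\<exists>\<sigma>\<in>{1, -1}. \<forall>x\<in>U.
                (\<Sum>i\<in>UNIV. (\<beta> x $ j $ Some i)\<^sup>2) - (\<beta> x $ j $ None)\<^sup>2 = \<sigma>)))"


section \<open>Frames and the action of simple elements\<close>

(* The spectral parameter lambda is written mu. *)
definition frame_of ::
    "(real^'n::finite option) set \<Rightarrow>
     (real^'n option \<Rightarrow> complex \<Rightarrow>
        complex^(('n option + 'k::finite) + 'n option)^(('n option + 'k) + 'n option)) \<Rightarrow>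
     (real^'n option \<Rightarrow> real^'n option^('n option + 'k)) \<Rightarrow>
     (real^'n option \<Rightarrow> real^('n option + 'k)^('n option + 'k)) \<Rightarrow>
     (real^'n option \<Rightarrow> real^'n option^'n option) \<Rightarrow> bool" where
  "frame_of U E \<xi> A B \<longleftrightarrow>
     (\<forall>\<mu>. smooth_on U (\<lambda>x. E x \<mu>)) \<and>
     (\<forall>x\<in>U. \<forall>\<mu>.
        (\<forall>i. matrix_inv (E x \<mu>) ** pderiv_at i (\<lambda>y. E y \<mu>) x =
           cscale \<mu> (cmat (block 0 (- (D i ** J)) (transpose (D i)) 0)) +
           cmat (block (D i ** transpose (\<xi> x) - \<xi> x ** transpose (D i)) 0
                       0 (- (J ** transpose (\<xi> x) ** D i ** J) + transpose (D i) ** \<xi> x))) \<and>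
        map_matrix cnj (E x (cnj \<mu>)) = E x \<mu> \<and>
        cmat I_m_n1 ** E x \<mu> ** cmat I_m_n1 = E x (- \<mu>) \<and>
        transpose (E x \<mu>) ** cmat I_mn_1 ** E x \<mu> = cmat I_mn_1) \<and>
     (\<forall>x\<in>U. E x 0 = cmat (block (A x) 0 0 (B x)))"

definition vec_W_iZ :: "real^'m::finite \<Rightarrow> real^'i::finite \<Rightarrow> complex^('m + 'i)" where
  "vec_W_iZ W Z = (\<chi> a. case a of Inl b \<Rightarrow> complex_of_real (W $ b)
                                | Inr j \<Rightarrow> \<i> * complex_of_real (Z $ j))"

definition herm1 ::
    "complex^(('n::finite option + 'k::finite) + 'n option) \<Rightarrow>
     complex^(('n option + 'k) + 'n option) \<Rightarrow> complex" where
  "herm1 u v = (\<Sum>a\<in>UNIV. cnj (u $ a) * (cmat I_mn_1 *v v) $ a)"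

definition orth_projection_onto ::
    "complex^(('n::finite option + 'k::finite) + 'n option) \<Rightarrow>
     complex^(('n option + 'k) + 'n option)^(('n option + 'k) + 'n option) \<Rightarrow> bool" where
  "orth_projection_onto v p \<longleftrightarrow>
     p ** p = p \<and> range (\<lambda>u. p *v u) = range (\<lambda>c. c *s v) \<and>
     (\<forall>u w. herm1 (p *v u) (w - p *v w) = 0)"

definition simple_element ::
    "real \<Rightarrow> complex^'i::finite^'i \<Rightarrow> complex \<Rightarrow> complex^'i^'i" where
  "simple_element s p \<mu> =
     (p + cscale ((\<mu> - \<i> * s) / (\<mu> + \<i> * s)) (mat 1 - p)) **
     (map_matrix cnj p + cscale ((\<mu> + \<i> * s) / (\<mu> - \<i> * s)) (mat 1 - map_matrix cnj p))"

definition hat_W :: "(real^'i::finite \<Rightarrow> real^'m::finite) \<Rightarrow> real^'i \<Rightarrow> real^'m" where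
  "hat_W Wt x = Wt x /\<^sub>R norm (Wt x)"

definition hat_Z :: "(real^'n::finite option \<Rightarrow> real^'n option) \<Rightarrow> real^'n option \<Rightarrow> real^'n option" where
  "hat_Z Zt x = Zt x /\<^sub>R norm_n1 (Zt x)"

(* q = q_{s,pi} with pi the projection determined by W, Z; Wt, Zt are the real vectors with
   (Wt; i Zt) = E(x,-is)^{-1} (W; i Z), and (Ft,Gt,Bt,At) = q . (F,G,B,A) on U. *)
definition simple_element_action ::
    "(real^'n::finite option) set \<Rightarrow>
     (complex \<Rightarrow> complex^(('n option + 'k::finite) + 'n option)^(('n option + 'k) + 'n option)) \<Rightarrow>
     real \<Rightarrow> real^('n option + 'k) \<Rightarrow> real^'n option \<Rightarrow>
     (real^'n option \<Rightarrow> complex \<Rightarrow>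
        complex^(('n option + 'k) + 'n option)^(('n option + 'k) + 'n option)) \<Rightarrow>
     (real^'n option \<Rightarrow> real^'n option^'n option) \<Rightarrow> (real^'n option \<Rightarrow> real^'n option^'k) \<Rightarrow>
     (real^'n option \<Rightarrow> real^'n option^'n option) \<Rightarrow>
     (real^'n option \<Rightarrow> real^('n option + 'k)^('n option + 'k)) \<Rightarrow>
     (real^'n option \<Rightarrow> real^('n option + 'k)) \<Rightarrow> (real^'n option \<Rightarrow> real^'n option) \<Rightarrow>
     (real^'n option \<Rightarrow> real^'n option^'n option) \<Rightarrow> (real^'n option \<Rightarrow> real^'n option^'k) \<Rightarrow>
     (real^'n option \<Rightarrow> real^'n option^'n option) \<Rightarrow>
     (real^'n option \<Rightarrow> real^('n option + 'k)^('n option + 'k)) \<Rightarrow> bool" where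
  "simple_element_action U q s W Z E F G B A Wt Zt Ft Gt Bt At \<longleftrightarrow>
     (\<exists>p. orth_projection_onto (vec_W_iZ W Z) p \<and> q = simple_element s p) \<and>
     (\<forall>x\<in>U.
        vec_W_iZ (Wt x) (Zt x) = matrix_inv (E x (- (\<i> * s))) *v vec_W_iZ W Z \<and>
        stack (Ft x) (Gt x) =
          stack (F x) (G x) - (2 * s) *\<^sub>R off_diag (outer (hat_W Wt x) (hat_Z Zt x) ** J) \<and>
        At x = A x ** (mat 1 - 2 *\<^sub>R outer (hat_W Wt x) (hat_W Wt x)) \<and>
        Bt x = B x ** (mat 1 - 2 *\<^sub>R (outer (hat_Z Zt x) (hat_Z Zt x) ** J)))"

end

theory Submission
  imports Defs
begin

text \<open>
  Put \<open>w = A Wt\<close>, \<open>z = B Zt\<close> and \<open>N = \<bar>Wt\<bar>\<^sup>2\<close>. Since \<open>E\<close> preserves the form \<open>I_mn_1\<close>, the unit vectors \<open>W\<close> and \<open>Z\<close>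
  give \<open>N = form_n1 Zt\<close>, and the frame equation at \<open>-is\<close> reduces to \<open>\<partial>\<^sub>i w = s J\<^sub>i Zt\<^sub>i e\<^sub>i\<close>, \<open>\<partial>\<^sub>i z = s Wt\<^sub>i b\<^sub>i\<close>
  with \<open>b\<^sub>i\<close> the columns of \<open>B\<close>. The new frame is the image of the old one under the reflection along \<open>w\<close>,
  and \<open>Xt\<^sub>j - X\<^sub>j\<close> is the multiple \<open>2 J\<^sub>j z\<^sub>j / (s N)\<close> of \<open>w\<close>. Differentiating these formulas shows that \<open>Xt\<close>
  corresponds to the transformed solution. A line through \<open>X\<^sub>j\<close> and its reflected line through \<open>Xt\<^sub>j\<close> always
  meet at equal distances, because the base points differ by a multiple of \<open>w\<close>. Non-degeneracy of \<open>X\<^sub>j\<close> forces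
  every common principal direction to be a coordinate direction, for which this applies to the tangent lines.
\<close>

text \<open>The equations for \<open>w\<close> and \<open>z\<close> are free of \<open>F\<close> and
  \<open>G\<close> for a structural reason. The pair \<open>(w, iz)\<close> is \<open>E(x,0)\<close>
  applied to \<open>E(x,-is)^{-1} (W, iZ)\<close>, and the part of the connection that does not
  depend on the spectral parameter is the same at both values, so it cancels. What survives is the
  coupling term, linear in the parameter; its factor \<open>-is\<close> meets the \<open>i\<close>
  in front of \<open>Z\<close>, which keeps all equations real. The constant \<open>2 / s\<close> in
  the displacement cancels the factor \<open>s\<close> in these derivatives: with it, a partial
  derivative of the new tuple factors into an entry of the new \<open>B\<close> and a reflected
  frame vector. The equality of the two norms lets one scalar \<open>1 / N\<close> normalise both
  the Euclidean reflection along \<open>w\<close>, which acts on \<open>A\<close>, and the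
  indefinite reflection along \<open>z\<close>, which acts on \<open>B\<close>.\<close>

section \<open>Calculus of smooth functions\<close>

text \<open>On an open set the derivative at a point is determined by nearby values, so agreement on
  \<open>U\<close> passes to all directional derivatives. The transformed maps of the theorem are
  specified only on the domain, hence agreement there has to suffice.\<close>

lemma Ck_on_cong:
  assumes "open U" "\<And>x. x \<in> U \<Longrightarrow> f x = g x" "Ck_on k U f"
  shows "Ck_on k U g"
  using assms(2,3)
proof (induction k arbitrary: f g)
  case 0
  then show ?case by (simp cong: continuous_on_cong)
next
  case (Suc k)
  have fd: "(g has_derivative frechet_derivative f (at x)) (at x)" if "x \<in> U" for x
  proof -
    have "f differentiable (at x)"
      using Suc.prems(2) that assms(1) by (simp add: differentiable_on_eq_differentiable_at)
    then have "(f has_derivative frechet_derivative f (at x)) (at x)"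
      using frechet_derivative_works by blast
    then show ?thesis
      using Suc.prems(1) that assms(1) by (meson has_derivative_transform_within_open)
  qed
  have "g differentiable_on U"
    using fd assms(1) by (auto simp: differentiable_on_eq_differentiable_at differentiable_def)
  moreover have "Ck_on k U (\<lambda>x. frechet_derivative g (at x) v)" for v
  proof (rule Suc.IH)
    show "frechet_derivative f (at x) v = frechet_derivative g (at x) v" if "x \<in> U" for x
      using frechet_derivative_at[OF fd[OF that]] by simp
    show "Ck_on k U (\<lambda>x. frechet_derivative f (at x) v)"
      using Suc.prems(2) by simp
  qed
  ultimately show ?case by simp
qed

text \<open>Lets an explicitly computed derivative replace the choice operator
  \<open>frechet_derivative\<close> in the definition of \<open>Ck_on\<close>.\<close>

lemma Ck_on_SucI:
  assumes "open U" "\<And>x. x \<in> U \<Longrightarrow> (f has_derivative f' x) (at x)"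
    and "\<And>v. Ck_on k U (\<lambda>x. f' x v)"
  shows "Ck_on (Suc k) U f"
proof -
  have "f differentiable_on U"
    using assms(1,2) by (auto simp: differentiable_on_eq_differentiable_at differentiable_def)
  moreover have "Ck_on k U (\<lambda>x. frechet_derivative f (at x) v)" for v
    by (rule Ck_on_cong[OF assms(1) _ assms(3)[of v]])
       (use frechet_derivative_at[OF assms(2)] in auto)
  ultimately show ?thesis by simp
qed

lemma Ck_on_SucD:
  assumes "open U" "Ck_on (Suc k) U f"
  shows "\<And>x. x \<in> U \<Longrightarrow> (f has_derivative frechet_derivative f (at x)) (at x)"
    and "\<And>v. Ck_on k U (\<lambda>x. frechet_derivative f (at x) v)"
  using assms frechet_derivative_works
  by (auto simp: differentiable_on_eq_differentiable_at)

lemma Ck_on_Suc_imp: "Ck_on (Suc k) U f \<Longrightarrow> Ck_on k U f"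
proof (induction k arbitrary: f)
  case 0
  then show ?case by (simp add: differentiable_imp_continuous_on)
next
  case (Suc k)
  then show ?case by (meson Ck_on.simps(2))
qed

lemma Ck_on_subset:
  assumes "V \<subseteq> U" "Ck_on k U f"
  shows "Ck_on k V f"
  using assms(2)
proof (induction k arbitrary: f)
  case 0
  then show ?case using assms(1) continuous_on_subset by auto
next
  case (Suc k)
  then show ?case using assms(1) differentiable_on_subset by fastforce
qed

lemma Ck_on_const: "open U \<Longrightarrow> Ck_on k U (\<lambda>x. c)"
proof (induction k arbitrary: c)
  case 0
  then show ?case by simp
next
  case (Suc k)
  show ?case
    by (rule Ck_on_SucI[where f' = "\<lambda>x v. 0"]) (use Suc in \<open>auto intro!: derivative_eq_intros\<close>)
qed

lemma Ck_on_add: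
  assumes "open U" "Ck_on k U f" "Ck_on k U g"
  shows "Ck_on k U (\<lambda>x. f x + g x)"
  using assms(2,3)
proof (induction k arbitrary: f g)
  case 0
  then show ?case by (simp add: continuous_on_add)
next
  case (Suc k)
  note f = Ck_on_SucD[OF assms(1) Suc.prems(1)] and g = Ck_on_SucD[OF assms(1) Suc.prems(2)]
  show ?case
    by (rule Ck_on_SucI[OF assms(1) has_derivative_add[OF f(1) g(1)]]) (auto intro: Suc.IH f g)
qed

lemma Ck_on_bounded_linear:
  assumes "bounded_linear h" "open U" "Ck_on k U f"
  shows "Ck_on k U (\<lambda>x. h (f x))"
  using assms(3)
proof (induction k arbitrary: f)
  case 0
  then show ?case
    by (simp add: assms(1) bounded_linear.continuous_on)
next
  case (Suc k)
  note f = Ck_on_SucD[OF assms(2) Suc.prems(1)]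
  show ?case
    by (rule Ck_on_SucI[OF assms(2) bounded_linear.has_derivative[OF assms(1) f(1)]])
       (auto intro: Suc.IH f)
qed

text \<open>The Leibniz rule pairs a derivative with an undifferentiated factor. The latter has one
  order of smoothness to spare, which \<open>Ck_on_Suc_imp\<close> drops before the induction
  hypothesis applies.\<close>

lemma Ck_on_bounded_bilinear:
  assumes "bounded_bilinear h" "open U" "Ck_on k U f" "Ck_on k U g"
  shows "Ck_on k U (\<lambda>x. h (f x) (g x))"
  using assms(3,4)
proof (induction k arbitrary: f g)
  case 0
  then show ?case
    by (simp add: assms(1) bounded_bilinear.continuous_on)
next
  case (Suc k)
  note f = Ck_on_SucD[OF assms(2) Suc.prems(1)] and g = Ck_on_SucD[OF assms(2) Suc.prems(2)]
  show ?case
    by (rule Ck_on_SucI[OF assms(2) bounded_bilinear.FDERIV[OF assms(1) f(1) g(1)]])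
       (auto intro!: Suc.IH f g Ck_on_add assms(2) intro: Ck_on_Suc_imp Suc.prems)
qed

text \<open>A bootstrap: the derivative of the inverse contains the inverse itself, so order
  \<open>k\<close> of the inverse yields order \<open>Suc k\<close>.\<close>

lemma Ck_on_inverse:
  fixes f :: "'a::euclidean_space \<Rightarrow> real"
  assumes "open U" "Ck_on k U f" "\<And>x. x \<in> U \<Longrightarrow> f x \<noteq> 0"
  shows "Ck_on k U (\<lambda>x. inverse (f x))"
  using assms(2)
proof (induction k)
  case 0
  then show ?case by (simp add: assms(3) continuous_on_inverse)
next
  case (Suc k)
  note f = Ck_on_SucD[OF assms(1) Suc.prems(1)]
  have D: "((\<lambda>x. inverse (f x)) has_derivative
      (\<lambda>v. - (inverse (f x) * (frechet_derivative f (at x) v * inverse (f x))))) (at x)" if "x \<in> U" for x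
    using Deriv.has_derivative_inverse[OF assms(3)[OF that] f(1)[OF that]] by (simp add: mult.assoc)
  have "Ck_on k U (\<lambda>x. inverse (f x))"
    using Suc by (blast intro: Ck_on_Suc_imp)
  then have "Ck_on k U (\<lambda>x. inverse (f x) * (frechet_derivative f (at x) v * inverse (f x)))" for v
    by (intro Ck_on_bounded_bilinear[OF bounded_bilinear_mult] f(2) assms(1))
  then have "Ck_on k U (\<lambda>x. - (inverse (f x) * (frechet_derivative f (at x) v * inverse (f x))))" for v
    by (rule Ck_on_bounded_linear[OF bounded_linear_minus[OF bounded_linear_ident] assms(1)])
  then show ?case
    using Ck_on_SucI[OF assms(1) D] by blast
qed

lemma smooth_has_derivative:
  "open U \<Longrightarrow> smooth_on U f \<Longrightarrow> x \<in> U \<Longrightarrow> (f has_derivative frechet_derivative f (at x)) (at x)"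
  unfolding smooth_on_def using Ck_on_SucD(1) by blast

lemma smooth_on_cong:
  "open U \<Longrightarrow> (\<And>x. x \<in> U \<Longrightarrow> f x = g x) \<Longrightarrow> smooth_on U f \<Longrightarrow> smooth_on U g"
  unfolding smooth_on_def using Ck_on_cong by blast

lemma smooth_on_subset: "V \<subseteq> U \<Longrightarrow> smooth_on U f \<Longrightarrow> smooth_on V f"
  unfolding smooth_on_def using Ck_on_subset by blast

lemma smooth_on_const: "open U \<Longrightarrow> smooth_on U (\<lambda>x. c)"
  by (simp add: smooth_on_def Ck_on_const)

lemma smooth_on_add: "open U \<Longrightarrow> smooth_on U f \<Longrightarrow> smooth_on U g \<Longrightarrow> smooth_on U (\<lambda>x. f x + g x)"
  by (simp add: smooth_on_def Ck_on_add)

lemma smooth_on_bounded_linear: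
  "bounded_linear h \<Longrightarrow> open U \<Longrightarrow> smooth_on U f \<Longrightarrow> smooth_on U (\<lambda>x. h (f x))"
  by (simp add: smooth_on_def Ck_on_bounded_linear)

lemma smooth_on_bounded_bilinear:
  "bounded_bilinear h \<Longrightarrow> open U \<Longrightarrow> smooth_on U f \<Longrightarrow> smooth_on U g \<Longrightarrow> smooth_on U (\<lambda>x. h (f x) (g x))"
  by (simp add: smooth_on_def Ck_on_bounded_bilinear)

lemmas smooth_on_mult = smooth_on_bounded_bilinear[OF bounded_bilinear_mult]
  and smooth_on_scaleR = smooth_on_bounded_bilinear[OF bounded_bilinear_scaleR]
  and smooth_on_inner = smooth_on_bounded_bilinear[OF bounded_bilinear_inner]
  and smooth_on_minus = smooth_on_bounded_linear[OF bounded_linear_minus[OF bounded_linear_ident]]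
  and smooth_on_nth = smooth_on_bounded_linear[OF bounded_linear_vec_nth]

lemma smooth_on_diff:
  "open U \<Longrightarrow> smooth_on U f \<Longrightarrow> smooth_on U g \<Longrightarrow> smooth_on U (\<lambda>x. f x - g x)"
  using smooth_on_add[of U f "\<lambda>x. - g x"] smooth_on_minus[of U g] by simp

lemma smooth_on_divide:
  fixes f g :: "'a::euclidean_space \<Rightarrow> real"
  assumes "open U" "smooth_on U f" "smooth_on U g" "\<And>x. x \<in> U \<Longrightarrow> g x \<noteq> 0"
  shows "smooth_on U (\<lambda>x. f x / g x)"
proof -
  have "smooth_on U (\<lambda>x. inverse (g x))"
    using assms(3) Ck_on_inverse[OF assms(1) _ assms(4)] by (simp add: smooth_on_def)
  then show ?thesis
    unfolding divide_inverse by (intro smooth_on_mult assms(1,2))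
qed

lemma smooth_on_sum:
  "open U \<Longrightarrow> (\<And>i. i \<in> I \<Longrightarrow> smooth_on U (f i)) \<Longrightarrow> smooth_on U (\<lambda>x. \<Sum>i\<in>I. f i x)"
  by (induction I rule: infinite_finite_induct) (auto intro: smooth_on_const smooth_on_add)

lemma smooth_on_id: "open U \<Longrightarrow> smooth_on U (\<lambda>x. x)"
  unfolding smooth_on_def
proof
  fix k assume U: "open U"
  show "Ck_on k U (\<lambda>x. x)"
  proof (cases k)
    case (Suc l)
    show ?thesis
      unfolding Suc by (rule Ck_on_SucI[OF U has_derivative_ident]) (rule Ck_on_const[OF U])
  qed simp
qed

lemma bounded_linear_axis: "bounded_linear (axis i :: 'b::real_normed_vector \<Rightarrow> 'b^'n::finite)"
proof
  show "axis i (x + y) = (axis i x + axis i y :: 'b^'n)" for x y :: 'b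
    by (simp add: axis_def vec_eq_iff)
  show "axis i (r *\<^sub>R x) = (r *\<^sub>R axis i x :: 'b^'n)" for r and x :: 'b
    by (simp add: axis_def vec_eq_iff)
  have "norm (axis i x :: 'b^'n) \<le> norm x * 1" for x :: 'b
  proof -
    have "norm (axis i x :: 'b^'n) \<le> (\<Sum>j\<in>UNIV. norm ((axis i x :: 'b^'n) $ j))"
      unfolding norm_vec_def by (rule L2_set_le_sum) simp
    also have "\<dots> = norm x" by (simp add: axis_def if_distrib cong: if_cong)
    finally show ?thesis by simp
  qed
  then show "\<exists>K. \<forall>x. norm (axis i x :: 'b^'n) \<le> norm x * K" by blast
qed

lemma vec_eq_sum_axis: "(v :: 'b::comm_monoid_add^'n::finite) = (\<Sum>i\<in>UNIV. axis i (v $ i))"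
  by (simp add: vec_eq_iff axis_def if_distrib cong: if_cong)

text \<open>A vector is the sum of the axis embeddings of its coordinates, and each embedding is
  bounded linear. Two applications in a row reduce smoothness of a matrix to its entries.\<close>

lemma smooth_on_vecI:
  fixes f :: "'a::euclidean_space \<Rightarrow> 'b::real_normed_vector^'n::finite"
  assumes "open U" "\<And>i. smooth_on U (\<lambda>x. f x $ i)"
  shows "smooth_on U f"
proof -
  have "smooth_on U (\<lambda>x. \<Sum>i\<in>UNIV. axis i (f x $ i))"
    by (intro smooth_on_sum assms(1) smooth_on_bounded_linear[OF bounded_linear_axis] assms(2))
  then show ?thesis by (simp flip: vec_eq_sum_axis)
qed

section \<open>Partial derivatives\<close>

text \<open>Total differentiability is bundled with the value in one coordinate direction. Sum and
  product rules then compose by introduction rules alone, without differentiability side conditions,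
  and \<open>has_pderiv_eq\<close> adjusts the raw value at the end.\<close>

definition has_pderiv ::
    "(real^'p::finite \<Rightarrow> 'b::real_normed_vector) \<Rightarrow> 'p \<Rightarrow> 'b \<Rightarrow> real^'p \<Rightarrow> bool" where
  "has_pderiv f a d x \<longleftrightarrow> (\<exists>f'. (f has_derivative f') (at x) \<and> f' (axis a 1) = d)"

lemma has_pderiv_eq: "has_pderiv f a d x \<Longrightarrow> d = d' \<Longrightarrow> has_pderiv f a d' x"
  by simp

lemma has_pderiv_imp: "has_pderiv f a d x \<Longrightarrow> pderiv_at a f x = d"
  unfolding has_pderiv_def pderiv_at_def using frechet_derivative_at by metis

lemma smooth_has_pderiv:
  assumes "open U" "smooth_on U f" "x \<in> U"
  shows "has_pderiv f a (pderiv_at a f x) x"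
  unfolding has_pderiv_def pderiv_at_def using smooth_has_derivative[OF assms] by blast

lemma smooth_on_pderiv: "smooth_on U f \<Longrightarrow> smooth_on U (pderiv_at a f)"
  unfolding smooth_on_def pderiv_at_def by (metis Ck_on.simps(2))

lemma has_pderiv_cong:
  assumes "open U" "x \<in> U" "\<And>y. y \<in> U \<Longrightarrow> f y = g y" "has_pderiv f a d x"
  shows "has_pderiv g a d x"
  using assms has_derivative_transform_within_open unfolding has_pderiv_def by metis

lemma has_pderiv_const: "has_pderiv (\<lambda>x. c) a 0 x"
  unfolding has_pderiv_def by (intro exI[of _ "\<lambda>_. 0"]) simp

lemma has_pderiv_add:
  "has_pderiv f a f' x \<Longrightarrow> has_pderiv g a g' x \<Longrightarrow> has_pderiv (\<lambda>x. f x + g x) a (f' + g') x"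
  unfolding has_pderiv_def by (elim exE conjE, rule exI, rule conjI, erule has_derivative_add, assumption) simp

lemma has_pderiv_diff:
  "has_pderiv f a f' x \<Longrightarrow> has_pderiv g a g' x \<Longrightarrow> has_pderiv (\<lambda>x. f x - g x) a (f' - g') x"
  unfolding has_pderiv_def by (elim exE conjE, rule exI, rule conjI, erule has_derivative_diff, assumption) simp

lemma has_pderiv_bounded_linear:
  "bounded_linear h \<Longrightarrow> has_pderiv f a f' x \<Longrightarrow> has_pderiv (\<lambda>x. h (f x)) a (h f') x"
  unfolding has_pderiv_def using bounded_linear.has_derivative by blast

lemma has_pderiv_bounded_bilinear:
  "bounded_bilinear h \<Longrightarrow> has_pderiv f a f' x \<Longrightarrow> has_pderiv g a g' x \<Longrightarrow>
   has_pderiv (\<lambda>x. h (f x) (g x)) a (h (f x) g' + h f' (g x)) x"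
  unfolding has_pderiv_def
  by (elim exE conjE, rule exI, rule conjI, erule bounded_bilinear.FDERIV, assumption+) simp

lemmas has_pderiv_mult = has_pderiv_bounded_bilinear[OF bounded_bilinear_mult]
  and has_pderiv_scaleR = has_pderiv_bounded_bilinear[OF bounded_bilinear_scaleR]
  and has_pderiv_inner = has_pderiv_bounded_bilinear[OF bounded_bilinear_inner]
  and has_pderiv_nth = has_pderiv_bounded_linear[OF bounded_linear_vec_nth]

lemma has_pderiv_sum:
  "(\<And>i. i \<in> I \<Longrightarrow> has_pderiv (f i) a (f' i) x) \<Longrightarrow>
   has_pderiv (\<lambda>x. \<Sum>i\<in>I. f i x) a (\<Sum>i\<in>I. f' i) x"
  by (induction I rule: infinite_finite_induct) (simp_all add: has_pderiv_const has_pderiv_add)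

lemma has_pderiv_inverse:
  fixes f :: "real^'p::finite \<Rightarrow> real"
  assumes "has_pderiv f a f' x" "f x \<noteq> 0"
  shows "has_pderiv (\<lambda>x. inverse (f x)) a (- (f' / (f x)\<^sup>2)) x"
proof -
  obtain d where d: "(f has_derivative d) (at x)" "d (axis a 1) = f'"
    using assms(1) unfolding has_pderiv_def by blast
  have "((\<lambda>x. inverse (f x)) has_derivative (\<lambda>h. - (inverse (f x) * d h * inverse (f x)))) (at x)"
    by (rule Deriv.has_derivative_inverse[OF assms(2) d(1)])
  moreover have "- (inverse (f x) * d (axis a 1) * inverse (f x)) = - (f' / (f x)\<^sup>2)"
    using d(2) by (simp add: field_simps power2_eq_square)
  ultimately show ?thesis
    unfolding has_pderiv_def by blast
qed

lemma differential_apply: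
  fixes X :: "real^'p::finite \<Rightarrow> real^'q::finite"
  assumes "open U" "smooth_on U X" "x \<in> U"
  shows "differential X x u = (\<Sum>i\<in>UNIV. u $ i *\<^sub>R pderiv_at i X x)"
proof -
  have lin: "linear (frechet_derivative X (at x))"
    using smooth_has_derivative[OF assms] by (rule has_derivative_linear)
  have "u = (\<Sum>i\<in>UNIV. u $ i *\<^sub>R axis i 1)"
    by (simp add: vec_eq_iff axis_def if_distrib cong: if_cong)
  then have "frechet_derivative X (at x) u = frechet_derivative X (at x) (\<Sum>i\<in>UNIV. u $ i *\<^sub>R axis i 1)"
    by simp
  then show ?thesis
    by (simp add: differential_def pderiv_at_def linear_sum[OF lin] linear_cmul[OF lin])
qed

section \<open>Symmetry of second partial derivatives\<close>

lemma pderiv_line: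
  fixes f :: "real^'p::finite \<Rightarrow> real"
  assumes "open U" "smooth_on U f" "p + t *\<^sub>R axis a 1 \<in> U"
  shows "((\<lambda>t. f (p + t *\<^sub>R axis a 1)) has_real_derivative
          pderiv_at a f (p + t *\<^sub>R axis a 1)) (at t)"
proof -
  let ?q = "p + t *\<^sub>R axis a 1"
  have f: "(f has_derivative frechet_derivative f (at ?q)) (at ?q)"
    by (rule smooth_has_derivative[OF assms])
  have "((\<lambda>t. p + t *\<^sub>R axis a 1) has_derivative (\<lambda>h. h *\<^sub>R axis a 1)) (at t)"
    by (auto intro!: derivative_eq_intros)
  from has_derivative_compose[OF this f]
  have "((\<lambda>t. f (p + t *\<^sub>R axis a 1)) has_derivative
      (\<lambda>h. frechet_derivative f (at ?q) (h *\<^sub>R axis a 1))) (at t)" .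
  moreover have "frechet_derivative f (at ?q) (h *\<^sub>R axis a 1) = pderiv_at a f ?q * h" for h
    using has_derivative_linear[OF f] by (simp add: linear_cmul pderiv_at_def)
  ultimately show ?thesis
    by (simp add: has_field_derivative_def)
qed

text \<open>The mean value theorem is applied first in direction \<open>a\<close>, to the difference
  of \<open>f\<close> along two parallel segments, then in direction \<open>b\<close> to the
  derivative so obtained. The radius \<open>2 * h\<close> covers two steps of length at most
  \<open>h\<close>.\<close>

lemma second_difference_mvt:
  fixes f :: "real^'p::finite \<Rightarrow> real"
  assumes U: "open U" "smooth_on U f" and h: "h > 0" "cball x (2 * h) \<subseteq> U"
  shows "\<exists>p\<in>cball x (2 * h). f (x + h *\<^sub>R axis a 1 + h *\<^sub>R axis b 1) - f (x + h *\<^sub>R axis a 1)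
           - f (x + h *\<^sub>R axis b 1) + f x = h * h * pderiv_at b (pderiv_at a f) p"
proof -
  let ?u = "axis a 1 :: real^'p" and ?v = "axis b 1 :: real^'p"
  have in_ball: "x + \<sigma> *\<^sub>R ?u + \<tau> *\<^sub>R ?v \<in> cball x (2 * h)"
    if "0 \<le> \<sigma>" "\<sigma> \<le> h" "0 \<le> \<tau>" "\<tau> \<le> h" for \<sigma> \<tau>
  proof -
    have "norm (\<sigma> *\<^sub>R ?u + \<tau> *\<^sub>R ?v) \<le> norm (\<sigma> *\<^sub>R ?u) + norm (\<tau> *\<^sub>R ?v)"
      by (rule norm_triangle_ineq)
    then have "norm (\<sigma> *\<^sub>R ?u + \<tau> *\<^sub>R ?v) \<le> 2 * h"
      using that by simp
    moreover have "dist x (x + \<sigma> *\<^sub>R ?u + \<tau> *\<^sub>R ?v) = norm (\<sigma> *\<^sub>R ?u + \<tau> *\<^sub>R ?v)"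
      by (metis add.assoc add_diff_cancel_left' dist_norm norm_minus_commute)
    ultimately show ?thesis by simp
  qed
  define g where "g \<sigma> = f ((x + h *\<^sub>R ?v) + \<sigma> *\<^sub>R ?u) - f (x + \<sigma> *\<^sub>R ?u)" for \<sigma>
  have g': "(g has_real_derivative pderiv_at a f ((x + h *\<^sub>R ?v) + \<sigma> *\<^sub>R ?u) - pderiv_at a f (x + \<sigma> *\<^sub>R ?u)) (at \<sigma>)"
    if "0 \<le> \<sigma>" "\<sigma> \<le> h" for \<sigma>
    unfolding g_def
    by (intro DERIV_diff pderiv_line[OF U])
       (use in_ball[of \<sigma> h] in_ball[of \<sigma> 0] that h in \<open>auto simp: ac_simps\<close>)
  obtain \<sigma> where \<sigma>: "0 < \<sigma>" "\<sigma> < h"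
    "g h - g 0 = (h - 0) * (pderiv_at a f ((x + h *\<^sub>R ?v) + \<sigma> *\<^sub>R ?u) - pderiv_at a f (x + \<sigma> *\<^sub>R ?u))"
    using MVT2[OF h(1) g'] by blast
  have k': "((\<lambda>\<tau>. pderiv_at a f ((x + \<sigma> *\<^sub>R ?u) + \<tau> *\<^sub>R ?v)) has_real_derivative
      pderiv_at b (pderiv_at a f) ((x + \<sigma> *\<^sub>R ?u) + \<tau> *\<^sub>R ?v)) (at \<tau>)"
    if "0 \<le> \<tau>" "\<tau> \<le> h" for \<tau>
    by (intro pderiv_line[OF U(1) smooth_on_pderiv[OF U(2)]])
       (use in_ball[of \<sigma> \<tau>] \<sigma> that h in auto)
  obtain \<tau> where \<tau>: "0 < \<tau>" "\<tau> < h"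
    "pderiv_at a f ((x + \<sigma> *\<^sub>R ?u) + h *\<^sub>R ?v) - pderiv_at a f ((x + \<sigma> *\<^sub>R ?u) + 0 *\<^sub>R ?v) =
     (h - 0) * pderiv_at b (pderiv_at a f) ((x + \<sigma> *\<^sub>R ?u) + \<tau> *\<^sub>R ?v)"
    using MVT2[OF h(1) k'] by blast
  have "g h - g 0 = h * h * pderiv_at b (pderiv_at a f) ((x + \<sigma> *\<^sub>R ?u) + \<tau> *\<^sub>R ?v)"
    using \<sigma>(3) \<tau>(3) by (simp add: ac_simps)
  moreover have "g h - g 0 = f (x + h *\<^sub>R ?u + h *\<^sub>R ?v) - f (x + h *\<^sub>R ?u) - f (x + h *\<^sub>R ?v) + f x"
    by (simp add: g_def ac_simps)
  moreover have "x + \<sigma> *\<^sub>R ?u + \<tau> *\<^sub>R ?v \<in> cball x (2 * h)"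
    using in_ball \<sigma> \<tau> by simp
  ultimately show ?thesis by metis
qed

text \<open>The second difference is symmetric in \<open>a\<close> and \<open>b\<close>, so one
  mixed derivative at some \<open>q\<close> equals the other at some \<open>p\<close>, both near
  \<open>x\<close>; continuity carries the equality to \<open>x\<close>.\<close>

lemma pderiv_commute:
  fixes f :: "real^'p::finite \<Rightarrow> real"
  assumes "open U" "smooth_on U f" "x \<in> U"
  shows "pderiv_at a (pderiv_at b f) x = pderiv_at b (pderiv_at a f) x"
proof (rule ccontr)
  let ?P = "pderiv_at a (pderiv_at b f)" and ?Q = "pderiv_at b (pderiv_at a f)"
  assume "?P x \<noteq> ?Q x"
  define \<epsilon> where "\<epsilon> = \<bar>?P x - ?Q x\<bar> / 2"
  have \<epsilon>: "\<epsilon> > 0" using \<open>?P x \<noteq> ?Q x\<close> by (simp add: \<epsilon>_def)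
  have "continuous_on U ?P" "continuous_on U ?Q"
    using smooth_on_pderiv[OF smooth_on_pderiv[OF assms(2)]]
    unfolding smooth_on_def by (metis Ck_on.simps(1))+
  then have "isCont ?P x" "isCont ?Q x"
    using assms by (simp_all add: continuous_on_eq_continuous_at)
  then obtain d1 d2 where d: "d1 > 0" "\<And>y. dist y x < d1 \<Longrightarrow> \<bar>?P y - ?P x\<bar> < \<epsilon>"
    "d2 > 0" "\<And>y. dist y x < d2 \<Longrightarrow> \<bar>?Q y - ?Q x\<bar> < \<epsilon>"
    unfolding continuous_at_eps_delta dist_real_def using \<epsilon> by metis
  obtain r where r: "r > 0" "cball x r \<subseteq> U"
    using assms open_contains_cball by blast
  \<comment> \<open>Then \<open>2 * h\<close> is at most \<open>r\<close>, and the inner halves keep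
    it strictly below \<open>d1\<close> and \<open>d2\<close>.\<close>
  define h where "h = min r (min (d1/2) (d2/2)) / 2"
  have h: "h > 0" "cball x (2 * h) \<subseteq> U" "2 * h < d1" "2 * h < d2"
    using r d(1,3) by (auto simp: h_def min_def split: if_splits)
  obtain p where p: "p \<in> cball x (2*h)"
      "f (x + h *\<^sub>R axis a 1 + h *\<^sub>R axis b 1) - f (x + h *\<^sub>R axis a 1)
           - f (x + h *\<^sub>R axis b 1) + f x = h * h * ?Q p"
    using second_difference_mvt[OF assms(1,2) h(1,2), of a b] by blast
  obtain q where q: "q \<in> cball x (2*h)"
      "f (x + h *\<^sub>R axis b 1 + h *\<^sub>R axis a 1) - f (x + h *\<^sub>R axis b 1)
           - f (x + h *\<^sub>R axis a 1) + f x = h * h * ?P q"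
    using second_difference_mvt[OF assms(1,2) h(1,2), of b a] by blast
  have "h * h * ?P q = h * h * ?Q p"
    using p(2) q(2) unfolding add.assoc add.commute[of "h *\<^sub>R axis b 1"] by linarith
  then have "?P q = ?Q p" using h(1) by simp
  moreover have "\<bar>?P q - ?P x\<bar> < \<epsilon>" "\<bar>?Q p - ?Q x\<bar> < \<epsilon>"
    using p(1) q(1) h d by (auto simp: dist_commute)
  ultimately have "\<bar>?P x - ?Q x\<bar> < 2 * \<epsilon>" by linarith
  then show False by (simp add: \<epsilon>_def)
qed

section \<open>Parametrisations by lines of curvature\<close>

lemma matrix_inv_unique:
  fixes M N :: "'a::semiring_1^'n::finite^'n"
  assumes "M ** N = mat 1" "N ** M = mat 1"
  shows "matrix_inv M = N"
proof -
  have "M ** matrix_inv M = mat 1"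
    using assms unfolding matrix_inv_def by (metis (mono_tags, lifting) someI_ex)
  then show ?thesis
    by (metis assms(2) matrix_mul_assoc matrix_mul_lid matrix_mul_rid)
qed

lemma scaleR_delta: "(if P then r else 0) *\<^sub>R v = (if P then r *\<^sub>R v else 0)"
  for v :: "'a::real_vector"
  by simp

definition diag :: "('p::finite \<Rightarrow> real) \<Rightarrow> real^'p^'p" where
  "diag d = (\<chi> a b. if a = b then d a else 0)"

lemma diag_mult: "diag c ** diag d = diag (\<lambda>a. c a * d a)"
  by (simp add: diag_def matrix_matrix_mult_def vec_eq_iff mult_delta_left mult_delta_right)

lemma diag_vector_mult: "diag d *v u = (\<chi> a. d a * u $ a)"
  by (simp add: diag_def matrix_vector_mult_def vec_eq_iff mult_delta_left mult_delta_right)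

lemma matrix_inv_diag:
  assumes "\<And>a. d a \<noteq> 0"
  shows "matrix_inv (diag d) = diag (\<lambda>a. 1 / d a)"
proof -
  have "diag (\<lambda>a. 1) = mat 1"
    by (simp add: diag_def mat_def vec_eq_iff)
  then show ?thesis
    by (intro matrix_inv_unique) (simp_all add: diag_mult assms)
qed

lemma sum_UNIV_Plus: "(\<Sum>c\<in>UNIV. f c) = (\<Sum>i\<in>UNIV. f (Inl i)) + (\<Sum>k\<in>UNIV. f (Inr k))"
  for f :: "'i::finite + 'j::finite \<Rightarrow> 'b::comm_monoid_add"
  by (subst UNIV_Plus_UNIV[symmetric], subst sum.Plus) simp_all

text \<open>The common situation of all members of the old and the new tuple, so that the geometry
  is done once. The first columns of \<open>A\<close> are unit vectors along the coordinate lines,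
  with signed speeds \<open>h\<close>. The remaining columns have tangent derivatives and are
  therefore parallel normal fields, and \<open>g / h\<close> gives the principal curvatures.\<close>

locale curvature_line_param =
  fixes U :: "(real^'p::finite) set" and Y :: "real^'p \<Rightarrow> real^('p + 'k::finite)"
    and A :: "real^'p \<Rightarrow> real^('p + 'k)^('p + 'k)" and h :: "real^'p \<Rightarrow> real^'p"
    and g :: "real^'p \<Rightarrow> real^'p^'k"
  assumes open_U: "open U" and smooth_Y: "smooth_on U Y" and smooth_A: "smooth_on U A"
    and orthogonal_A: "x \<in> U \<Longrightarrow> orthogonal_matrix (A x)"
    and pderiv_Y: "x \<in> U \<Longrightarrow> pderiv_at i Y x = h x $ i *\<^sub>R column (Inl i) (A x)"
    and pderiv_normal: "x \<in> U \<Longrightarrow>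
          pderiv_at i (\<lambda>y. column (Inr k) (A y)) x = g x $ k $ i *\<^sub>R column (Inl i) (A x)"
    and h_nonzero: "x \<in> U \<Longrightarrow> h x $ i \<noteq> 0"
begin

abbreviation e :: "'p + 'k \<Rightarrow> real^'p \<Rightarrow> real^('p + 'k)" where
  "e c x \<equiv> column c (A x)"

lemma e_inner: "x \<in> U \<Longrightarrow> e c x \<bullet> e d x = (if c = d then 1 else 0)"
  using orthogonal_A[of x]
  by (auto simp: orthogonal_matrix_orthonormal_columns pairwise_def orthogonal_def norm_eq_1)

lemma e_expand: "x \<in> U \<Longrightarrow> (\<Sum>c\<in>UNIV. (v \<bullet> e c x) *\<^sub>R e c x) = v"
proof -
  assume x: "x \<in> U"
  have "A x *v (transpose (A x) *v v) = v"
    using orthogonal_A[OF x]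
    by (simp only: orthogonal_matrix_def matrix_vector_mul_assoc matrix_vector_mul_lid)
  moreover have "(transpose (A x) *v v) $ c = v \<bullet> e c x" for c
    by (simp add: matrix_vector_mult_def transpose_def column_def inner_vec_def mult.commute)
  ultimately show ?thesis
    by (simp add: matrix_mult_sum scalar_mult_eq_scaleR)
qed

lemma e_split: "x \<in> U \<Longrightarrow>
    (\<Sum>i\<in>UNIV. (v \<bullet> e (Inl i) x) *\<^sub>R e (Inl i) x) + (\<Sum>k\<in>UNIV. (v \<bullet> e (Inr k) x) *\<^sub>R e (Inr k) x) = v"
  using e_expand[of x v] unfolding sum_UNIV_Plus .

lemma smooth_e: "smooth_on U (e c)"
  by (rule smooth_on_vecI[OF open_U]) (simp add: column_def smooth_on_nth open_U smooth_A)

lemma differential_Y: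
  "x \<in> U \<Longrightarrow> differential Y x u = (\<Sum>i\<in>UNIV. (u $ i * h x $ i) *\<^sub>R e (Inl i) x)"
  by (simp add: differential_apply[OF open_U smooth_Y] pderiv_Y)

lemma differential_Y_axis: "x \<in> U \<Longrightarrow> differential Y x (axis a r) = (r * h x $ a) *\<^sub>R e (Inl a) x"
  by (simp add: differential_Y axis_def mult_delta_left scaleR_delta)

lemma sum_e_inner:
  "x \<in> U \<Longrightarrow> (\<Sum>i\<in>UNIV. c i *\<^sub>R e (Inl i) x) \<bullet> e (Inl a) x = c a"
  "x \<in> U \<Longrightarrow> (\<Sum>i\<in>UNIV. c i *\<^sub>R e (Inl i) x) \<bullet> e (Inr k) x = 0"
  "x \<in> U \<Longrightarrow> (\<Sum>k\<in>UNIV. d k *\<^sub>R e (Inr k) x) \<bullet> e (Inl a) x = 0"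
  "x \<in> U \<Longrightarrow> (\<Sum>k\<in>UNIV. d k *\<^sub>R e (Inr k) x) \<bullet> e (Inr l) x = d l"
  by (simp_all add: inner_sum_left e_inner mult_delta_right)

lemma tangent_space_iff:
  assumes x: "x \<in> U"
  shows "v \<in> tangent_space Y x \<longleftrightarrow> (\<forall>k. v \<bullet> e (Inr k) x = 0)"
proof
  assume "v \<in> tangent_space Y x"
  then show "\<forall>k. v \<bullet> e (Inr k) x = 0"
    by (auto simp: tangent_space_def differential_Y x sum_e_inner)
next
  assume v: "\<forall>k. v \<bullet> e (Inr k) x = 0"
  have "differential Y x (\<chi> i. v \<bullet> e (Inl i) x / h x $ i) = v"
    using e_split[OF x, of v] v by (simp add: differential_Y x h_nonzero)
  then show "v \<in> tangent_space Y x"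
    unfolding tangent_space_def by (metis rangeI)
qed

lemma normal_space_iff:
  assumes x: "x \<in> U"
  shows "v \<in> normal_space Y x \<longleftrightarrow> (\<forall>i. v \<bullet> e (Inl i) x = 0)"
proof
  assume v: "v \<in> normal_space Y x"
  have "e (Inl i) x \<in> tangent_space Y x" for i
    by (simp add: tangent_space_iff x e_inner)
  then show "\<forall>i. v \<bullet> e (Inl i) x = 0"
    using v by (auto simp: normal_space_def orthogonal_comp_def orthogonal_def inner_commute)
next
  assume v: "\<forall>i. v \<bullet> e (Inl i) x = 0"
  have "orthogonal w v" if "w \<in> tangent_space Y x" for w
  proof -
    have "(\<Sum>i\<in>UNIV. (w \<bullet> e (Inl i) x) *\<^sub>R e (Inl i) x) = w"
      using e_split[OF x, of w] that by (simp add: tangent_space_iff x)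
    then have "w \<bullet> v = (\<Sum>i\<in>UNIV. (w \<bullet> e (Inl i) x) *\<^sub>R e (Inl i) x) \<bullet> v" by simp
    also have "\<dots> = 0" using v by (simp add: inner_sum_right inner_commute[of _ v])
    finally show ?thesis by (simp add: orthogonal_def)
  qed
  then show "v \<in> normal_space Y x"
    by (simp add: normal_space_def orthogonal_comp_def)
qed

lemma normal_expand:
  "x \<in> U \<Longrightarrow> v \<in> normal_space Y x \<Longrightarrow> (\<Sum>k\<in>UNIV. (v \<bullet> e (Inr k) x) *\<^sub>R e (Inr k) x) = v"
  using e_split[of x v] by (simp add: normal_space_iff)

lemma normal_part_eq:
  assumes x: "x \<in> U"
  shows "normal_part Y x v = (\<Sum>k\<in>UNIV. (v \<bullet> e (Inr k) x) *\<^sub>R e (Inr k) x)"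
  unfolding normal_part_def
proof (rule the_equality)
  show "(\<Sum>k\<in>UNIV. (v \<bullet> e (Inr k) x) *\<^sub>R e (Inr k) x) \<in> normal_space Y x \<and>
        v - (\<Sum>k\<in>UNIV. (v \<bullet> e (Inr k) x) *\<^sub>R e (Inr k) x) \<in> tangent_space Y x"
    by (simp add: normal_space_iff tangent_space_iff x sum_e_inner inner_diff_left)
  fix w assume w: "w \<in> normal_space Y x \<and> v - w \<in> tangent_space Y x"
  then have "v \<bullet> e (Inr k) x = w \<bullet> e (Inr k) x" for k
    by (simp add: tangent_space_iff x inner_diff_left)
  then show "w = (\<Sum>k\<in>UNIV. (v \<bullet> e (Inr k) x) *\<^sub>R e (Inr k) x)"
    using normal_expand[OF x, of w] w by simp
qed

lemma immersion: "immersion_on U Y"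
proof -
  have "inj (differential Y x)" if x: "x \<in> U" for x
  proof (rule injI)
    fix u v assume "differential Y x u = differential Y x v"
    then have "differential Y x u \<bullet> e (Inl i) x = differential Y x v \<bullet> e (Inl i) x" for i by simp
    then show "u = v"
      using h_nonzero[OF x] by (simp add: differential_Y x sum_e_inner vec_eq_iff)
  qed
  then show ?thesis by (simp add: immersion_on_def smooth_Y)
qed

lemma first_fund_eq: "x \<in> U \<Longrightarrow> first_fund Y x = diag (\<lambda>a. (h x $ a)\<^sup>2)"
  by (simp add: first_fund_def diag_def vec_eq_iff pderiv_Y e_inner power2_eq_square)

lemma second_fund_eq: "x \<in> U \<Longrightarrow> second_fund Y (e (Inr k)) x = diag (\<lambda>a. h x $ a * g x $ k $ a)"
  by (simp add: second_fund_def diag_def vec_eq_iff pderiv_Y pderiv_normal e_inner)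

text \<open>Differentiating the orthogonality of \<open>e (Inr k)\<close> and the coordinate fields
  trades second derivatives of \<open>Y\<close> for the known derivatives of the normal. The
  vanishing for distinct \<open>a\<close> and \<open>b\<close> says that the coordinate lines are
  lines of curvature.\<close>

lemma pderiv_pderiv_Y:
  assumes x: "x \<in> U"
  shows "e (Inr k) x \<bullet> pderiv_at b (pderiv_at a Y) x = (if a = b then - (h x $ a * g x $ k $ a) else 0)"
proof -
  have 1: "has_pderiv (\<lambda>y. e (Inr k) y \<bullet> pderiv_at a Y y) b
      (e (Inr k) x \<bullet> pderiv_at b (pderiv_at a Y) x + pderiv_at b (e (Inr k)) x \<bullet> pderiv_at a Y x) x"
    by (intro has_pderiv_inner smooth_has_pderiv[OF open_U] smooth_e smooth_on_pderiv smooth_Y x)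
  have 2: "has_pderiv (\<lambda>y. e (Inr k) y \<bullet> pderiv_at a Y y) b 0 x"
    by (rule has_pderiv_cong[OF open_U x _ has_pderiv_const]) (simp add: pderiv_Y e_inner)
  have "e (Inr k) x \<bullet> pderiv_at b (pderiv_at a Y) x
      + pderiv_at b (e (Inr k)) x \<bullet> pderiv_at a Y x = 0"
    by (rule trans[OF has_pderiv_imp[OF 1, symmetric] has_pderiv_imp[OF 2]])
  then show ?thesis
    by (auto simp: pderiv_Y pderiv_normal x e_inner algebra_simps split: if_splits)
qed

lemma shape_operator_eq:
  assumes x: "x \<in> U" and v: "v \<in> normal_space Y x"
  shows "shape_operator Y x v = diag (\<lambda>a. (\<Sum>k\<in>UNIV. (v \<bullet> e (Inr k) x) * g x $ k $ a) / h x $ a)"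
proof -
  have *: "v \<bullet> w = (\<Sum>k\<in>UNIV. (v \<bullet> e (Inr k) x) * (e (Inr k) x \<bullet> w))" for w
    by (subst normal_expand[OF x v, symmetric]) (simp add: inner_sum_left)
  have "v \<bullet> pderiv_at b (pderiv_at a Y) x =
      (if a = b then - (h x $ a * (\<Sum>k\<in>UNIV. (v \<bullet> e (Inr k) x) * g x $ k $ a)) else 0)" for a b
    by (subst *) (simp add: pderiv_pderiv_Y x sum_distrib_left sum_negf ac_simps)
  then have "(\<chi> a b. - (v \<bullet> pderiv_at b (pderiv_at a Y) x)) =
      diag (\<lambda>a. h x $ a * (\<Sum>k\<in>UNIV. (v \<bullet> e (Inr k) x) * g x $ k $ a))"
    by (simp add: diag_def vec_eq_iff)
  then show ?thesis
    by (simp add: shape_operator_def first_fund_eq x matrix_inv_diag h_nonzero diag_mult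
        power2_eq_square)
qed

lemma eigenvector_axis:
  assumes "x \<in> U" "v \<in> normal_space Y x" "r \<noteq> 0"
  shows "eigenvector (shape_operator Y x v) (axis a r)"
proof -
  have "shape_operator Y x v *v axis a r =
      ((\<Sum>k\<in>UNIV. (v \<bullet> e (Inr k) x) * g x $ k $ a) / h x $ a) *\<^sub>R axis a r"
    by (simp add: shape_operator_eq assms diag_vector_mult vec_eq_iff axis_def)
  then show ?thesis
    using assms(3) unfolding eigenvector_def by auto
qed

lemma principal_frame: "principal_frame_on U Y (\<lambda>i. e (Inl i))"
  unfolding principal_frame_on_def
proof (intro conjI allI ballI)
  fix i x assume x: "x \<in> U"
  have "e (Inl i) x = differential Y x (axis i (1 / h x $ i))"
    using h_nonzero[OF x] by (simp add: differential_Y_axis x)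
  moreover have "principal_direction Y x (axis i (1 / h x $ i))"
    unfolding principal_direction_def using h_nonzero[OF x] by (simp add: eigenvector_axis x)
  ultimately show "\<exists>u. e (Inl i) x = differential Y x u \<and> principal_direction Y x u" by blast
next
  fix x assume x: "x \<in> U"
  show "span (range (\<lambda>i. e (Inl i) x)) = tangent_space Y x"
  proof
    have "subspace (tangent_space Y x)"
      unfolding subspace_def by (simp add: tangent_space_iff x inner_add_left)
    moreover have "range (\<lambda>i. e (Inl i) x) \<subseteq> tangent_space Y x"
      by (auto simp: tangent_space_iff x e_inner)
    ultimately show "span (range (\<lambda>i. e (Inl i) x)) \<subseteq> tangent_space Y x"
      by (rule span_minimal[rotated])
    show "tangent_space Y x \<subseteq> span (range (\<lambda>i. e (Inl i) x))"
    proof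
      fix v assume "v \<in> tangent_space Y x"
      then show "v \<in> span (range (\<lambda>i. e (Inl i) x))"
        by (subst e_split[OF x, symmetric])
           (auto simp: tangent_space_iff x intro!: span_sum span_scale intro: span_base)
    qed
  qed
qed (auto simp: smooth_e e_inner)

text \<open>The derivatives of the normal frame vectors are tangent and disappear in the normal
  projection, so in this frame the normal connection is plain differentiation of
  coefficients.\<close>

lemma normal_connection_sum:
  assumes x: "x \<in> U" and d: "\<And>k. smooth_on U (d k)"
    and \<zeta>: "\<And>y. y \<in> U \<Longrightarrow> \<zeta> y = (\<Sum>k\<in>UNIV. d k y *\<^sub>R e (Inr k) y)"
  shows "normal_connection Y a \<zeta> x = (\<Sum>k\<in>UNIV. pderiv_at a (d k) x *\<^sub>R e (Inr k) x)"
proof -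
  have "has_pderiv (\<lambda>y. \<Sum>k\<in>UNIV. d k y *\<^sub>R e (Inr k) y) a
      (\<Sum>k\<in>UNIV. d k x *\<^sub>R pderiv_at a (e (Inr k)) x + pderiv_at a (d k) x *\<^sub>R e (Inr k) x) x"
    by (intro has_pderiv_sum has_pderiv_scaleR smooth_has_pderiv[OF open_U] smooth_e d x)
  then have "has_pderiv \<zeta> a
      (\<Sum>k\<in>UNIV. d k x *\<^sub>R pderiv_at a (e (Inr k)) x + pderiv_at a (d k) x *\<^sub>R e (Inr k) x) x"
    by (rule has_pderiv_cong[OF open_U x, rotated]) (simp add: \<zeta>)
  then have "pderiv_at a \<zeta> x =
      (\<Sum>k\<in>UNIV. (d k x * g x $ k $ a)) *\<^sub>R e (Inl a) x + (\<Sum>k\<in>UNIV. pderiv_at a (d k) x *\<^sub>R e (Inr k) x)"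
    by (simp add: has_pderiv_imp pderiv_normal x sum.distrib scaleR_left.sum)
  then have "pderiv_at a \<zeta> x \<bullet> e (Inr l) x = pderiv_at a (d l) x" for l
    by (simp add: inner_add_left x e_inner sum_e_inner)
  then show ?thesis
    by (simp add: normal_connection_def normal_part_eq x)
qed

lemma normal_field_coeffs:
  assumes "normal_field_on U Y \<zeta>"
  shows "smooth_on U (\<lambda>y. \<zeta> y \<bullet> e (Inr k) y)"
    and "y \<in> U \<Longrightarrow> \<zeta> y = (\<Sum>k\<in>UNIV. (\<zeta> y \<bullet> e (Inr k) y) *\<^sub>R e (Inr k) y)"
  using assms
  by (auto simp: normal_field_on_def intro!: smooth_on_inner open_U smooth_e normal_expand[symmetric])

text \<open>In coefficients the curvature of the normal bundle is the commutator of two partial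
  derivatives.\<close>

lemma flat: "flat_normal_bundle_on U Y"
  unfolding flat_normal_bundle_on_def
proof (intro allI impI ballI)
  fix \<zeta> x a b assume \<zeta>: "normal_field_on U Y \<zeta>" and x: "x \<in> U"
  let ?d = "\<lambda>k y. \<zeta> y \<bullet> e (Inr k) y"
  note d = normal_field_coeffs[OF \<zeta>]
  have "normal_connection Y a (normal_connection Y b \<zeta>) x =
      (\<Sum>k\<in>UNIV. pderiv_at a (pderiv_at b (?d k)) x *\<^sub>R e (Inr k) x)" for a b
    by (rule normal_connection_sum[OF x])
       (auto intro!: normal_connection_sum smooth_on_pderiv d)
  then show "normal_connection Y a (normal_connection Y b \<zeta>) x =
      normal_connection Y b (normal_connection Y a \<zeta>) x"
    using pderiv_commute[OF open_U d(1) x, of a b] by simp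
qed

text \<open>The coefficients are arbitrary because they are later taken from a parallel field of
  another submanifold over the same parameter domain.\<close>

lemma parallel_sum:
  assumes d: "\<And>k. smooth_on U (d k)" and d0: "\<And>k a x. x \<in> U \<Longrightarrow> pderiv_at a (d k) x = 0"
    and \<zeta>: "\<And>y. y \<in> U \<Longrightarrow> \<zeta> y = (\<Sum>k\<in>UNIV. d k y *\<^sub>R e (Inr k) y)"
  shows "parallel_normal_field_on U Y \<zeta>"
  unfolding parallel_normal_field_on_def normal_field_on_def
proof (intro conjI ballI allI)
  show "smooth_on U \<zeta>"
    by (rule smooth_on_cong[OF open_U \<zeta>[symmetric]])
       (auto intro!: smooth_on_sum smooth_on_scaleR open_U d smooth_e)
  fix x assume x: "x \<in> U"
  show "\<zeta> x \<in> normal_space Y x"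
    by (simp add: normal_space_iff x \<zeta> sum_e_inner)
  show "normal_connection Y a \<zeta> x = 0" for a
    by (subst normal_connection_sum[OF x d \<zeta>]) (simp_all add: d0 x)
qed

lemma parallel_coeffs:
  assumes \<zeta>: "parallel_normal_field_on U Y \<zeta>" and x: "x \<in> U"
  shows "pderiv_at a (\<lambda>y. \<zeta> y \<bullet> e (Inr k) y) x = 0"
proof -
  have n: "normal_field_on U Y \<zeta>" and "normal_connection Y a \<zeta> x = 0"
    using \<zeta> x by (auto simp: parallel_normal_field_on_def)
  then have "(\<Sum>k\<in>UNIV. pderiv_at a (\<lambda>y. \<zeta> y \<bullet> e (Inr k) y) x *\<^sub>R e (Inr k) x) \<bullet> e (Inr k) x = 0"
    using normal_connection_sum[OF x normal_field_coeffs[OF n]] by simp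
  then show ?thesis by (simp add: sum_e_inner x)
qed

lemma parallel_frame: "parallel_normal_frame_on U Y (\<lambda>k. e (Inr k))"
  unfolding parallel_normal_frame_on_def
proof (intro conjI allI ballI)
  fix k
  show "parallel_normal_field_on U Y (e (Inr k))"
    by (rule parallel_sum[where d = "\<lambda>l y. if l = k then 1 else 0"])
       (auto intro!: smooth_on_const open_U has_pderiv_imp has_pderiv_const simp: scaleR_delta)
next
  fix x assume x: "x \<in> U"
  show "span (range (\<lambda>k. e (Inr k) x)) = normal_space Y x"
  proof
    have "subspace (normal_space Y x)"
      unfolding subspace_def by (simp add: normal_space_iff x inner_add_left)
    moreover have "range (\<lambda>k. e (Inr k) x) \<subseteq> normal_space Y x"
      by (auto simp: normal_space_iff x e_inner)
    ultimately show "span (range (\<lambda>k. e (Inr k) x)) \<subseteq> normal_space Y x"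
      by (rule span_minimal[rotated])
    show "normal_space Y x \<subseteq> span (range (\<lambda>k. e (Inr k) x))"
    proof
      fix v assume "v \<in> normal_space Y x"
      then show "v \<in> span (range (\<lambda>k. e (Inr k) x))"
        by (subst normal_expand[OF x, symmetric]) (auto intro!: span_sum span_scale intro: span_base)
    qed
  qed
qed (auto simp: e_inner)

lemma shape_operators_eq:
  assumes x: "x \<in> U"
  shows "shape_operator Y x ` normal_space Y x =
    (\<lambda>y. diag (\<lambda>a. y $ a / h x $ a)) ` range (\<lambda>c. transpose (g x) *v c)"
proof (intro subset_antisym subsetI)
  fix S assume "S \<in> shape_operator Y x ` normal_space Y x"
  then obtain v where v: "v \<in> normal_space Y x" "S = shape_operator Y x v" by blast
  have "S = diag (\<lambda>a. (transpose (g x) *v (\<chi> k. v \<bullet> e (Inr k) x)) $ a / h x $ a)"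
    by (simp add: v shape_operator_eq x matrix_vector_mult_def transpose_def mult.commute)
  then show "S \<in> (\<lambda>y. diag (\<lambda>a. y $ a / h x $ a)) ` range (\<lambda>c. transpose (g x) *v c)" by blast
next
  fix S assume "S \<in> (\<lambda>y. diag (\<lambda>a. y $ a / h x $ a)) ` range (\<lambda>c. transpose (g x) *v c)"
  then obtain c where c: "S = diag (\<lambda>a. (transpose (g x) *v c) $ a / h x $ a)" by blast
  define v where "v = (\<Sum>k\<in>UNIV. c $ k *\<^sub>R e (Inr k) x)"
  have v: "v \<in> normal_space Y x" "v \<bullet> e (Inr k) x = c $ k" for k
    by (simp_all add: v_def normal_space_iff x sum_e_inner)
  have "shape_operator Y x v = S"
    by (simp add: c v shape_operator_eq x matrix_vector_mult_def transpose_def mult.commute)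
  then show "S \<in> shape_operator Y x ` normal_space Y x" using v(1) by blast
qed

text \<open>All shape operators are diagonal in the coordinate basis, and dividing by the nonzero
  \<open>h\<close> is linear and injective, so their space has the dimension of the row space of
  \<open>g x\<close>. Non-degeneracy thus becomes full column rank.\<close>

lemma dim_shape_operators:
  assumes x: "x \<in> U"
  shows "dim (shape_operator Y x ` normal_space Y x) = rank (g x)"
proof -
  let ?L = "\<lambda>y :: real^'p. diag (\<lambda>a. y $ a / h x $ a)"
  have "linear ?L"
    by (rule linearI) (auto simp: diag_def vec_eq_iff add_divide_distrib)
  moreover have "inj ?L"
  proof (rule injI)
    fix y z assume "?L y = ?L z"
    then have "?L y $ a $ a = ?L z $ a $ a" for a by simp
    then show "y = z" using h_nonzero[OF x] by (simp add: diag_def vec_eq_iff)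
  qed
  ultimately have "dim (?L ` S) = dim S" for S
    by (simp add: dim_image_eq inj_on_subset)
  then show ?thesis
    by (simp only: shape_operators_eq[OF x] rank_dim_range[symmetric] rank_transpose)
qed

lemma nondegenerate_iff:
  "nondegenerate_normal_bundle_on U Y \<longleftrightarrow> (\<forall>x\<in>U. rank (g x) = CARD('p))"
  by (simp add: nondegenerate_normal_bundle_on_def dim_shape_operators)

text \<open>Full rank makes every diagonal matrix a shape operator, in particular the projection
  onto a coordinate axis \<open>a\<close> with \<open>u $ a \<noteq> 0\<close>. An eigenvector of
  this projection with nonzero coordinate \<open>a\<close> lies on that axis.\<close>

lemma principal_direction_axis:
  assumes x: "x \<in> U" and g: "rank (g x) = CARD('p)" and u: "principal_direction Y x u"
  shows "\<exists>a r. r \<noteq> 0 \<and> u = axis a r"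
proof -
  \<comment> \<open>\<open>principal_direction\<close> quantifies over normal vectors; the zero
    normal already yields \<open>u \<noteq> 0\<close>.\<close>
  have "0 \<in> normal_space Y x" by (simp add: normal_space_iff x)
  then have "u \<noteq> 0"
    using u by (auto simp: principal_direction_def eigenvector_def)
  then obtain a where a: "u $ a \<noteq> 0" by (auto simp: vec_eq_iff)
  have "surj (\<lambda>c. transpose (g x) *v c)"
    using g full_rank_surjective[of "transpose (g x)"] rank_transpose[of "g x"] by argo
  \<comment> \<open>The value \<open>h x $ a\<close> is undone by the later division by
    \<open>h\<close>, which leaves the entry 1.\<close>
  then obtain c where c: "axis a (h x $ a) = transpose (g x) *v c" by (rule surjE)
  have "diag (\<lambda>b. axis a (h x $ a) $ b / h x $ b) \<in> shape_operator Y x ` normal_space Y x"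
    unfolding shape_operators_eq[OF x] c by (intro imageI rangeI)
  then obtain v where v: "v \<in> normal_space Y x"
      "shape_operator Y x v = diag (\<lambda>b. axis a (h x $ a) $ b / h x $ b)"
    by (elim imageE) simp
  have "shape_operator Y x v = diag (\<lambda>b. if b = a then 1 else 0)"
    unfolding v(2) using h_nonzero[OF x] by (simp add: diag_def axis_def vec_eq_iff)
  then have *: "shape_operator Y x v *v u = axis a (u $ a)"
    by (simp only:) (simp add: diag_vector_mult vec_eq_iff axis_def)
  obtain \<kappa> where \<kappa>: "axis a (u $ a) = \<kappa> *\<^sub>R u"
    using u v(1) unfolding principal_direction_def eigenvector_def *[symmetric] by blast
  from arg_cong[OF \<kappa>, of "\<lambda>w. w $ a"] have "\<kappa> = 1" using a by simp
  then have "u = axis a (u $ a)" using \<kappa> by simp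
  then show ?thesis using a by blast
qed

end

section \<open>Matrix entries\<close>

text \<open>The diagonal of \<open>J\<close> as a scalar function, so that signs move through sums
  and cancel in pairs.\<close>

definition sg :: "'n option \<Rightarrow> real" where
  "sg i = (if i = None then -1 else 1)"

lemma sg_mult_self [simp]: "sg i * sg i = 1"
  and sg_mult_self' [simp]: "sg i * (sg i * r) = r"
  and sg_square [simp]: "(sg i)\<^sup>2 = 1"
  and sg_nonzero [simp]: "sg i \<noteq> 0"
  by (auto simp: sg_def)

lemma J_nth [simp]: "J $ i $ j = (if i = j then sg i else 0)"
  by (simp add: J_def sg_def)

lemma J_vector_mult [simp]: "(J *v Z) $ i = sg i * Z $ i"
  by (simp add: matrix_vector_mult_def mult_delta_left)

lemma form_n1_eq: "form_n1 Z = (\<Sum>i\<in>UNIV. sg i * (Z $ i)\<^sup>2)"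
  by (simp add: form_n1_def inner_vec_def power2_eq_square ac_simps)

lemma stack_nth [simp]: "stack P Q $ Inl i $ j = P $ i $ j" "stack P Q $ Inr k $ j = Q $ k $ j"
  by (simp_all add: stack_def)

lemma block_nth [simp]:
  "block P Q R S $ Inl i $ Inl j = P $ i $ j" "block P Q R S $ Inl i $ Inr l = Q $ i $ l"
  "block P Q R S $ Inr k $ Inl j = R $ k $ j" "block P Q R S $ Inr k $ Inr l = S $ k $ l"
  by (simp_all add: block_def)

lemma C_nth [simp]: "C i $ a $ b = (if a = i \<and> b = i then 1 else 0)"
  by (simp add: C_def)

lemma D_nth [simp]: "D i $ c $ j = (if c = Inl i \<and> j = i then 1 else 0)"
  by (cases c) (auto simp: D_def)

lemma outer_nth [simp]: "outer u v $ a $ b = u $ a * v $ b"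
  by (simp add: outer_def matrix_matrix_mult_def columnvector_def rowvector_def)

lemma off_diag_nth [simp]: "off_diag M $ c $ j = (if c = Inl j then 0 else M $ c $ j)"
  by (simp add: off_diag_def)

lemma cmat_nth [simp]: "cmat M $ a $ b = complex_of_real (M $ a $ b)"
  by (simp add: cmat_def map_matrix_def)

lemma cscale_nth [simp]: "cscale c M $ a $ b = c * M $ a $ b"
  by (simp add: cscale_def map_matrix_def)

lemma vec_W_iZ_nth [simp]:
  "vec_W_iZ W Z $ Inl a = complex_of_real (W $ a)"
  "vec_W_iZ W Z $ Inr j = \<i> * complex_of_real (Z $ j)"
  by (simp_all add: vec_W_iZ_def)

lemma delta_conj: "(if P \<and> Q then r else 0) = (if P then if Q then r else 0 else 0)"
  by simp

lemma of_real_delta: "complex_of_real (if P then r else 0) = (if P then complex_of_real r else 0)"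
  and Re_delta: "Re (if P then z else 0) = (if P then Re z else 0)"
  and Im_delta: "Im (if P then z else 0) = (if P then Im z else 0)"
  by simp_all

lemma matrix_mult_nth: "(M ** N) $ a $ b = (\<Sum>c\<in>UNIV. M $ a $ c * N $ c $ b)"
  by (simp add: matrix_matrix_mult_def)

lemma matrix_mult_J_nth [simp]: "(M ** J) $ a $ j = M $ a $ j * sg j"
  by (simp add: matrix_matrix_mult_def mult_delta_right)

lemma J_matrix_mult_nth [simp]: "(J ** M) $ i $ a = sg i * M $ i $ a"
  by (simp add: matrix_matrix_mult_def mult_delta_left)

lemma matrix_mult_C_nth [simp]: "(M ** C i) $ a $ j = (if j = i then M $ a $ i else 0)"
  by (simp add: matrix_matrix_mult_def mult_delta_right delta_conj)

lemma C_matrix_mult_nth [simp]: "(C i ** M) $ a $ j = (if a = i then M $ i $ j else 0)"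
  by (simp add: matrix_matrix_mult_def mult_delta_left delta_conj)

lemma D_matrix_mult_nth [simp]: "(D i ** M) $ c $ j = (if c = Inl i then M $ i $ j else 0)"
  by (simp add: matrix_matrix_mult_def mult_delta_left delta_conj)

lemma matrix_mult_D_nth [simp]: "(M ** D i) $ a $ j = (if j = i then M $ a $ Inl i else 0)"
  by (simp add: matrix_matrix_mult_def mult_delta_right delta_conj)

lemma D_transpose_mult_nth [simp]: "(transpose (D i) ** M) $ a $ j = (if a = i then M $ Inl i $ j else 0)"
  by (simp add: matrix_matrix_mult_def transpose_def mult_delta_left delta_conj)

lemma mult_D_transpose_nth [simp]: "(M ** transpose (D i)) $ a $ c = (if c = Inl i then M $ a $ i else 0)"
  by (simp add: matrix_matrix_mult_def transpose_def mult_delta_right delta_conj)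

lemma transpose_nth: "transpose M $ a $ b = M $ b $ a"
  by (simp add: transpose_def)

text \<open>The stacked matrix hides the blocks: tangent and normal indices obey one formula,
  visibly skew-symmetric in \<open>b\<close> and \<open>c\<close>.\<close>

lemma connection_nth:
  "block (- (F ** C i) + C i ** transpose F) (C i ** transpose G) (- (G ** C i)) 0 $ b $ c =
   (if b = Inl i then stack F G $ c $ i else 0) - (if c = Inl i then stack F G $ b $ i else 0)"
  by (cases b; cases c) (auto simp: transpose_nth)

lemma pderiv_vec_nth:
  assumes "open U" "smooth_on U f" "x \<in> U"
  shows "pderiv_at a (\<lambda>y. f y $ i) x = pderiv_at a f x $ i"
  by (rule has_pderiv_imp[OF has_pderiv_nth[OF smooth_has_pderiv[OF assms]]])

lemma pderiv_mat_nth: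
  assumes "open U" "smooth_on U f" "x \<in> U"
  shows "pderiv_at a (\<lambda>y. f y $ i $ j) x = pderiv_at a f x $ i $ j"
  by (rule has_pderiv_imp[OF has_pderiv_nth[OF has_pderiv_nth[OF smooth_has_pderiv[OF assms]]]])

lemma smooth_on_column: "open U \<Longrightarrow> smooth_on U A \<Longrightarrow> smooth_on U (\<lambda>y. column c (A y))"
  by (rule smooth_on_vecI) (simp_all add: column_def smooth_on_nth)

lemma pderiv_column:
  assumes "open U" "smooth_on U A" "x \<in> U"
  shows "pderiv_at a (\<lambda>y. column c (A y)) x = column c (pderiv_at a A x)"
proof -
  have "pderiv_at a (\<lambda>y. column c (A y)) x $ r = column c (pderiv_at a A x) $ r" for r
    by (simp add: pderiv_vec_nth[OF assms(1) smooth_on_column[OF assms(1,2)] assms(3), symmetric])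
       (simp add: column_def pderiv_vec_nth[OF assms(1) smooth_on_nth[OF assms(1,2)] assms(3)]
          pderiv_vec_nth[OF assms])
  then show ?thesis by (simp add: vec_eq_iff)
qed

lemma orthogonal_matrix_inv: "orthogonal_matrix A \<Longrightarrow> matrix_inv A = transpose A"
  by (rule matrix_inv_unique) (simp_all add: orthogonal_matrix_def)

text \<open>The Maurer-Cartan form of \<open>A\<close>, read as moving-frame equations for its
  columns. Both directions matter: one extracts the equations of the given frame, the other
  establishes those of the transformed frame.\<close>

lemma connection_iff_columns:
  fixes F :: "real^'i::finite^'i" and G :: "real^'i^'k::finite" and A :: "real^'p::finite \<Rightarrow> real^('i + 'k)^('i + 'k)"
  assumes "open U" "smooth_on U A" "x \<in> U" "orthogonal_matrix (A x)"
  shows "matrix_inv (A x) ** pderiv_at a A x =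
      block (- (F ** C i) + C i ** transpose F) (C i ** transpose G) (- (G ** C i)) 0 \<longleftrightarrow>
    (\<forall>c. pderiv_at a (\<lambda>y. column c (A y)) x =
      stack F G $ c $ i *\<^sub>R column (Inl i) (A x) -
      (if c = Inl i then (\<Sum>d\<in>UNIV. stack F G $ d $ i *\<^sub>R column d (A x)) else 0))"
    (is "?L = ?M \<longleftrightarrow> ?R")
proof -
  have "?L = ?M \<longleftrightarrow> pderiv_at a A x = A x ** ?M"
  proof
    assume "?L = ?M"
    then have "A x ** (transpose (A x) ** pderiv_at a A x) = A x ** ?M"
      by (simp add: orthogonal_matrix_inv assms(4))
    then show "pderiv_at a A x = A x ** ?M"
      using assms(4) by (simp only: matrix_mul_assoc orthogonal_matrix_def matrix_mul_lid)
  next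
    assume "pderiv_at a A x = A x ** ?M"
    then show "?L = ?M"
      using assms(4)
      by (simp only: orthogonal_matrix_inv matrix_mul_assoc)
         (simp only: orthogonal_matrix_def matrix_mul_lid)
  qed
  also have "\<dots> \<longleftrightarrow> (\<forall>c. column c (pderiv_at a A x) = column c (A x ** ?M))"
    by (auto simp: column_def vec_eq_iff)
  also have "\<dots> \<longleftrightarrow> ?R"
  proof -
    have "column c (A x ** ?M) = stack F G $ c $ i *\<^sub>R column (Inl i) (A x) -
      (if c = Inl i then (\<Sum>d\<in>UNIV. stack F G $ d $ i *\<^sub>R column d (A x)) else 0)" for c
      unfolding vec_eq_iff column_def vec_lambda_beta matrix_mult_nth[of "A x"] connection_nth
      by (simp add: algebra_simps sum_subtractf mult_delta_right)
    then show ?thesis by (simp only: pderiv_column[OF assms(1-3)])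
  qed
  finally show ?thesis .
qed

section \<open>Frames\<close>

lemma frame_connection_nth:
  fixes \<xi> :: "real^'n::finite option^('n option + 'k::finite)" and \<mu> :: complex and i :: "'n option"
  defines "M \<equiv> cscale \<mu> (cmat (block 0 (- (D i ** J)) (transpose (D i)) 0)) +
           cmat (block (D i ** transpose \<xi> - \<xi> ** transpose (D i)) 0
                       0 (- (J ** transpose \<xi> ** D i ** J) + transpose (D i) ** \<xi>))"
  shows "M $ Inl c $ Inl d = complex_of_real ((if c = Inl i then \<xi> $ d $ i else 0) - (if d = Inl i then \<xi> $ c $ i else 0))"
    and "M $ Inl c $ Inr j = (if c = Inl i \<and> j = i then - \<mu> * complex_of_real (sg i) else 0)"
    and "M $ Inr j $ Inl c = (if c = Inl i \<and> j = i then \<mu> else 0)"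
    and "M $ Inr j $ Inr l = complex_of_real ((if j = i then \<xi> $ Inl i $ l else 0) -
          (if l = i then sg j * sg i * \<xi> $ Inl i $ j else 0))"
  unfolding M_def by (auto simp: transpose_nth)

definition eta :: "'p + 'n option \<Rightarrow> real" where
  "eta a = (case a of Inl c \<Rightarrow> 1 | Inr j \<Rightarrow> sg j)"

lemma eta_simps [simp]: "eta (Inl c) = 1" "eta (Inr j) = sg j"
  by (simp_all add: eta_def)

lemma eta_mult_self [simp]: "eta a * eta a = 1"
  by (cases a) simp_all

lemma I_mn_1_nth [simp]: "I_mn_1 $ a $ b = (if a = b then eta a else 0)"
  unfolding I_mn_1_def by (cases a; cases b) (auto simp: mat_def)

lemma I_mn_1_sandwich_nth:
  "(cmat I_mn_1 ** M ** cmat I_mn_1) $ a $ b = complex_of_real (eta a * eta b) * M $ a $ b"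
  by (simp add: matrix_matrix_mult_def of_real_delta mult_delta_left mult_delta_right)

section \<open>The frame \<open>E\<close> and the vector field that its inverse produces from
  \<open>W\<close> and \<open>Z\<close>\<close>

context
  fixes \<Omega> :: "(real^'n::finite option) set" and F B :: "real^'n option \<Rightarrow> real^'n option^'n option"
    and G :: "real^'n option \<Rightarrow> real^'n option^'k::finite"
    and A :: "real^'n option \<Rightarrow> real^('n option + 'k)^('n option + 'k)"
    and E :: "real^'n option \<Rightarrow> complex \<Rightarrow>
              complex^(('n option + 'k) + 'n option)^(('n option + 'k) + 'n option)"
    and s :: real and W :: "real^('n option + 'k)" and Z :: "real^'n option"
    and Wt :: "real^'n option \<Rightarrow> real^('n option + 'k)" and Zt :: "real^'n option \<Rightarrow> real^'n option"
  assumes open_dom: "open \<Omega>"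
    and smooth_B: "smooth_on \<Omega> B"
    and frame: "frame_of \<Omega> E (\<lambda>x. stack (F x) (G x)) A B"
    and v_eq: "\<And>x. x \<in> \<Omega> \<Longrightarrow> vec_W_iZ (Wt x) (Zt x) = matrix_inv (E x (- (\<i> * s))) *v vec_W_iZ W Z"
begin

text \<open>\<open>E\<close> preserves a bilinear form whose matrix is its own inverse. This gives a
  left inverse, which for square matrices is two-sided.\<close>

lemma frame_inverse:
  assumes x: "x \<in> \<Omega>"
  shows "matrix_inv (E x \<mu>) = cmat I_mn_1 ** transpose (E x \<mu>) ** cmat I_mn_1"
    and "E x \<mu> ** matrix_inv (E x \<mu>) = mat 1"
proof -
  let ?I = "cmat I_mn_1 :: complex^(('n option + 'k) + 'n option)^(('n option + 'k) + 'n option)"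
  have II: "?I ** ?I = mat 1"
    by (simp add: vec_eq_iff matrix_matrix_mult_def mat_def of_real_delta
        mult_delta_left of_real_mult[symmetric] del: of_real_mult)
  have "transpose (E x \<mu>) ** ?I ** E x \<mu> = ?I"
    using frame x by (auto simp: frame_of_def)
  then have "?I ** (transpose (E x \<mu>) ** ?I ** E x \<mu>) = mat 1"
    using II by simp
  then have 1: "(?I ** transpose (E x \<mu>) ** ?I) ** E x \<mu> = mat 1"
    by (simp only: matrix_mul_assoc)
  then have 2: "E x \<mu> ** (?I ** transpose (E x \<mu>) ** ?I) = mat 1"
    using matrix_left_right_inverse by blast
  show "matrix_inv (E x \<mu>) = ?I ** transpose (E x \<mu>) ** ?I"
    by (rule matrix_inv_unique[OF 2 1])
  then show "E x \<mu> ** matrix_inv (E x \<mu>) = mat 1"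
    using 2 by simp
qed

definition connection :: "complex \<Rightarrow> 'n option \<Rightarrow> real^'n option \<Rightarrow>
    complex^(('n option + 'k) + 'n option)^(('n option + 'k) + 'n option)" where
  "connection \<mu> i x = (let \<xi> = stack (F x) (G x) in
     cscale \<mu> (cmat (block 0 (- (D i ** J)) (transpose (D i)) 0)) +
           cmat (block (D i ** transpose \<xi> - \<xi> ** transpose (D i)) 0
                       0 (- (J ** transpose \<xi> ** D i ** J) + transpose (D i) ** \<xi>)))"

lemma connection_entries:
  "connection \<mu> i x $ Inl c $ Inl d = complex_of_real
     ((if c = Inl i then stack (F x) (G x) $ d $ i else 0) - (if d = Inl i then stack (F x) (G x) $ c $ i else 0))"
  "connection \<mu> i x $ Inl c $ Inr j = (if c = Inl i \<and> j = i then - \<mu> * complex_of_real (sg i) else 0)"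
  "connection \<mu> i x $ Inr j $ Inl c = (if c = Inl i \<and> j = i then \<mu> else 0)"
  "connection \<mu> i x $ Inr j $ Inr l = complex_of_real ((if j = i then F x $ i $ l else 0) -
          (if l = i then sg j * sg i * F x $ i $ j else 0))"
  unfolding connection_def Let_def frame_connection_nth stack_nth by (rule refl)+

lemma smooth_frame: "smooth_on \<Omega> (\<lambda>y. E y \<mu> $ a $ b)"
  using frame by (auto simp: frame_of_def intro!: smooth_on_nth open_dom)

lemma pderiv_frame_nth:
  assumes x: "x \<in> \<Omega>"
  shows "has_pderiv (\<lambda>y. E y \<mu> $ a $ b) i (\<Sum>c\<in>UNIV. E x \<mu> $ a $ c * connection \<mu> i x $ c $ b) x"
proof -
  have sm: "smooth_on \<Omega> (\<lambda>y. E y \<mu>)" using frame by (auto simp: frame_of_def)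
  have "matrix_inv (E x \<mu>) ** pderiv_at i (\<lambda>y. E y \<mu>) x = connection \<mu> i x"
    using frame x by (auto simp: frame_of_def connection_def Let_def)
  then have "E x \<mu> ** (matrix_inv (E x \<mu>) ** pderiv_at i (\<lambda>y. E y \<mu>) x) = E x \<mu> ** connection \<mu> i x"
    by simp
  then have "pderiv_at i (\<lambda>y. E y \<mu>) x = E x \<mu> ** connection \<mu> i x"
    by (simp only: matrix_mul_assoc frame_inverse(2)[OF x] matrix_mul_lid)
  then have "(\<Sum>c\<in>UNIV. E x \<mu> $ a $ c * connection \<mu> i x $ c $ b) = pderiv_at i (\<lambda>y. E y \<mu>) x $ a $ b"
    by (simp add: matrix_matrix_mult_def)
  then show ?thesis
    by (simp only:) (intro has_pderiv_nth smooth_has_pderiv[OF open_dom sm x])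
qed

text \<open>\<open>B\<close> is the lower block of the frame at parameter 0. This supplies the case
  \<open>j = k\<close>, the derivative of a column in its own direction, on which the equations of
  the system are silent.\<close>

lemma frame_pderiv_B:
  assumes x: "x \<in> \<Omega>"
  shows "pderiv_at k (\<lambda>y. column j (B y)) x = F x $ k $ j *\<^sub>R column k (B x) -
      (if j = k then (\<Sum>l\<in>UNIV. (sg l * sg k * F x $ k $ l) *\<^sub>R column l (B x)) else 0)"
proof -
  have E0: "E y 0 = cmat (block (A y) 0 0 (B y))" if "y \<in> \<Omega>" for y
    using frame that by (auto simp: frame_of_def)
  have "pderiv_at k (\<lambda>y. B y $ r $ j) x = F x $ k $ j * B x $ r $ k -
      (if j = k then (\<Sum>l\<in>UNIV. sg l * sg k * F x $ k $ l * B x $ r $ l) else 0)" for r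
  proof -
    have "has_pderiv (\<lambda>y. Re (E y 0 $ Inr r $ Inr j)) k
        (Re (\<Sum>c\<in>UNIV. E x 0 $ Inr r $ c * connection 0 k x $ c $ Inr j)) x"
      by (intro has_pderiv_bounded_linear[OF bounded_linear_Re] pderiv_frame_nth x)
    then have "has_pderiv (\<lambda>y. B y $ r $ j) k
        (Re (\<Sum>c\<in>UNIV. E x 0 $ Inr r $ c * connection 0 k x $ c $ Inr j)) x"
      by (rule has_pderiv_cong[OF open_dom x, rotated]) (simp add: E0)
    moreover have "(\<Sum>c\<in>UNIV. E x 0 $ Inr r $ c * connection 0 k x $ c $ Inr j) =
        complex_of_real (\<Sum>l\<in>UNIV. B x $ r $ l * ((if l = k then F x $ k $ j else 0) -
          (if j = k then sg l * sg k * F x $ k $ l else 0)))"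
      by (simp add: sum_UNIV_Plus[where 'b = complex] connection_entries E0 x)
    ultimately have "pderiv_at k (\<lambda>y. B y $ r $ j) x = (\<Sum>l\<in>UNIV. B x $ r $ l * ((if l = k then F x $ k $ j else 0) -
          (if j = k then sg l * sg k * F x $ k $ l else 0)))"
      by (simp add: has_pderiv_imp)
    then show ?thesis
      by (cases "j = k") (simp_all add: algebra_simps sum_subtractf mult_delta_right)
  qed
  then show ?thesis
    unfolding pderiv_column[OF open_dom smooth_B x] vec_eq_iff pderiv_mat_nth[OF open_dom smooth_B x]
    by (simp add: column_def)
qed

text \<open>With the inverse expressed through the transpose, the vector is linear in the entries of
  \<open>E\<close>, so it can be differentiated without differentiating a matrix inverse.\<close>

lemma frame_vector_nth:
  assumes x: "x \<in> \<Omega>"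
  shows "vec_W_iZ (Wt x) (Zt x) $ a =
    (\<Sum>b\<in>UNIV. complex_of_real (eta a * eta b) * E x (- (\<i> * s)) $ b $ a * vec_W_iZ W Z $ b)"
  by (simp add: v_eq x matrix_vector_mult_def frame_inverse(1) I_mn_1_sandwich_nth transpose_nth)

lemma smooth_frame_vector: "smooth_on \<Omega> (\<lambda>y. vec_W_iZ (Wt y) (Zt y) $ a)"
proof (rule smooth_on_cong[OF open_dom])
  show "smooth_on \<Omega> (\<lambda>y. \<Sum>b\<in>UNIV. complex_of_real (eta a * eta b) * E y (- (\<i> * s)) $ b $ a * vec_W_iZ W Z $ b)"
    by (intro smooth_on_sum smooth_on_mult smooth_on_const smooth_frame open_dom)
qed (simp add: frame_vector_nth)

lemma frame_smooth_Wt: "smooth_on \<Omega> Wt"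
proof (rule smooth_on_vecI[OF open_dom])
  fix c
  show "smooth_on \<Omega> (\<lambda>x. Wt x $ c)"
    using smooth_on_bounded_linear[OF bounded_linear_Re open_dom smooth_frame_vector[of "Inl c"]] by simp
qed

lemma frame_smooth_Zt: "smooth_on \<Omega> Zt"
proof (rule smooth_on_vecI[OF open_dom])
  fix j
  show "smooth_on \<Omega> (\<lambda>x. Zt x $ j)"
    using smooth_on_bounded_linear[OF bounded_linear_Im open_dom smooth_frame_vector[of "Inr j"]] by simp
qed

text \<open>The usual form of this derivative is minus the connection applied to the vector. Minus
  the connection appears here as its transpose conjugated by \<open>I_mn_1\<close>, the shape in
  which \<open>frame_vector_nth\<close> produces it.\<close>

lemma pderiv_frame_vector:
  assumes x: "x \<in> \<Omega>"
  shows "has_pderiv (\<lambda>y. vec_W_iZ (Wt y) (Zt y) $ a) i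
    (\<Sum>c\<in>UNIV. complex_of_real (eta a * eta c) * connection (- (\<i> * s)) i x $ c $ a * vec_W_iZ (Wt x) (Zt x) $ c) x"
proof -
  let ?E = "E x (- (\<i> * s))" and ?C = "connection (- (\<i> * s)) i x" and ?w = "vec_W_iZ W Z"
  have "has_pderiv (\<lambda>y. \<Sum>b\<in>UNIV. (complex_of_real (eta a * eta b) * ?w $ b) * E y (- (\<i> * s)) $ b $ a) i
     (\<Sum>b\<in>UNIV. (complex_of_real (eta a * eta b) * ?w $ b) * (\<Sum>c\<in>UNIV. ?E $ b $ c * ?C $ c $ a)) x"
    by (intro has_pderiv_sum has_pderiv_bounded_linear[OF bounded_linear_mult_right] pderiv_frame_nth x)
  then have "has_pderiv (\<lambda>y. vec_W_iZ (Wt y) (Zt y) $ a) i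
     (\<Sum>b\<in>UNIV. (complex_of_real (eta a * eta b) * ?w $ b) * (\<Sum>c\<in>UNIV. ?E $ b $ c * ?C $ c $ a)) x"
    by (rule has_pderiv_cong[OF open_dom x, rotated]) (simp add: frame_vector_nth ac_simps)
  moreover have "(\<Sum>b\<in>UNIV. (complex_of_real (eta a * eta b) * ?w $ b) * (\<Sum>c\<in>UNIV. ?E $ b $ c * ?C $ c $ a)) =
     (\<Sum>c\<in>UNIV. \<Sum>b\<in>UNIV. (complex_of_real (eta a * eta b) * ?w $ b) * (?E $ b $ c * ?C $ c $ a))"
    unfolding sum_distrib_left by (rule sum.swap)
  moreover have "(\<Sum>b\<in>UNIV. (complex_of_real (eta a * eta b) * ?w $ b) * (?E $ b $ c * ?C $ c $ a)) =
     complex_of_real (eta a * eta c) * ?C $ c $ a * vec_W_iZ (Wt x) (Zt x) $ c" for c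
  proof -
    \<comment> \<open>Inserting \<open>eta c\<close> twice splits the sign, so that the sum over
      \<open>b\<close> becomes entry \<open>c\<close> of the vector.\<close>
    have *: "complex_of_real (eta a * eta b) = complex_of_real (eta a * eta c) * complex_of_real (eta c * eta b)" for b
      by (simp add: of_real_mult[symmetric] del: of_real_mult)
    show ?thesis
      unfolding frame_vector_nth[OF x, of c] sum_distrib_left
      by (rule sum.cong[OF refl], subst *, simp only: ac_simps)
  qed
  ultimately show ?thesis by simp
qed

text \<open>The upper, real half of the vector equation. The coupling to \<open>Zt\<close> is real
  because the imaginary parameter meets the factor \<open>\<i>\<close> in front of
  \<open>Zt\<close>.\<close>

lemma frame_pderiv_Wt:
  assumes x: "x \<in> \<Omega>"
  shows "pderiv_at k (\<lambda>y. Wt y $ c) x = stack (F x) (G x) $ c $ k * Wt x $ Inl k +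
    (if c = Inl k then s * sg k * Zt x $ k - (\<Sum>d\<in>UNIV. stack (F x) (G x) $ d $ k * Wt x $ d) else 0)"
proof -
  have "has_pderiv (\<lambda>y. Re (vec_W_iZ (Wt y) (Zt y) $ Inl c)) k
    (Re (\<Sum>a\<in>UNIV. complex_of_real (eta (Inl c :: ('n option + 'k) + 'n option) * eta a) * connection (- (\<i> * s)) k x $ a $ Inl c * vec_W_iZ (Wt x) (Zt x) $ a)) x"
    by (intro has_pderiv_bounded_linear[OF bounded_linear_Re] pderiv_frame_vector x)
  then have "pderiv_at k (\<lambda>y. Wt y $ c) x =
    (Re (\<Sum>a\<in>UNIV. complex_of_real (eta (Inl c :: ('n option + 'k) + 'n option) * eta a) * connection (- (\<i> * s)) k x $ a $ Inl c * vec_W_iZ (Wt x) (Zt x) $ a))"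
    by (simp add: has_pderiv_imp)
  also have "\<dots> = (\<Sum>d\<in>UNIV. ((if d = Inl k then stack (F x) (G x) $ c $ k else 0) -
       (if c = Inl k then stack (F x) (G x) $ d $ k else 0)) * Wt x $ d) +
     (\<Sum>j\<in>UNIV. if c = Inl k \<and> j = k then s * sg j * Zt x $ j else 0)"
    by (simp add: sum_UNIV_Plus[where 'i = "'n option + 'k"] connection_entries Re_delta
        mult_delta_left mult_delta_right ac_simps cong: if_cong)
  also have "\<dots> = stack (F x) (G x) $ c $ k * Wt x $ Inl k +
    (if c = Inl k then s * sg k * Zt x $ k - (\<Sum>d\<in>UNIV. stack (F x) (G x) $ d $ k * Wt x $ d) else 0)"
    by (simp add: left_diff_distrib sum_subtractf mult_delta_left delta_conj)
  finally show ?thesis .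
qed

lemma frame_pderiv_Zt:
  assumes x: "x \<in> \<Omega>"
  shows "pderiv_at k (\<lambda>y. Zt y $ j) x = sg j * sg k * F x $ k $ j * Zt x $ k +
    (if j = k then s * Wt x $ Inl k - (\<Sum>l\<in>UNIV. F x $ k $ l * Zt x $ l) else 0)"
proof -
  have "has_pderiv (\<lambda>y. Im (vec_W_iZ (Wt y) (Zt y) $ Inr j)) k
    (Im (\<Sum>a\<in>UNIV. complex_of_real (eta (Inr j :: ('n option + 'k) + 'n option) * eta a) * connection (- (\<i> * s)) k x $ a $ Inr j * vec_W_iZ (Wt x) (Zt x) $ a)) x"
    by (intro has_pderiv_bounded_linear[OF bounded_linear_Im] pderiv_frame_vector x)
  then have "pderiv_at k (\<lambda>y. Zt y $ j) x =
    (Im (\<Sum>a\<in>UNIV. complex_of_real (eta (Inr j :: ('n option + 'k) + 'n option) * eta a) * connection (- (\<i> * s)) k x $ a $ Inr j * vec_W_iZ (Wt x) (Zt x) $ a))"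
    by (simp add: has_pderiv_imp)
  also have "\<dots> = (\<Sum>c\<in>UNIV. if c = Inl k \<and> j = k then s * Wt x $ c else 0) +
     (\<Sum>l\<in>UNIV. sg j * sg l * ((if l = k then F x $ k $ j else 0) -
       (if j = k then sg l * sg k * F x $ k $ l else 0)) * Zt x $ l)"
    by (simp add: sum_UNIV_Plus[where 'i = "'n option + 'k"] connection_entries Im_delta
        mult_delta_left mult_delta_right ac_simps cong: if_cong)
  also have "\<dots> = sg j * sg k * F x $ k $ j * Zt x $ k +
    (if j = k then s * Wt x $ Inl k - (\<Sum>l\<in>UNIV. F x $ k $ l * Zt x $ l) else 0)"
    by (simp add: left_diff_distrib right_diff_distrib sum_subtractf mult_delta_left mult_delta_right delta_conj ac_simps)
  finally show ?thesis .
qed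

text \<open>The form preserved by \<open>E\<close> is complex bilinear, without conjugation, so at
  \<open>vec_W_iZ V Y\<close> its value is \<open>V \<bullet> V - form_n1 Y\<close>. For the unit
  vectors \<open>W\<close> and \<open>Z\<close> this is 0, hence also along the whole field.\<close>

lemma frame_quadric:
  assumes x: "x \<in> \<Omega>" and W: "norm W = 1" and Z: "form_n1 Z = 1"
  shows "Wt x \<bullet> Wt x = form_n1 (Zt x)"
proof -
  let ?E = "E x (- (\<i> * s))" and ?v = "vec_W_iZ (Wt x) (Zt x)" and ?w = "vec_W_iZ W Z"
  define Q where "Q u = (\<Sum>a\<in>UNIV. complex_of_real (eta a) * u $ a * u $ a)"
    for u :: "complex^(('n option + 'k) + 'n option)"
  have Q: "Q (vec_W_iZ V Y) = complex_of_real (V \<bullet> V - form_n1 Y)" for V Y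
    by (simp add: Q_def sum_UNIV_Plus[where 'i = "'n option + 'k"] form_n1_eq inner_vec_def
        power2_eq_square sum_negf ac_simps)
  have Ev: "?w $ a = (\<Sum>b\<in>UNIV. ?E $ a $ b * ?v $ b)" for a
  proof -
    have "?E *v ?v = ?w"
      by (simp only: v_eq[OF x] matrix_vector_mul_assoc frame_inverse(2)[OF x] matrix_vector_mul_lid)
    from arg_cong[OF this, of "\<lambda>u. u $ a"] show ?thesis
      by (simp only: matrix_vector_mult_def vec_lambda_beta)
  qed
  have EIE: "(\<Sum>a\<in>UNIV. complex_of_real (eta a) * ?E $ a $ b * ?E $ a $ c) =
      (if b = c then complex_of_real (eta b) else 0)" for b c
  proof -
    have "transpose ?E ** cmat I_mn_1 ** ?E = cmat I_mn_1"
      using frame x by (auto simp: frame_of_def)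
    then have "(transpose ?E ** cmat I_mn_1 ** ?E) $ b $ c = cmat I_mn_1 $ b $ c" by simp
    then have "(\<Sum>a\<in>UNIV. ?E $ a $ b * complex_of_real (eta a) * ?E $ a $ c) =
        (if b = c then complex_of_real (eta b) else 0)"
      by (simp add: matrix_mult_nth transpose_nth of_real_delta mult_delta_right cong: if_cong)
    then show ?thesis by (simp only: ac_simps)
  qed
  have "Q ?w = (\<Sum>a\<in>UNIV. \<Sum>b\<in>UNIV. \<Sum>c\<in>UNIV. (complex_of_real (eta a) * ?E $ a $ b * ?E $ a $ c) * (?v $ b * ?v $ c))"
    unfolding Q_def Ev by (simp add: sum_distrib_left sum_distrib_right ac_simps)
  also have "\<dots> = (\<Sum>b\<in>UNIV. \<Sum>c\<in>UNIV. \<Sum>a\<in>UNIV. (complex_of_real (eta a) * ?E $ a $ b * ?E $ a $ c) * (?v $ b * ?v $ c))"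
    by (subst sum.swap, rule sum.cong[OF refl], rule sum.swap)
  also have "\<dots> = Q ?v"
    unfolding sum_distrib_right[symmetric] EIE Q_def by (simp add: mult_delta_left mult_delta_right ac_simps)
  finally have "W \<bullet> W - form_n1 Z = Wt x \<bullet> Wt x - form_n1 (Zt x)"
    unfolding Q of_real_eq_iff .
  then show ?thesis using W Z by (simp add: norm_eq_1)
qed

end

section \<open>The Darboux transformation\<close>

lemma pderiv_cong:
  assumes "open U" "x \<in> U" "\<And>y. y \<in> U \<Longrightarrow> f y = g y" "smooth_on U f"
  shows "pderiv_at a f x = pderiv_at a g x"
  using has_pderiv_imp[OF has_pderiv_cong[OF assms(1-3) smooth_has_pderiv[OF assms(1,4,2)]]] by simp

lemma correspondsD:
  assumes "corresponds U X F G B A"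
  shows "smooth_on U F" "smooth_on U G" "smooth_on U B" "smooth_on U A" "smooth_on U X"
    and "x \<in> U \<Longrightarrow> orthogonal_matrix (A x)" and "x \<in> U \<Longrightarrow> B x \<in> O_n1"
  using assms by (auto simp: corresponds_def solution_system_II_def)

lemma corresponds_subset:
  "V \<subseteq> U \<Longrightarrow> corresponds U X F G B A \<Longrightarrow> corresponds V X F G B A"
  unfolding corresponds_def solution_system_II_def by (auto intro: smooth_on_subset)

lemma corresponds_pderiv_A:
  assumes "open U" "corresponds U X F G B A" "x \<in> U"
  shows "pderiv_at i (\<lambda>y. column c (A y)) x = stack (F x) (G x) $ c $ i *\<^sub>R column (Inl i) (A x) -
      (if c = Inl i then (\<Sum>d\<in>UNIV. stack (F x) (G x) $ d $ i *\<^sub>R column d (A x)) else 0)"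
proof -
  have "matrix_inv (A x) ** pderiv_at i A x =
      block (- (F x ** C i) + C i ** transpose (F x)) (C i ** transpose (G x)) (- (G x ** C i)) 0"
    using assms by (simp add: corresponds_def)
  then show ?thesis
    unfolding connection_iff_columns[OF assms(1) correspondsD(4)[OF assms(2)] assms(3) correspondsD(6)[OF assms(2,3)]]
    by blast
qed

lemma left_block_mult_nth:
  "(left_block A ** C k ** transpose B ** J) $ r $ j = sg j * B $ j $ k * A $ r $ Inl k"
  by (simp add: matrix_mult_nth[where N = "transpose _"] transpose_nth left_block_def mult_delta_left)

lemma corresponds_pderiv_X:
  assumes "open U" "corresponds U X F G B A" "x \<in> U"
  shows "pderiv_at k (\<lambda>y. column j (X y)) x = (- (sg j * B x $ j $ k)) *\<^sub>R column (Inl k) (A x)"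
proof -
  have "pderiv_at k X x = - (left_block (A x) ** C k ** transpose (B x) ** J)"
    using assms by (simp add: corresponds_def)
  then show ?thesis
    unfolding pderiv_column[OF assms(1) correspondsD(5)[OF assms(2)] assms(3)]
    by (simp add: vec_eq_iff column_def left_block_mult_nth del: matrix_mult_J_nth)
qed

lemma corresponds_cong:
  assumes "open U" and eq: "\<And>x. x \<in> U \<Longrightarrow> X x = X' x" "\<And>x. x \<in> U \<Longrightarrow> F x = F' x" "\<And>x. x \<in> U \<Longrightarrow> G x = G' x"
      "\<And>x. x \<in> U \<Longrightarrow> B x = B' x" "\<And>x. x \<in> U \<Longrightarrow> A x = A' x"
    and c: "corresponds U X F G B A"
  shows "corresponds U X' F' G' B' A'"
proof -
  note sm = correspondsD(1-5)[OF c]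
  have pd: "pderiv_at a A' x = pderiv_at a A x" "pderiv_at a X' x = pderiv_at a X x"
    "pderiv_at a (\<lambda>y. F' y $ i $ j) x = pderiv_at a (\<lambda>y. F y $ i $ j) x"
    "pderiv_at a (\<lambda>y. B' y $ i $ j) x = pderiv_at a (\<lambda>y. B y $ i $ j) x"
    "pderiv_at a (\<lambda>y. G' y $ k $ j) x = pderiv_at a (\<lambda>y. G y $ k $ j) x"
    if "x \<in> U" for a x i j k
    using eq that by (auto intro!: pderiv_cong[OF assms(1), symmetric] smooth_on_nth assms(1) sm)
  have "smooth_on U X'" "smooth_on U F'" "smooth_on U G'" "smooth_on U B'" "smooth_on U A'"
    using smooth_on_cong[OF assms(1)] eq sm by blast+
  then show ?thesis
    using c unfolding corresponds_def solution_system_II_def by (simp add: pd eq[symmetric])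
qed

lemma O_n1_iff:
  "B \<in> O_n1 \<longleftrightarrow> (\<forall>j l. (\<Sum>i\<in>UNIV. sg i * B $ i $ j * B $ i $ l) = (if j = l then sg j else 0))"
proof -
  have "(transpose B ** J ** B) $ j $ l = (\<Sum>i\<in>UNIV. sg i * B $ i $ j * B $ i $ l)" for j l
    by (simp add: matrix_mult_nth[where N = B] transpose_nth ac_simps)
  then show ?thesis by (simp add: O_n1_def vec_eq_iff)
qed

text \<open>The definition of \<open>O_n1\<close> relates columns; since one-sided inverses of
  square matrices are two-sided, rows satisfy the same relation. This is the source of the
  hyperbolic value, which is -1 only for the last member of a tuple.\<close>

lemma O_n1_rows:
  assumes "B \<in> O_n1"
  shows "(\<Sum>i\<in>UNIV. sg i * (B $ j $ i)\<^sup>2) = sg j"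
proof -
  have "J ** J = (mat 1 :: real^'a option^'a option)"
    by (simp add: vec_eq_iff mat_def)
  then have "(J ** transpose B ** J) ** B = mat 1"
    using assms by (simp add: O_n1_def matrix_mul_assoc[symmetric])
  then have "B ** (J ** transpose B ** J) = mat 1"
    using matrix_left_right_inverse by blast
  then have "(B ** (J ** transpose B ** J)) $ j $ j = 1" by (simp add: mat_def)
  then have "(\<Sum>i\<in>UNIV. sg i * (B $ j $ i)\<^sup>2) * sg j = 1"
    by (simp add: matrix_mult_nth[of B] transpose_nth power2_eq_square sum_distrib_left sum_distrib_right ac_simps)
  then show ?thesis
    by (metis mult.assoc mult_1 mult.right_neutral sg_mult_self)
qed

text \<open>What the frame contributes at the parameters 0 and \<open>-is\<close> is recorded as
  real differential equations and one quadratic relation; within the locale neither the frame nor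
  complex numbers occur.\<close>

locale dressing =
  fixes \<Omega> :: "(real^'n::finite option) set" and F B :: "real^'n option \<Rightarrow> real^'n option^'n option"
    and G :: "real^'n option \<Rightarrow> real^'n option^'k::finite"
    and A :: "real^'n option \<Rightarrow> real^('n option + 'k)^('n option + 'k)"
    and X :: "real^'n option \<Rightarrow> real^'n option^('n option + 'k)"
    and s :: real
    and Wt :: "real^'n option \<Rightarrow> real^('n option + 'k)" and Zt :: "real^'n option \<Rightarrow> real^'n option"
  assumes open_dom: "open \<Omega>" and corr: "corresponds \<Omega> X F G B A" and s_nonzero: "s \<noteq> 0"
    and smooth_Wt: "smooth_on \<Omega> Wt" and smooth_Zt: "smooth_on \<Omega> Zt"
    and pderiv_Wt: "x \<in> \<Omega> \<Longrightarrow> pderiv_at k (\<lambda>y. Wt y $ c) x = stack (F x) (G x) $ c $ k * Wt x $ Inl k +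
      (if c = Inl k then s * sg k * Zt x $ k - (\<Sum>d\<in>UNIV. stack (F x) (G x) $ d $ k * Wt x $ d) else 0)"
    and pderiv_Zt: "x \<in> \<Omega> \<Longrightarrow> pderiv_at k (\<lambda>y. Zt y $ j) x = sg j * sg k * F x $ k $ j * Zt x $ k +
      (if j = k then s * Wt x $ Inl k - (\<Sum>l\<in>UNIV. F x $ k $ l * Zt x $ l) else 0)"
    and pderiv_B: "x \<in> \<Omega> \<Longrightarrow> pderiv_at k (\<lambda>y. column j (B y)) x = F x $ k $ j *\<^sub>R column k (B x) -
      (if j = k then (\<Sum>l\<in>UNIV. (sg l * sg k * F x $ k $ l) *\<^sub>R column l (B x)) else 0)"
    and quadric: "x \<in> \<Omega> \<Longrightarrow> Wt x \<bullet> Wt x = form_n1 (Zt x)"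
    and Wt_nonzero: "x \<in> \<Omega> \<Longrightarrow> Wt x \<noteq> 0"
begin

text \<open>In terms of \<open>Y = J Zt\<close> and \<open>\<rho> = 1 / \<bar>Wt\<bar>\<^sup>2\<close> the differential equations become polynomial, and most signs
  of the indefinite form disappear.\<close>

definition \<xi> where "\<xi> x = stack (F x) (G x)"
definition \<rho> where "\<rho> x = inverse (Wt x \<bullet> Wt x)"
definition Y where "Y x = J *v Zt x"
definition w where "w x = A x *v Wt x"
definition z where "z x = B x *v Zt x"

abbreviation e where "e c x \<equiv> column c (A x)"
abbreviation Wi where "Wi k x \<equiv> Wt x $ Inl k"

text \<open>These are the transformed data with the hats removed: \<open>Wt\<close> and
  \<open>Zt\<close> have equal norms, so each product of two hat vectors is \<open>\<rho>\<close>
  times the product of the vectors. Moving \<open>A\<close> and \<open>B\<close> into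
  \<open>w\<close> and \<open>z\<close> leaves rank-one corrections.\<close>

definition \<xi>t where "\<xi>t x = \<xi> x - (2 * s * \<rho> x) *\<^sub>R off_diag (outer (Wt x) (Y x))"
definition At where "At x = A x - (2 * \<rho> x) *\<^sub>R outer (w x) (Wt x)"
definition Bt where "Bt x = B x - (2 * \<rho> x) *\<^sub>R outer (z x) (Y x)"
definition Xt where "Xt x = X x + (2 / s * \<rho> x) *\<^sub>R outer (w x) (J *v z x)"

lemma \<xi>_nth: "\<xi> x $ Inl i $ j = F x $ i $ j" "\<xi> x $ Inr k $ j = G x $ k $ j"
  by (simp_all add: \<xi>_def)

lemma \<xi>t_nth: "\<xi>t x $ c $ j = (if c = Inl j then \<xi> x $ c $ j else \<xi> x $ c $ j - 2 * s * \<rho> x * Wt x $ c * Y x $ j)"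
  by (simp add: \<xi>t_def)

lemma sol: "solution_system_II \<Omega> F G B"
  using corr by (simp add: corresponds_def)

lemma smooth_data: "smooth_on \<Omega> F" "smooth_on \<Omega> G" "smooth_on \<Omega> B" "smooth_on \<Omega> A" "smooth_on \<Omega> X"
  using corr by (auto simp: corresponds_def solution_system_II_def)

lemma smooth_\<xi>: "smooth_on \<Omega> \<xi>"
proof (rule smooth_on_vecI[OF open_dom], rule smooth_on_vecI[OF open_dom])
  fix c j show "smooth_on \<Omega> (\<lambda>x. \<xi> x $ c $ j)"
    by (cases c) (simp_all add: \<xi>_nth smooth_on_nth open_dom smooth_data)
qed

lemma F_diag: "x \<in> \<Omega> \<Longrightarrow> F x $ i $ i = 0"
  using sol by (simp add: solution_system_II_def)

lemma orthogonal_A: "x \<in> \<Omega> \<Longrightarrow> orthogonal_matrix (A x)"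
  using corr by (simp add: corresponds_def)

lemma e_inner: "x \<in> \<Omega> \<Longrightarrow> e c x \<bullet> e d x = (if c = d then 1 else 0)"
  using orthogonal_A[of x]
  by (auto simp: orthogonal_matrix_orthonormal_columns pairwise_def orthogonal_def norm_eq_1)

lemma w_eq: "w x = (\<Sum>c\<in>UNIV. Wt x $ c *\<^sub>R e c x)"
  by (simp add: w_def matrix_mult_sum scalar_mult_eq_scaleR)

lemma w_inner: "x \<in> \<Omega> \<Longrightarrow> w x \<bullet> e c x = Wt x $ c"
  by (simp add: w_eq inner_sum_left e_inner mult_delta_right)

lemma w_inner': "x \<in> \<Omega> \<Longrightarrow> e c x \<bullet> w x = Wt x $ c"
  using w_inner[of x c] by (simp add: inner_commute)

lemma w_norm: "x \<in> \<Omega> \<Longrightarrow> \<rho> x * (w x \<bullet> w x) = 1"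
proof -
  assume x: "x \<in> \<Omega>"
  have "w x \<bullet> w x = (\<Sum>c\<in>UNIV. Wt x $ c * (w x \<bullet> e c x))"
    by (subst (2) w_eq) (simp add: inner_sum_right)
  also have "\<dots> = (\<Sum>c\<in>UNIV. Wt x $ c * Wt x $ c)"
    by (simp add: w_inner x)
  also have "\<dots> = Wt x \<bullet> Wt x"
    by (simp add: inner_vec_def)
  finally show ?thesis using Wt_nonzero[OF x] by (simp add: \<rho>_def)
qed

lemma Wt_norm: "x \<in> \<Omega> \<Longrightarrow> \<rho> x * (\<Sum>c\<in>UNIV. Wt x $ c * Wt x $ c) = 1"
proof -
  assume "x \<in> \<Omega>"
  then have "Wt x \<bullet> Wt x \<noteq> 0" by (simp add: Wt_nonzero)
  then show ?thesis by (simp add: \<rho>_def inner_vec_def)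
qed

lemma smooth_\<rho>: "smooth_on \<Omega> \<rho>"
proof -
  have "smooth_on \<Omega> (\<lambda>x. 1 / (Wt x \<bullet> Wt x))"
    by (intro smooth_on_divide smooth_on_const smooth_on_inner open_dom smooth_Wt)
       (simp add: Wt_nonzero)
  moreover have "(\<lambda>x. 1 / (Wt x \<bullet> Wt x)) = \<rho>"
    by (simp add: fun_eq_iff \<rho>_def inverse_eq_divide)
  ultimately show ?thesis by simp
qed

lemma smooth_Y: "smooth_on \<Omega> Y"
  by (rule smooth_on_vecI[OF open_dom])
     (simp add: Y_def, intro smooth_on_mult smooth_on_const smooth_on_nth open_dom smooth_Zt)

lemma smooth_w: "smooth_on \<Omega> w"
  unfolding w_eq[abs_def]
  by (intro smooth_on_sum smooth_on_scaleR smooth_on_nth smooth_on_column open_dom smooth_Wt smooth_data)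

lemma smooth_z: "smooth_on \<Omega> z"
  by (rule smooth_on_vecI[OF open_dom])
     (simp add: z_def matrix_vector_mult_def,
      intro smooth_on_sum smooth_on_mult smooth_on_nth open_dom smooth_Zt smooth_data)

lemma smooth_\<xi>t: "smooth_on \<Omega> \<xi>t"
proof (rule smooth_on_vecI[OF open_dom], rule smooth_on_vecI[OF open_dom])
  fix c j show "smooth_on \<Omega> (\<lambda>x. \<xi>t x $ c $ j)"
    by (cases "c = Inl j")
       (simp_all add: \<xi>t_nth,
        (intro smooth_on_diff smooth_on_mult smooth_on_const smooth_on_nth open_dom smooth_\<xi> smooth_\<rho> smooth_Wt smooth_Y)+)
qed

lemma smooth_At: "smooth_on \<Omega> At"
proof (rule smooth_on_vecI[OF open_dom], rule smooth_on_vecI[OF open_dom])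
  fix c j show "smooth_on \<Omega> (\<lambda>x. At x $ c $ j)"
    by (simp add: At_def,
        intro smooth_on_diff smooth_on_mult smooth_on_const smooth_on_nth open_dom smooth_data smooth_\<rho> smooth_Wt smooth_w)
qed

lemma smooth_Bt: "smooth_on \<Omega> Bt"
proof (rule smooth_on_vecI[OF open_dom], rule smooth_on_vecI[OF open_dom])
  fix c j show "smooth_on \<Omega> (\<lambda>x. Bt x $ c $ j)"
    by (simp add: Bt_def,
        intro smooth_on_diff smooth_on_mult smooth_on_const smooth_on_nth open_dom smooth_data smooth_\<rho> smooth_Y smooth_z)
qed

lemma smooth_Xt: "smooth_on \<Omega> Xt"
proof (rule smooth_on_vecI[OF open_dom], rule smooth_on_vecI[OF open_dom])
  fix c j show "smooth_on \<Omega> (\<lambda>x. Xt x $ c $ j)"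
    unfolding Xt_def vector_add_component vector_scaleR_component outer_nth J_vector_mult real_scaleR_def
    by (intro smooth_on_add smooth_on_mult smooth_on_const smooth_on_nth open_dom smooth_data smooth_\<rho> smooth_w smooth_z)
qed

text \<open>By \<open>w_inner\<close>, \<open>Wt x $ c\<close> is the inner product of
  \<open>w x\<close> with \<open>e c x\<close>; hence this is the reflection of \<open>e c x\<close>
  in the hyperplane orthogonal to \<open>w x\<close>.\<close>

lemma column_At: "column c (At x) = e c x - (2 * \<rho> x * Wt x $ c) *\<^sub>R w x"
  by (simp add: vec_eq_iff column_def At_def ac_simps)

lemma Xt_column: "column j (Xt x) = column j (X x) + (2 / s * sg j * \<rho> x * z x $ j) *\<^sub>R w x"
  by (simp add: vec_eq_iff column_def Xt_def ac_simps)

lemma Bt_nth: "Bt x $ i $ j = B x $ i $ j - 2 * \<rho> x * z x $ i * Y x $ j"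
  by (simp add: Bt_def ac_simps)

context
  fixes x assumes x: "x \<in> \<Omega>"
begin

lemma pd_e: "has_pderiv (e c) k (\<xi> x $ c $ k *\<^sub>R e (Inl k) x -
    (if c = Inl k then (\<Sum>d\<in>UNIV. \<xi> x $ d $ k *\<^sub>R e d x) else 0)) x"
proof -
  have "pderiv_at k (e c) x = \<xi> x $ c $ k *\<^sub>R e (Inl k) x -
      (if c = Inl k then (\<Sum>d\<in>UNIV. \<xi> x $ d $ k *\<^sub>R e d x) else 0)"
    using corresponds_pderiv_A[OF open_dom corr x] by (simp add: \<xi>_def)
  then show ?thesis
    using smooth_has_pderiv[OF open_dom smooth_on_column[OF open_dom smooth_data(4)] x] by metis
qed

lemma pd_Wt: "has_pderiv (\<lambda>y. Wt y $ c) k (\<xi> x $ c $ k * Wi k x +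
    (if c = Inl k then s * Y x $ k - (\<Sum>d\<in>UNIV. \<xi> x $ d $ k * Wt x $ d) else 0)) x"
  using smooth_has_pderiv[OF open_dom smooth_on_nth[OF open_dom smooth_Wt, of c] x, of k]
  by (cases "c = Inl k") (simp_all add: pderiv_Wt x \<xi>_def Y_def mult.assoc)

lemma pd_Y: "j \<noteq> k \<Longrightarrow> has_pderiv (\<lambda>y. Y y $ j) k (F x $ k $ j * Y x $ k) x"
proof -
  assume "j \<noteq> k"
  then have "has_pderiv (\<lambda>y. sg j * Zt y $ j) k (sg j * (sg j * sg k * F x $ k $ j * Zt x $ k)) x"
    using has_pderiv_bounded_linear[OF bounded_linear_mult_right
        smooth_has_pderiv[OF open_dom smooth_on_nth[OF open_dom smooth_Zt, of j] x], of "sg j" k]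
    by (simp add: pderiv_Zt x)
  then show ?thesis by (simp add: Y_def mult.assoc mult.left_commute)
qed

lemma pd_B_nth: "has_pderiv (\<lambda>y. B y $ i $ j) k (F x $ k $ j * B x $ i $ k -
    (if j = k then (\<Sum>l\<in>UNIV. sg l * sg k * F x $ k $ l * B x $ i $ l) else 0)) x"
proof -
  have "has_pderiv (\<lambda>y. column j (B y) $ i) k ((F x $ k $ j *\<^sub>R column k (B x) -
      (if j = k then (\<Sum>l\<in>UNIV. (sg l * sg k * F x $ k $ l) *\<^sub>R column l (B x)) else 0)) $ i) x"
    using has_pderiv_nth[OF smooth_has_pderiv[OF open_dom smooth_on_column[OF open_dom smooth_data(3)] x]]
    by (simp only: pderiv_B[OF x])
  then show ?thesis by (cases "j = k") (simp_all add: column_def)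
qed

lemma pd_w: "has_pderiv w k ((s * Y x $ k) *\<^sub>R e (Inl k) x) x"
proof -
  have "has_pderiv w k (\<Sum>c\<in>UNIV. Wt x $ c *\<^sub>R (\<xi> x $ c $ k *\<^sub>R e (Inl k) x -
      (if c = Inl k then (\<Sum>d\<in>UNIV. \<xi> x $ d $ k *\<^sub>R e d x) else 0)) +
     (\<xi> x $ c $ k * Wi k x + (if c = Inl k then s * Y x $ k - (\<Sum>d\<in>UNIV. \<xi> x $ d $ k * Wt x $ d) else 0)) *\<^sub>R e c x) x"
    unfolding w_eq[abs_def] by (intro has_pderiv_sum has_pderiv_scaleR pd_Wt pd_e)
  moreover have "(\<Sum>c\<in>UNIV. Wt x $ c *\<^sub>R (if c = Inl k then v else 0)) = Wi k x *\<^sub>R v" for v :: "real^('n option + 'k)"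
    by (simp add: if_distrib[of "scaleR _"] cong: if_cong)
  ultimately show ?thesis
    by (elim has_pderiv_eq)
       (simp add: sum.distrib sum_subtractf scaleR_add_left scaleR_diff_right scaleR_delta
          scaleR_sum_left scaleR_sum_right algebra_simps)
qed

lemma pd_z: "has_pderiv (\<lambda>y. z y $ i) k (s * Wi k x * B x $ i $ k) x"
proof -
  have "has_pderiv (\<lambda>y. \<Sum>j\<in>UNIV. B y $ i $ j * Zt y $ j) k
    (\<Sum>j\<in>UNIV. B x $ i $ j * (sg j * sg k * F x $ k $ j * Zt x $ k +
      (if j = k then s * Wt x $ Inl k - (\<Sum>l\<in>UNIV. F x $ k $ l * Zt x $ l) else 0)) +
     (F x $ k $ j * B x $ i $ k -
    (if j = k then (\<Sum>l\<in>UNIV. sg l * sg k * F x $ k $ l * B x $ i $ l) else 0)) * Zt x $ j) x"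
    using smooth_has_pderiv[OF open_dom smooth_on_nth[OF open_dom smooth_Zt] x]
    by (intro has_pderiv_sum has_pderiv_mult pd_B_nth) (simp only: pderiv_Zt[OF x, symmetric])
  then show ?thesis
    unfolding z_def matrix_vector_mult_def vec_lambda_beta
    by (elim has_pderiv_eq)
       (simp add: sum.distrib sum_subtractf mult_delta_right mult_delta_left sum_distrib_left sum_distrib_right
          algebra_simps)
qed

text \<open>The terms with \<open>\<xi>\<close> cancel by skew-symmetry; only the coupling to
  \<open>Zt\<close> changes the length of \<open>Wt\<close>.\<close>

lemma pd_\<rho>: "has_pderiv \<rho> k (- 2 * s * Y x $ k * Wi k x * (\<rho> x)\<^sup>2) x"
proof -
  have "has_pderiv (\<lambda>y. \<Sum>c\<in>UNIV. Wt y $ c * Wt y $ c) k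
     (\<Sum>c\<in>UNIV. Wt x $ c * (\<xi> x $ c $ k * Wi k x +
       (if c = Inl k then s * Y x $ k - (\<Sum>d\<in>UNIV. \<xi> x $ d $ k * Wt x $ d) else 0)) +
      (\<xi> x $ c $ k * Wi k x +
       (if c = Inl k then s * Y x $ k - (\<Sum>d\<in>UNIV. \<xi> x $ d $ k * Wt x $ d) else 0)) * Wt x $ c) x"
    by (intro has_pderiv_sum has_pderiv_mult pd_Wt)
  then have "has_pderiv (\<lambda>y. Wt y \<bullet> Wt y) k (2 * s * Y x $ k * Wi k x) x"
    unfolding inner_vec_def inner_real_def
    by (elim has_pderiv_eq)
       (simp add: sum.distrib sum_subtractf mult_delta_right mult_delta_left sum_distrib_left sum_distrib_right
          algebra_simps)
  from has_pderiv_inverse[OF this] show ?thesis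
    using Wt_nonzero[OF x] by (simp add: \<rho>_def[abs_def] field_simps power2_eq_square)
qed

text \<open>For a column other than \<open>Inl k\<close>, comparing coefficients of
  \<open>e (Inl k) x\<close> and \<open>w x\<close> suffices. The derivative of column
  \<open>Inl k\<close> involves all columns, so there the reflection has to be summed.\<close>

lemma pd_At: "has_pderiv (\<lambda>y. column c (At y)) k (\<xi>t x $ c $ k *\<^sub>R column (Inl k) (At x) -
    (if c = Inl k then (\<Sum>d\<in>UNIV. \<xi>t x $ d $ k *\<^sub>R column d (At x)) else 0)) x"
proof -
  let ?Wk = "\<xi> x $ c $ k * Wi k x + (if c = Inl k then s * Y x $ k - (\<Sum>d\<in>UNIV. \<xi> x $ d $ k * Wt x $ d) else 0)"
  have D: "has_pderiv (\<lambda>y. column c (At y)) k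
    ((\<xi> x $ c $ k *\<^sub>R e (Inl k) x - (if c = Inl k then (\<Sum>d\<in>UNIV. \<xi> x $ d $ k *\<^sub>R e d x) else 0)) -
     ((2 * \<rho> x * Wt x $ c) *\<^sub>R ((s * Y x $ k) *\<^sub>R e (Inl k) x) +
      ((2 * \<rho> x) * ?Wk + (2 * (- 2 * s * Y x $ k * Wi k x * (\<rho> x)\<^sup>2)) * Wt x $ c) *\<^sub>R w x)) x"
    unfolding column_At
    by (intro has_pderiv_diff has_pderiv_scaleR has_pderiv_mult pd_e pd_w pd_Wt
        has_pderiv_bounded_linear[OF bounded_linear_mult_right] pd_\<rho>)
  show ?thesis
  proof (cases "c = Inl k")
    case False
    then show ?thesis
      by (intro has_pderiv_eq[OF D]) (simp add: \<xi>t_nth column_At algebra_simps power2_eq_square)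
  next
    case True
    define c_k where "c_k = 2 * s * \<rho> x * Y x $ k"
    have Fkk: "\<xi> x $ Inl k $ k = 0" by (simp add: \<xi>_nth F_diag x)
    \<comment> \<open>The correction \<open>c_k * Wt x $ d\<close> is suppressed at the diagonal
      entry \<open>d = Inl k\<close>. The sum is completed to all \<open>d\<close>, and a separate
      term compensates.\<close>
    have "(\<Sum>d\<in>UNIV. \<xi>t x $ d $ k *\<^sub>R column d (At x)) =
      (\<Sum>d\<in>UNIV. (\<xi> x $ d $ k - c_k * Wt x $ d) *\<^sub>R column d (At x) +
        (if d = Inl k then (c_k * Wi k x) *\<^sub>R column (Inl k) (At x) else 0))"
      by (rule sum.cong[OF refl]) (simp add: \<xi>t_nth c_k_def Fkk algebra_simps)
    also have "\<dots> = (\<Sum>d\<in>UNIV. (\<xi> x $ d $ k - c_k * Wt x $ d) *\<^sub>R column d (At x))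
        + (c_k * Wi k x) *\<^sub>R column (Inl k) (At x)"
      by (simp add: sum.distrib)
    also have "(\<Sum>d\<in>UNIV. (\<xi> x $ d $ k - c_k * Wt x $ d) *\<^sub>R column d (At x)) =
      (\<Sum>d\<in>UNIV. \<xi> x $ d $ k *\<^sub>R e d x) - c_k *\<^sub>R (\<Sum>d\<in>UNIV. Wt x $ d *\<^sub>R e d x) -
       (2 * \<rho> x * (\<Sum>d\<in>UNIV. \<xi> x $ d $ k * Wt x $ d)) *\<^sub>R w x
       + (2 * c_k * (\<rho> x * (\<Sum>d\<in>UNIV. Wt x $ d * Wt x $ d))) *\<^sub>R w x"
      by (simp add: column_At sum.distrib sum_subtractf scaleR_sum_left scaleR_sum_right
          sum_distrib_left algebra_simps)
    also note w_eq[symmetric]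
    \<comment> \<open>The reflection sends \<open>w\<close> to its negative: by
      \<open>Wt_norm\<close> the coefficients \<open>- c_k\<close> and \<open>2 * c_k\<close> of
      \<open>w x\<close> combine to \<open>c_k\<close>.\<close>
    finally have "(\<Sum>d\<in>UNIV. \<xi>t x $ d $ k *\<^sub>R column d (At x)) =
      (\<Sum>d\<in>UNIV. \<xi> x $ d $ k *\<^sub>R e d x) + c_k *\<^sub>R w x -
       (2 * \<rho> x * (\<Sum>d\<in>UNIV. \<xi> x $ d $ k * Wt x $ d)) *\<^sub>R w x + (c_k * Wi k x) *\<^sub>R column (Inl k) (At x)"
      unfolding Wt_norm[OF x] mult_1_right mult_2 scaleR_add_left by simp
    then show ?thesis
      using True
      by (intro has_pderiv_eq[OF D])
         (simp add: \<xi>t_nth Fkk column_At c_k_def algebra_simps power2_eq_square)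
  qed
qed

lemma pd_X: "has_pderiv (\<lambda>y. column j (X y)) k (- (sg j * B x $ j $ k) *\<^sub>R e (Inl k) x) x"
proof -
  have "pderiv_at k (\<lambda>y. column j (X y)) x = - (sg j * B x $ j $ k) *\<^sub>R e (Inl k) x"
    using corresponds_pderiv_X[OF open_dom corr x] by simp
  then show ?thesis
    using smooth_has_pderiv[OF open_dom smooth_on_column[OF open_dom smooth_data(5)] x] by metis
qed

text \<open>The four terms of the Leibniz rule are the expanded product of two rank-one corrections,
  the one in \<open>Bt\<close> and the one in \<open>At\<close>.\<close>

lemma pd_Xt: "has_pderiv (\<lambda>y. column j (Xt y)) k (- (sg j * Bt x $ j $ k) *\<^sub>R column (Inl k) (At x)) x"
proof -
  have "has_pderiv (\<lambda>y. column j (Xt y)) k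
    (- (sg j * B x $ j $ k) *\<^sub>R e (Inl k) x +
     ((2 / s * sg j * \<rho> x * z x $ j) *\<^sub>R ((s * Y x $ k) *\<^sub>R e (Inl k) x) +
      ((2 / s * sg j * \<rho> x) * (s * Wi k x * B x $ j $ k) +
       (2 / s * sg j * (- 2 * s * Y x $ k * Wi k x * (\<rho> x)\<^sup>2)) * z x $ j) *\<^sub>R w x)) x"
    unfolding Xt_column
    by (intro has_pderiv_add has_pderiv_scaleR has_pderiv_mult pd_X pd_w pd_z
        has_pderiv_bounded_linear[OF bounded_linear_mult_right] pd_\<rho>)
  then show ?thesis
    by (elim has_pderiv_eq)
       (simp add: column_At Bt_nth s_nonzero algebra_simps power2_eq_square)
qed

lemma pd_Bt_nth:
  assumes "j \<noteq> k"
  shows "has_pderiv (\<lambda>y. Bt y $ i $ j) k (\<xi>t x $ Inl k $ j * Bt x $ i $ k) x"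
proof -
  have "has_pderiv (\<lambda>y. Bt y $ i $ j) k ((F x $ k $ j * B x $ i $ k - 0) -
     (2 * \<rho> x * z x $ i * (F x $ k $ j * Y x $ k) +
      (2 * \<rho> x * (s * Wi k x * B x $ i $ k) + (2 * (- 2 * s * Y x $ k * Wi k x * (\<rho> x)\<^sup>2)) * z x $ i) * Y x $ j)) x"
    unfolding Bt_nth
    by (intro has_pderiv_diff has_pderiv_mult pd_Y assms pd_z
        has_pderiv_bounded_linear[OF bounded_linear_mult_right] pd_\<rho>)
       (use pd_B_nth[of i j k] assms in simp)
  then show ?thesis
    using assms by (elim has_pderiv_eq) (simp add: \<xi>t_nth \<xi>_nth Bt_nth algebra_simps power2_eq_square)
qed

text \<open>For \<open>c = Inl i\<close> this is the equation for three distinct indices of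
  \<open>F\<close>, for \<open>c = Inr i\<close> the equation for \<open>G\<close>; stacked, they
  have the same form.\<close>

lemma pd_\<xi>: "j \<noteq> k \<Longrightarrow> c \<noteq> Inl j \<Longrightarrow> c \<noteq> Inl k \<Longrightarrow>
    has_pderiv (\<lambda>y. \<xi> y $ c $ j) k (\<xi> x $ c $ k * F x $ k $ j) x"
proof -
  assume c: "j \<noteq> k" "c \<noteq> Inl j" "c \<noteq> Inl k"
  have "pderiv_at k (\<lambda>y. \<xi> y $ c $ j) x = \<xi> x $ c $ k * F x $ k $ j"
    using sol x c by (cases c) (auto simp: solution_system_II_def \<xi>_nth)
  then show ?thesis
    using smooth_has_pderiv[OF open_dom smooth_on_nth[OF open_dom smooth_on_nth[OF open_dom smooth_\<xi>]] x] by metis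
qed

lemma pd_\<xi>t:
  assumes c: "j \<noteq> k" "c \<noteq> Inl j" "c \<noteq> Inl k"
  shows "has_pderiv (\<lambda>y. \<xi>t y $ c $ j) k (\<xi>t x $ c $ k * \<xi>t x $ Inl k $ j) x"
proof -
  have "has_pderiv (\<lambda>y. \<xi> y $ c $ j - 2 * s * \<rho> y * Wt y $ c * Y y $ j) k
    (\<xi> x $ c $ k * F x $ k $ j - (2 * s * \<rho> x * Wt x $ c * (F x $ k $ j * Y x $ k) +
     (2 * s * \<rho> x * (\<xi> x $ c $ k * Wi k x) + (2 * s * (- 2 * s * Y x $ k * Wi k x * (\<rho> x)\<^sup>2)) * Wt x $ c) * Y x $ j)) x"
    by (intro has_pderiv_diff has_pderiv_mult pd_Y pd_\<xi> c
        has_pderiv_bounded_linear[OF bounded_linear_mult_right] pd_\<rho>)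
       (use pd_Wt[of c k] c in simp)
  then have "has_pderiv (\<lambda>y. \<xi> y $ c $ j - 2 * s * \<rho> y * Wt y $ c * Y y $ j) k
    (\<xi>t x $ c $ k * \<xi>t x $ Inl k $ j) x"
    using c by (elim has_pderiv_eq) (simp add: \<xi>t_nth \<xi>_nth algebra_simps power2_eq_square)
  then show ?thesis using c by (simp add: \<xi>t_nth)
qed

text \<open>The system constrains the derivative of \<open>f_ij\<close> along \<open>x_i\<close>
  only together with its mirror image, so this derivative of \<open>F\<close> stays symbolic until
  both are added.\<close>

lemma pd_\<xi>t_diag:
  assumes "i \<noteq> j"
  shows "pderiv_at i (\<lambda>y. \<xi>t y $ Inl i $ j) x = pderiv_at i (\<lambda>y. F y $ i $ j) x -
    2 * s * \<rho> x * (Wi i x * F x $ i $ j * Y x $ i + s * Y x $ i * Y x $ j - Y x $ j * (\<Sum>d\<in>UNIV. \<xi> x $ d $ i * Wt x $ d)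
      - 2 * s * \<rho> x * Y x $ i * Y x $ j * Wi i x * Wi i x)"
proof -
  have "has_pderiv (\<lambda>y. \<xi> y $ Inl i $ j - 2 * s * \<rho> y * Wi i y * Y y $ j) i
    (pderiv_at i (\<lambda>y. F y $ i $ j) x - (2 * s * \<rho> x * Wi i x * (F x $ i $ j * Y x $ i) +
     (2 * s * \<rho> x * (s * Y x $ i - (\<Sum>d\<in>UNIV. \<xi> x $ d $ i * Wt x $ d)) +
      (2 * s * (- 2 * s * Y x $ i * Wi i x * (\<rho> x)\<^sup>2)) * Wi i x) * Y x $ j)) x"
    unfolding \<xi>_nth
    by (intro has_pderiv_diff has_pderiv_mult pd_Y assms[symmetric]
        has_pderiv_bounded_linear[OF bounded_linear_mult_right] pd_\<rho>
        smooth_has_pderiv[OF open_dom] smooth_on_nth open_dom smooth_data x)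
       (use pd_Wt[of "Inl i" i] in \<open>simp add: F_diag x \<xi>_nth\<close>)
  from has_pderiv_imp[OF this] show ?thesis
    using assms by (simp add: \<xi>t_nth algebra_simps power2_eq_square)
qed

text \<open>The sums \<open>Si\<close> and \<open>Sj\<close>, which enter through the derivatives of
  \<open>Wt\<close>, cancel against the cross terms of the product sum.\<close>

lemma gauss_\<xi>t:
  assumes ij: "i \<noteq> j"
  shows "pderiv_at i (\<lambda>y. \<xi>t y $ Inl i $ j) x + pderiv_at j (\<lambda>y. \<xi>t y $ Inl j $ i) x
    + (\<Sum>c\<in>UNIV. \<xi>t x $ c $ i * \<xi>t x $ c $ j) = 0"
proof -
  define ci cj where "ci = 2 * s * \<rho> x * Y x $ i" and "cj = 2 * s * \<rho> x * Y x $ j"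
  define Si Sj where "Si = (\<Sum>d\<in>UNIV. \<xi> x $ d $ i * Wt x $ d)" and "Sj = (\<Sum>d\<in>UNIV. \<xi> x $ d $ j * Wt x $ d)"
  have base: "pderiv_at i (\<lambda>y. F y $ i $ j) x + pderiv_at j (\<lambda>y. F y $ j $ i) x
    + (\<Sum>c\<in>UNIV. \<xi> x $ c $ i * \<xi> x $ c $ j) = 0"
    using sol x ij by (simp add: solution_system_II_def sum_UNIV_Plus \<xi>_nth add.assoc)
  \<comment> \<open>The diagonal entries carry no correction; the two conditional summands
    compensate for this at \<open>c = Inl i\<close> and \<open>c = Inl j\<close>.\<close>
  have "(\<Sum>c\<in>UNIV. \<xi>t x $ c $ i * \<xi>t x $ c $ j) =
    (\<Sum>c\<in>UNIV. (\<xi> x $ c $ i - ci * Wt x $ c) * (\<xi> x $ c $ j - cj * Wt x $ c)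
      + (if c = Inl i then ci * Wi i x * (F x $ i $ j - cj * Wi i x) else 0)
      + (if c = Inl j then cj * Wi j x * (F x $ j $ i - ci * Wi j x) else 0))"
    by (rule sum.cong[OF refl])
       (use ij in \<open>auto simp: \<xi>t_nth \<xi>_nth F_diag x ci_def cj_def algebra_simps\<close>)
  also have "\<dots> = (\<Sum>c\<in>UNIV. \<xi> x $ c $ i * \<xi> x $ c $ j) - cj * Si - ci * Sj
      + ci * cj * (\<Sum>c\<in>UNIV. Wt x $ c * Wt x $ c)
      + ci * Wi i x * (F x $ i $ j - cj * Wi i x) + cj * Wi j x * (F x $ j $ i - ci * Wi j x)"
    by (simp add: sum.distrib sum_subtractf sum_distrib_left Si_def Sj_def algebra_simps)
  \<comment> \<open>The factor \<open>\<rho>\<close> in \<open>ci\<close> absorbs the squared length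
    of \<open>Wt\<close>. The result cancels the terms with \<open>s * Y x $ i * Y x $ j\<close>
    from the two derivatives.\<close>
  also have "ci * cj * (\<Sum>c\<in>UNIV. Wt x $ c * Wt x $ c) = 2 * s * Y x $ i * cj"
  proof -
    have "ci * cj * (\<Sum>c\<in>UNIV. Wt x $ c * Wt x $ c) =
        2 * s * Y x $ i * cj * (\<rho> x * (\<Sum>c\<in>UNIV. Wt x $ c * Wt x $ c))"
      by (simp only: ci_def ac_simps)
    then show ?thesis by (simp add: Wt_norm x)
  qed
  finally show ?thesis
    using base
    unfolding pd_\<xi>t_diag[OF ij] pd_\<xi>t_diag[OF ij[symmetric]] Si_def[symmetric] Sj_def[symmetric]
    by (simp add: ci_def cj_def algebra_simps)
qed

lemma orthogonal_At: "orthogonal_matrix (At x)"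
proof -
  have "column c (At x) \<bullet> column d (At x) = (if c = d then 1 else 0)" for c d
  proof -
    have "column c (At x) \<bullet> column d (At x) = e c x \<bullet> e d x - 4 * \<rho> x * Wt x $ c * Wt x $ d
       + 4 * \<rho> x * Wt x $ c * Wt x $ d * (\<rho> x * (w x \<bullet> w x))"
      by (simp add: column_At inner_diff_left inner_diff_right w_inner w_inner' x algebra_simps)
    then show ?thesis by (simp add: w_norm x e_inner)
  qed
  then show ?thesis
    by (simp add: orthogonal_matrix_orthonormal_columns pairwise_def orthogonal_def norm_eq_1)
qed

text \<open>\<open>B\<close> preserves the indefinite form, so \<open>z\<close> has the same form
  value as \<open>Zt\<close>, which is the squared length of \<open>Wt\<close> that
  \<open>\<rho>\<close> inverts.\<close>

lemma form_z: "\<rho> x * (\<Sum>i\<in>UNIV. sg i * z x $ i * z x $ i) = 1"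
  and B_z: "(\<Sum>i\<in>UNIV. sg i * B x $ i $ j * z x $ i) = Y x $ j"
proof -
  have B: "(\<Sum>i\<in>UNIV. sg i * B x $ i $ j * B x $ i $ l) = (if j = l then sg j else 0)" for j l
    using correspondsD(7)[OF corr x] by (simp add: O_n1_iff)
  have z_nth: "z x $ i = (\<Sum>l\<in>UNIV. B x $ i $ l * Zt x $ l)" for i
    by (simp add: z_def matrix_vector_mult_def)
  show B_z: "(\<Sum>i\<in>UNIV. sg i * B x $ i $ j * z x $ i) = Y x $ j" for j
  proof -
    have "(\<Sum>i\<in>UNIV. sg i * B x $ i $ j * z x $ i) =
        (\<Sum>i\<in>UNIV. \<Sum>l\<in>UNIV. (sg i * B x $ i $ j * B x $ i $ l) * Zt x $ l)"
      by (simp add: z_nth sum_distrib_left mult.assoc)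
    also have "\<dots> = (\<Sum>l\<in>UNIV. (\<Sum>i\<in>UNIV. sg i * B x $ i $ j * B x $ i $ l) * Zt x $ l)"
      unfolding sum_distrib_right by (rule sum.swap)
    also have "\<dots> = Y x $ j"
      by (simp add: B Y_def mult_delta_left)
    finally show ?thesis .
  qed
  have "(\<Sum>i\<in>UNIV. sg i * z x $ i * z x $ i) = (\<Sum>i\<in>UNIV. \<Sum>l\<in>UNIV. (sg i * B x $ i $ l * z x $ i) * Zt x $ l)"
    by (subst (2) z_nth) (simp add: sum_distrib_left ac_simps)
  also have "\<dots> = (\<Sum>l\<in>UNIV. (\<Sum>i\<in>UNIV. sg i * B x $ i $ l * z x $ i) * Zt x $ l)"
    unfolding sum_distrib_right by (rule sum.swap)
  also have "\<dots> = Wt x \<bullet> Wt x"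
    unfolding B_z by (simp add: quadric x form_n1_eq Y_def power2_eq_square ac_simps)
  finally show "\<rho> x * (\<Sum>i\<in>UNIV. sg i * z x $ i * z x $ i) = 1"
    using Wt_nonzero[OF x] by (simp add: \<rho>_def)
qed

text \<open>\<open>Bt\<close> is \<open>B\<close> followed by the reflection along \<open>z\<close>
  with respect to the indefinite form; \<open>form_z\<close> gives the normalisation of this
  reflection.\<close>

lemma Bt_O_n1: "Bt x \<in> O_n1"
  unfolding O_n1_iff
proof (intro allI)
  fix j l
  have "(\<Sum>i\<in>UNIV. sg i * Bt x $ i $ j * Bt x $ i $ l) =
      (\<Sum>i\<in>UNIV. sg i * B x $ i $ j * B x $ i $ l)
      - 2 * \<rho> x * Y x $ l * (\<Sum>i\<in>UNIV. sg i * B x $ i $ j * z x $ i)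
      - 2 * \<rho> x * Y x $ j * (\<Sum>i\<in>UNIV. sg i * B x $ i $ l * z x $ i)
      + 4 * \<rho> x * Y x $ j * Y x $ l * (\<rho> x * (\<Sum>i\<in>UNIV. sg i * z x $ i * z x $ i))"
    by (simp add: Bt_nth sum.distrib sum_subtractf sum_distrib_left algebra_simps)
  then show "(\<Sum>i\<in>UNIV. sg i * Bt x $ i $ j * Bt x $ i $ l) = (if j = l then sg j else 0)"
    using correspondsD(7)[OF corr x] by (simp add: form_z B_z O_n1_iff)
qed

end

theorem corresponds_Xt:
  "corresponds \<Omega> Xt (\<lambda>x. \<chi> i. \<xi>t x $ Inl i) (\<lambda>x. \<chi> k. \<xi>t x $ Inr k) Bt At"
proof -
  have stack: "stack (\<chi> i. \<xi>t x $ Inl i) (\<chi> k. \<xi>t x $ Inr k) = \<xi>t x" for x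
  proof -
    have "stack (\<chi> i. \<xi>t x $ Inl i) (\<chi> k. \<xi>t x $ Inr k) $ c $ j = \<xi>t x $ c $ j" for c j
      by (cases c) simp_all
    then show ?thesis by (simp add: vec_eq_iff)
  qed
  have "smooth_on \<Omega> (\<lambda>x. \<chi> i. \<xi>t x $ Inl i)" "smooth_on \<Omega> (\<lambda>x. \<chi> k. \<xi>t x $ Inr k)"
    by (rule smooth_on_vecI[OF open_dom], simp add: smooth_on_nth[OF _ smooth_\<xi>t] open_dom)+
  moreover have "pderiv_at k Xt x = - (left_block (At x) ** C k ** transpose (Bt x) ** J)" if "x \<in> \<Omega>" for x k
  proof -
    have "pderiv_at k Xt x $ r $ j = (- (sg j * Bt x $ j $ k) *\<^sub>R column (Inl k) (At x)) $ r" for r j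
    proof -
      have "pderiv_at k Xt x $ r $ j = column j (pderiv_at k Xt x) $ r" by (simp add: column_def)
      then show ?thesis
        by (simp only: pderiv_column[OF open_dom smooth_Xt that, symmetric] has_pderiv_imp[OF pd_Xt[OF that]])
    qed
    then show ?thesis
      by (simp add: vec_eq_iff left_block_mult_nth column_def del: matrix_mult_J_nth)
  qed
  moreover have "matrix_inv (At x) ** pderiv_at i At x =
      block (- ((\<chi> i. \<xi>t x $ Inl i) ** C i) + C i ** transpose (\<chi> i. \<xi>t x $ Inl i))
        (C i ** transpose (\<chi> k. \<xi>t x $ Inr k)) (- ((\<chi> k. \<xi>t x $ Inr k) ** C i)) 0" if "x \<in> \<Omega>" for x i
    unfolding connection_iff_columns[OF open_dom smooth_At that orthogonal_At[OF that]] stack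
    using has_pderiv_imp[OF pd_At[OF that]] by blast
  moreover have "solution_system_II \<Omega> (\<lambda>x. \<chi> i. \<xi>t x $ Inl i) (\<lambda>x. \<chi> k. \<xi>t x $ Inr k) Bt"
    unfolding solution_system_II_def
  proof (intro conjI ballI allI impI)
    fix x assume x: "x \<in> \<Omega>"
    show "(\<chi> i. \<xi>t x $ Inl i) $ i $ i = 0" for i
      by (simp add: \<xi>t_nth \<xi>_nth F_diag x)
    show "Bt x \<in> O_n1" by (rule Bt_O_n1[OF x])
    show "pderiv_at i (\<lambda>y. (\<chi> i. \<xi>t y $ Inl i) $ i $ j) x + pderiv_at j (\<lambda>y. (\<chi> i. \<xi>t y $ Inl i) $ j $ i) x
           + (\<Sum>k\<in>UNIV. (\<chi> i. \<xi>t x $ Inl i) $ k $ i * (\<chi> i. \<xi>t x $ Inl i) $ k $ j)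
           + (\<Sum>k\<in>UNIV. (\<chi> k. \<xi>t x $ Inr k) $ k $ i * (\<chi> k. \<xi>t x $ Inr k) $ k $ j) = 0" if "i \<noteq> j" for i j
      using gauss_\<xi>t[OF x that] by (simp add: sum_UNIV_Plus add.assoc)
    show "pderiv_at k (\<lambda>y. (\<chi> i. \<xi>t y $ Inl i) $ i $ j) x = (\<chi> i. \<xi>t x $ Inl i) $ i $ k * (\<chi> i. \<xi>t x $ Inl i) $ k $ j"
      if "i \<noteq> j \<and> j \<noteq> k \<and> i \<noteq> k" for i j k
      using that by (simp add: has_pderiv_imp[OF pd_\<xi>t[OF x]])
    show "pderiv_at k (\<lambda>y. Bt y $ i $ j) x = (\<chi> i. \<xi>t x $ Inl i) $ k $ j * Bt x $ i $ k" if "j \<noteq> k" for i j k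
      using that by (simp add: has_pderiv_imp[OF pd_Bt_nth[OF x]])
    show "pderiv_at k (\<lambda>y. (\<chi> k. \<xi>t y $ Inr k) $ i $ j) x = (\<chi> i. \<xi>t x $ Inl i) $ k $ j * (\<chi> k. \<xi>t x $ Inr k) $ i $ k"
      if "j \<noteq> k" for i j k
      using that by (simp add: has_pderiv_imp[OF pd_\<xi>t[OF x]])
  qed (fact calculation smooth_Bt)+
  ultimately show ?thesis
    unfolding corresponds_def by (simp add: smooth_At smooth_Xt orthogonal_At)
qed

end

section \<open>From solutions to curvature line coordinates and tuples of type O(n,1)\<close>

lemma corresponds_curvature_line_param:
  assumes "open U" "corresponds U X F G B A" and B: "\<And>x i. x \<in> U \<Longrightarrow> B x $ j $ i \<noteq> 0"
  shows "curvature_line_param U (\<lambda>x. column j (X x)) A (\<lambda>x. \<chi> i. - (sg j * B x $ j $ i)) G"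
proof
  note sm = correspondsD[OF assms(2)]
  show "open U" "smooth_on U A" by (fact assms sm)+
  show "smooth_on U (\<lambda>x. column j (X x))" by (rule smooth_on_column[OF assms(1) sm(5)])
  show "orthogonal_matrix (A x)" if "x \<in> U" for x by (rule sm(6)[OF that])
  fix x i assume x: "x \<in> U"
  show "pderiv_at i (\<lambda>x. column j (X x)) x = (\<chi> i. - (sg j * B x $ j $ i)) $ i *\<^sub>R column (Inl i) (A x)"
    by (simp add: corresponds_pderiv_X[OF assms(1,2) x])
  show "pderiv_at i (\<lambda>y. column (Inr k) (A y)) x = G x $ k $ i *\<^sub>R column (Inl i) (A x)" for k
    by (simp add: corresponds_pderiv_A[OF assms(1,2) x])
  show "(\<chi> i. - (sg j * B x $ j $ i)) $ i \<noteq> 0" using B[OF x] by simp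
qed

theorem corresponds_tuple:
  assumes U: "open_domain U" and c: "corresponds U X F G B A"
    and B: "\<And>x j i. x \<in> U \<Longrightarrow> B x $ j $ i \<noteq> 0" and G: "\<And>x. x \<in> U \<Longrightarrow> rank (G x) = CARD('n option)"
  shows "tuple_type_O_n1 U (X :: real^'n::finite option \<Rightarrow> real^'n option^('n option + 'k::finite))"
proof -
  have "open U" using U by (simp add: open_domain_def)
  note P = corresponds_curvature_line_param[OF this c B]
  \<comment> \<open>The speeds of the coordinate lines form the matrix \<open>- (J ** B x)\<close>,
    because the equation for \<open>X\<close> carries a minus sign and a factor \<open>J\<close>.
    This matrix is again in \<open>O_n1\<close>.\<close>
  let ?\<beta> = "\<lambda>x. \<chi> j i. - (sg j * B x $ j $ i)"
  have "smooth_on U ?\<beta>"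
  proof (rule smooth_on_vecI[OF \<open>open U\<close>], rule smooth_on_vecI[OF \<open>open U\<close>])
    fix j i
    have "smooth_on U (\<lambda>x. (- sg j) * B x $ j $ i)"
      by (intro smooth_on_mult smooth_on_const smooth_on_nth \<open>open U\<close> correspondsD(3)[OF c])
    then show "smooth_on U (\<lambda>x. ?\<beta> x $ j $ i)" by simp
  qed
  moreover have "smooth_on U G" by (rule correspondsD(2)[OF c])
  moreover have "?\<beta> x \<in> O_n1" if "x \<in> U" for x
    using correspondsD(7)[OF c that] by (simp add: O_n1_iff ac_simps)
  moreover have "parallel_normal_frame_on U (\<lambda>x. column j (X x)) (\<lambda>k x. column (Inr k) (A x))" for j
    by (rule curvature_line_param.parallel_frame[OF P])
  moreover have "first_fund (\<lambda>x. column j (X x)) x = (\<chi> a b. if a = b then (?\<beta> x $ j $ a)\<^sup>2 else 0)"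
    if "x \<in> U" for x j
    using curvature_line_param.first_fund_eq[OF P that] by (simp add: diag_def vec_eq_iff)
  moreover have "second_fund (\<lambda>x. column j (X x)) (\<lambda>x. column (Inr k) (A x)) x =
      (\<chi> a b. if a = b then ?\<beta> x $ j $ a * G x $ k $ a else 0)" if "x \<in> U" for x j k
    using curvature_line_param.second_fund_eq[OF P that] by (simp add: diag_def vec_eq_iff)
  moreover have "\<exists>\<sigma>\<in>{1, -1}. \<forall>x\<in>U. (\<Sum>i\<in>UNIV. (?\<beta> x $ j $ Some i)\<^sup>2) - (?\<beta> x $ j $ None)\<^sup>2 = \<sigma>" for j
  proof (rule bexI[of _ "sg j"], rule ballI)
    fix x assume x: "x \<in> U"
    have "(\<Sum>i\<in>UNIV. sg i * (B x $ j $ i)\<^sup>2) = sg j" by (rule O_n1_rows[OF correspondsD(7)[OF c x]])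
    then show "(\<Sum>i\<in>UNIV. (?\<beta> x $ j $ Some i)\<^sup>2) - (?\<beta> x $ j $ None)\<^sup>2 = sg j"
      by (simp add: UNIV_option_conv sum.reindex power_mult_distrib) (simp add: sg_def)
  qed (simp add: sg_def)
  ultimately have "\<exists>(e :: 'k \<Rightarrow> real^'n option \<Rightarrow> real^('n option + 'k)) \<beta> \<gamma>.
        smooth_on U \<beta> \<and> smooth_on U \<gamma> \<and> (\<forall>x\<in>U. \<beta> x \<in> O_n1) \<and>
        (\<forall>j. parallel_normal_frame_on U (\<lambda>x. column j (X x)) e \<and>
             (\<forall>x\<in>U.
                first_fund (\<lambda>x. column j (X x)) x =
                  (\<chi> a b. if a = b then (\<beta> x $ j $ a)\<^sup>2 else 0) \<and>
                (\<forall>k. second_fund (\<lambda>x. column j (X x)) (e k) x =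
                  (\<chi> a b. if a = b then \<beta> x $ j $ a * \<gamma> x $ k $ a else 0))) \<and>
             (\<exists>\<sigma>\<in>{1, -1}. \<forall>x\<in>U.
                (\<Sum>i\<in>UNIV. (\<beta> x $ j $ Some i)\<^sup>2) - (\<beta> x $ j $ None)\<^sup>2 = \<sigma>))"
    by (intro exI[of _ "\<lambda>k x. column (Inr k) (A x)"] exI[of _ ?\<beta>] exI[of _ G]) simp
  moreover have "normal_space (\<lambda>x. column i (X x)) x = normal_space (\<lambda>x. column j (X x)) x" if "x \<in> U" for i j x
    by (simp add: set_eq_iff curvature_line_param.normal_space_iff[OF P that])
  moreover have "immersion_on U (\<lambda>x. column j (X x))" "flat_normal_bundle_on U (\<lambda>x. column j (X x))"
     "nondegenerate_normal_bundle_on U (\<lambda>x. column j (X x))" for j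
    using curvature_line_param.immersion[OF P] curvature_line_param.flat[OF P]
      curvature_line_param.nondegenerate_iff[OF P] G by blast+
  ultimately show ?thesis
    unfolding tuple_type_O_n1_def using U by blast
qed

text \<open>A zero entry would annihilate the partial derivative in direction \<open>i\<close> and
  put \<open>axis i 1\<close> into the kernel of the differential.\<close>

lemma corresponds_immersion_nonzero:
  assumes "open U" "corresponds U X F G B A" "immersion_on U (\<lambda>x. column j (X x))" "x \<in> U"
  shows "B x $ j $ i \<noteq> 0"
proof
  assume "B x $ j $ i = 0"
  let ?d = "differential (\<lambda>x. column j (X x)) x"
  have "?d (axis i 1) = ?d 0"
    using \<open>B x $ j $ i = 0\<close>
    by (auto intro!: sum.neutral simp: differential_apply[OF assms(1) smooth_on_column[OF assms(1) correspondsD(5)[OF assms(2)]] assms(4)]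
        corresponds_pderiv_X[OF assms(1,2,4)] axis_def)
  moreover have "inj ?d" using assms(3,4) by (simp add: immersion_on_def)
  ultimately have "axis i (1::real) = 0" by (metis injD)
  then show False by simp
qed

section \<open>Ribaucour transformations from reflections\<close>

text \<open>Both \<open>u - v\<close> and \<open>q - p\<close> are multiples of \<open>w\<close>, so
  the lines meet after equal parameters, and the reflection preserves lengths. The factors
  \<open>a\<close> and \<open>b\<close> serve the coordinate fields, whose speeds on the two
  submanifolds differ.\<close>

lemma meet_equidistant_reflection:
  fixes p q u v w :: "'a::euclidean_space"
  assumes w: "\<rho> * (w \<bullet> w) = 1" and v: "v = u - (2 * \<rho> * (w \<bullet> u)) *\<^sub>R w" and q: "q = p + t *\<^sub>R w"
    and ab: "a \<noteq> 0" "b \<noteq> 0"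
  shows "meet_equidistant p (a *\<^sub>R u) q (b *\<^sub>R v)"
proof (cases "w \<bullet> u = 0")
  \<comment> \<open>Here \<open>v = u\<close>: the lines are parallel, and the displacement along
    \<open>w\<close> is orthogonal to them.\<close>
  case True
  have "b *\<^sub>R v = (b / a) *\<^sub>R (a *\<^sub>R u)" "b / a \<noteq> 0" "(q - p) \<bullet> (a *\<^sub>R u) = 0"
    using True ab by (simp_all add: v q)
  then show ?thesis unfolding meet_equidistant_def by blast
next
  case False
  have "\<rho> \<noteq> 0" using w by auto
  \<comment> \<open>Chosen so that \<open>\<tau>\<close> times \<open>u - v\<close> is the
    displacement from \<open>p\<close> to \<open>q\<close>.\<close>
  define \<tau> where "\<tau> = t / (2 * \<rho> * (w \<bullet> u))"
  define c where "c = p + \<tau> *\<^sub>R u"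
  have t: "\<tau> * (2 * \<rho> * (w \<bullet> u)) = t"
    using False \<open>\<rho> \<noteq> 0\<close> by (simp add: \<tau>_def)
  have c': "c = q + \<tau> *\<^sub>R v"
    using t by (simp add: c_def q v scaleR_diff_right)
  have "v \<bullet> v = u \<bullet> u - 4 * \<rho> * (w \<bullet> u)\<^sup>2 + 4 * \<rho> * (w \<bullet> u)\<^sup>2 * (\<rho> * (w \<bullet> w))"
    by (simp add: v inner_diff_left inner_diff_right inner_commute[of u w] power2_eq_square algebra_simps)
  then have "norm v = norm u" by (simp add: w norm_eq)
  moreover have "dist c p = \<bar>\<tau>\<bar> * norm u" by (simp add: c_def dist_norm)
  moreover have "dist c q = \<bar>\<tau>\<bar> * norm v" by (simp add: c' dist_norm)
  ultimately have "dist c p = dist c q" by simp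
  moreover have "c \<in> range (geodesic p (a *\<^sub>R u))"
    unfolding geodesic_def c_def using ab by (intro range_eqI[of _ _ "\<tau> / a"]) simp
  moreover have "c \<in> range (geodesic q (b *\<^sub>R v))"
    unfolding geodesic_def c' using ab by (intro range_eqI[of _ _ "\<tau> / b"]) simp
  ultimately show ?thesis unfolding meet_equidistant_def by blast
qed

text \<open>A common parameter domain lets the diffeomorphism be the identity. One and the same
  \<open>w\<close> directs both the reflection of the frame and the displacement of the base point,
  which is what makes corresponding lines meet.\<close>

locale ribaucour_pair =
  M: curvature_line_param U Y A h g + M': curvature_line_param U Y' A' h' g'
  for U :: "(real^'p::finite) set" and Y Y' :: "real^'p \<Rightarrow> real^('p + 'k::finite)"
    and A A' :: "real^'p \<Rightarrow> real^('p + 'k)^('p + 'k)" and h h' :: "real^'p \<Rightarrow> real^'p"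
    and g g' :: "real^'p \<Rightarrow> real^'p^'k" +
  fixes w :: "real^'p \<Rightarrow> real^('p + 'k)" and \<rho> t :: "real^'p \<Rightarrow> real"
  assumes unit: "x \<in> U \<Longrightarrow> \<rho> x * (w x \<bullet> w x) = 1"
    and reflection: "x \<in> U \<Longrightarrow> column c (A' x) = column c (A x) - (2 * \<rho> x * (w x \<bullet> column c (A x))) *\<^sub>R w x"
    and translation: "x \<in> U \<Longrightarrow> Y' x = Y x + t x *\<^sub>R w x"
    and full_rank: "x \<in> U \<Longrightarrow> rank (g x) = CARD('p)"
begin

abbreviation P where "P \<equiv> frame_morphism (\<lambda>k x. column (Inr k) (A x)) (\<lambda>k x. column (Inr k) (A' x))"

lemma P_inner:
  "x \<in> U \<Longrightarrow> P x v \<bullet> column (Inr k) (A' x) = v \<bullet> column (Inr k) (A x)"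
  "x \<in> U \<Longrightarrow> P x v \<bullet> column (Inl i) (A' x) = 0"
  by (simp_all add: frame_morphism_def M'.sum_e_inner)

lemma P_normal: "x \<in> U \<Longrightarrow> P x v \<in> normal_space Y' x"
  by (simp add: M'.normal_space_iff P_inner)

text \<open>By linearity the reflection formula extends from the frame vectors to all normal
  vectors, as the condition on normal lines demands.\<close>

lemma P_reflection:
  assumes x: "x \<in> U" and v: "v \<in> normal_space Y x"
  shows "P x v = v - (2 * \<rho> x * (w x \<bullet> v)) *\<^sub>R w x"
proof -
  have "P x v = (\<Sum>k\<in>UNIV. (v \<bullet> M.e (Inr k) x) *\<^sub>R M.e (Inr k) x) -
     (2 * \<rho> x * (w x \<bullet> (\<Sum>k\<in>UNIV. (v \<bullet> M.e (Inr k) x) *\<^sub>R M.e (Inr k) x))) *\<^sub>R w x"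
    by (simp add: frame_morphism_def reflection x scaleR_diff_right sum_subtractf inner_sum_right
        scaleR_sum_left sum_distrib_left ac_simps)
  then show ?thesis unfolding M.normal_expand[OF x v] .
qed

lemma bij_P:
  assumes x: "x \<in> U"
  shows "bij_betw (P x) (normal_space Y x) (normal_space Y' x)"
proof (rule bij_betwI)
  let ?Q = "\<lambda>v. \<Sum>k\<in>UNIV. (v \<bullet> M'.e (Inr k) x) *\<^sub>R M.e (Inr k) x"
  show "P x \<in> normal_space Y x \<rightarrow> normal_space Y' x" by (simp add: P_normal x)
  show "?Q \<in> normal_space Y' x \<rightarrow> normal_space Y x" by (simp add: M.normal_space_iff M.sum_e_inner x)
  show "?Q (P x v) = v" if "v \<in> normal_space Y x" for v
    using M.normal_expand[OF x that] by (simp add: P_inner x)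
  show "P x (?Q v) = v" if "v \<in> normal_space Y' x" for v
    using M'.normal_expand[OF x that] by (simp add: frame_morphism_def M.sum_e_inner x)
qed

lemma inv_into_id: "y \<in> U \<Longrightarrow> inv_into U (\<lambda>x. x) y = y"
  using inv_into_f_f[of "\<lambda>x. x" U y] by (simp add: inj_on_def)

lemma sphere_congruence: "sphere_congruence U Y U Y' (\<lambda>x. x) P"
  unfolding sphere_congruence_def
proof (intro conjI allI impI ballI)
  show "diffeomorphism_on U U (\<lambda>x. x)"
    unfolding diffeomorphism_on_def
  proof (intro conjI)
    show "bij_betw (\<lambda>x. x) U U" by (simp add: bij_betw_def inj_on_def)
    show "smooth_on U (\<lambda>x. x)" by (rule smooth_on_id[OF M.open_U])
    show "smooth_on U (inv_into U (\<lambda>x. x))"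
      by (rule smooth_on_cong[OF M.open_U _ smooth_on_id[OF M.open_U]]) (simp add: inv_into_id)
  qed
  show "normal_bundle_iso U Y U Y' (\<lambda>x. x) P"
    unfolding normal_bundle_iso_def
  proof (intro conjI allI impI ballI)
    fix x assume x: "x \<in> U"
    show "bij_betw (P x) (normal_space Y x) (normal_space Y' x)" by (rule bij_P[OF x])
    show "P x (a *\<^sub>R v + b *\<^sub>R v') = a *\<^sub>R P x v + b *\<^sub>R P x v'" for v v' a b
      by (simp add: frame_morphism_def inner_add_left scaleR_add_left sum.distrib scaleR_sum_right)
  next
    fix \<zeta> assume "normal_field_on U Y \<zeta>"
    note d = M.normal_field_coeffs(1)[OF this]
    show "smooth_on U (\<lambda>y. P (inv_into U (\<lambda>x. x) y) (\<zeta> (inv_into U (\<lambda>x. x) y)))"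
    proof (rule smooth_on_cong[OF M.open_U])
      show "smooth_on U (\<lambda>y. \<Sum>k\<in>UNIV. (\<zeta> y \<bullet> M.e (Inr k) y) *\<^sub>R M'.e (Inr k) y)"
        by (intro smooth_on_sum smooth_on_scaleR M.open_U d M'.smooth_e)
    qed (simp add: inv_into_id frame_morphism_def)
  qed
  fix \<zeta> assume \<zeta>: "parallel_normal_field_on U Y \<zeta>"
  then have n: "normal_field_on U Y \<zeta>" by (simp add: parallel_normal_field_on_def)
  \<comment> \<open>\<open>P\<close> carries the coefficients unchanged from one parallel frame to
    the other.\<close>
  show "parallel_normal_field_on U Y' (\<lambda>y. P (inv_into U (\<lambda>x. x) y) (\<zeta> (inv_into U (\<lambda>x. x) y)))"
    by (rule M'.parallel_sum[OF M.normal_field_coeffs(1)[OF n] M.parallel_coeffs[OF \<zeta>]])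
       (simp_all add: inv_into_id frame_morphism_def)
next
  fix x v assume x: "x \<in> U" and v: "v \<in> normal_space Y x"
  show "meet_equidistant (Y x) v (Y' x) (P x v)"
    using meet_equidistant_reflection[OF unit[OF x] P_reflection[OF x v] translation[OF x], of 1 1] by simp
qed (fact M.open_U M.immersion M'.immersion)+

text \<open>Since principal directions are coordinate axes, each such tangent line is spanned by a
  column of \<open>A\<close> and its image by the reflected column of \<open>A'\<close>.\<close>

theorem ribaucour: "ribaucour_transformation U Y U Y' (\<lambda>x. x) P"
  unfolding ribaucour_transformation_def
proof (intro conjI ballI allI impI)
  fix x u assume x: "x \<in> U" and "principal_direction Y x u"
  then obtain a r where u: "r \<noteq> 0" "u = axis a r"
    using M.principal_direction_axis full_rank by blast
  have id: "differential (\<lambda>x. x) x v = v" for v :: "real^'p"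
    unfolding differential_def by (metis frechet_derivative_at has_derivative_ident)
  show "eigenvector (shape_operator Y' x (P x v)) (differential (\<lambda>x. x) x u)" for v
    unfolding id u(2) by (rule M'.eigenvector_axis[OF x P_normal[OF x] u(1)])
  show "meet_equidistant (Y x) (differential Y x u) (Y' x) (differential Y' x (differential (\<lambda>x. x) x u))"
    unfolding id u(2) M.differential_Y_axis[OF x] M'.differential_Y_axis[OF x]
    using u(1) M.h_nonzero[OF x] M'.h_nonzero[OF x]
    by (intro meet_equidistant_reflection[OF unit[OF x] reflection[OF x] translation[OF x]]) simp_all
qed (rule sphere_congruence)

end

section \<open>Rank-one matrices and the final statement\<close>

lemma matrix_mult_outer: "M ** outer u v = outer (M *v u) (v :: real^'q::finite)"
  by (simp add: vec_eq_iff matrix_mult_nth[of M] matrix_vector_mult_def sum_distrib_right mult.assoc)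

lemma outer_mult_transpose: "outer u v ** transpose N = outer u (N *v (v :: real^'q::finite))"
  by (simp add: vec_eq_iff matrix_mult_nth[of _ "transpose N"] matrix_vector_mult_def transpose_nth
      sum_distrib_left ac_simps)

lemma outer_mult_J: "outer u v ** J = outer u (J *v v)"
  by (simp add: vec_eq_iff ac_simps)

lemma outer_scaleR: "outer (a *\<^sub>R u) (b *\<^sub>R v) = (a * b) *\<^sub>R outer u (v :: real^'q::finite)"
  by (simp add: vec_eq_iff ac_simps)

lemma matrix_mult_reflection:
  "M ** (mat 1 - c *\<^sub>R outer u v) = M - c *\<^sub>R outer (M *v u) (v :: real^'q::finite)"
proof -
  have "M ** (mat 1 - c *\<^sub>R outer u v) = M - c *\<^sub>R (M ** outer u v)"
    by (simp add: vec_eq_iff matrix_mult_nth[of M] mat_def right_diff_distrib sum_subtractf mult_delta_right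
        sum_distrib_left ac_simps)
  then show ?thesis by (simp add: matrix_mult_outer)
qed


text \<open>Regularity need not be inherited. In direction \<open>i\<close> the derivative of member
  \<open>j\<close> of \<open>Xt\<close> is a unit vector times plus or minus
  \<open>Bt x $ j $ i\<close>, so this member is immersed exactly where row \<open>j\<close> of
  \<open>Bt\<close> has no zero, and there \<open>rank (Gt x)\<close> decides non-degeneracy. Hence
  the geometric claims about \<open>Xt\<close> are local, while the equations in (ii) hold on all of
  \<open>\<Omega>\<close>. In (v), where the reflection fixes \<open>e_i\<close> the two tangent
  lines are parallel, and a finite meeting parameter need not exist.\<close>

theorem theorem12p3:
  fixes \<Omega> :: "(real^'n::finite option) set"
    and F B :: "real^'n option \<Rightarrow> real^'n option^'n option"
    and G :: "real^'n option \<Rightarrow> real^'n option^'k::finite"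
    and A :: "real^'n option \<Rightarrow> real^('n option + 'k)^('n option + 'k)"
    and X :: "real^'n option \<Rightarrow> real^'n option^('n option + 'k)"
    and E :: "real^'n option \<Rightarrow> complex \<Rightarrow>
              complex^(('n option + 'k) + 'n option)^(('n option + 'k) + 'n option)"
    and q :: "complex \<Rightarrow> complex^(('n option + 'k) + 'n option)^(('n option + 'k) + 'n option)"
    and s :: real and W :: "real^('n option + 'k)" and Z :: "real^'n option"
    and Wt :: "real^'n option \<Rightarrow> real^('n option + 'k)"
    and Zt :: "real^'n option \<Rightarrow> real^'n option"
    and Ft Bt :: "real^'n option \<Rightarrow> real^'n option^'n option"
    and Gt :: "real^'n option \<Rightarrow> real^'n option^'k"
    and At :: "real^'n option \<Rightarrow> real^('n option + 'k)^('n option + 'k)"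
    and Xt :: "real^'n option \<Rightarrow> real^'n option^('n option + 'k)"
  assumes dom: "open_domain \<Omega>"
    and sol: "solution_system_II \<Omega> F G B"
    and tuple: "tuple_type_O_n1 \<Omega> X"
    and corr: "corresponds \<Omega> X F G B A"
    and frame: "frame_of \<Omega> E (\<lambda>x. stack (F x) (G x)) A B"
    and s: "s \<noteq> 0" and W: "norm W = 1" and Z: "form_n1 Z = 1"
    and act: "simple_element_action \<Omega> q s W Z E F G B A Wt Zt Ft Gt Bt At"
    and hats_defined: "\<forall>x\<in>\<Omega>. norm (Wt x) \<noteq> 0 \<and> norm_n1 (Zt x) \<noteq> 0"
    and Xt: "\<forall>x\<in>\<Omega>. Xt x = X x +
               (2 / s) *\<^sub>R (A x ** outer (hat_W Wt x) (hat_Z Zt x) ** transpose (B x) ** J)"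
  shows
    "\<comment> \<open>(i)\<close>
     (\<forall>U. open_domain U \<and> U \<subseteq> \<Omega> \<and>
          (\<forall>x\<in>U. (\<forall>j i. Bt x $ j $ i \<noteq> 0) \<and> rank (Gt x) = CARD('n option)) \<longrightarrow>
          tuple_type_O_n1 U Xt)
     \<and>
     \<comment> \<open>(ii)\<close>
     corresponds \<Omega> Xt Ft Gt Bt At
     \<and>
     \<comment> \<open>(iii)\<close>
     (\<forall>j. principal_frame_on \<Omega> (\<lambda>x. column j (X x)) (\<lambda>i x. column (Inl i) (A x)) \<and>
          parallel_normal_frame_on \<Omega> (\<lambda>x. column j (X x)) (\<lambda>k x. column (Inr k) (A x)))
     \<and>
     (\<forall>j U. open_domain U \<and> U \<subseteq> \<Omega> \<and> (\<forall>x\<in>U. \<forall>i. Bt x $ j $ i \<noteq> 0) \<longrightarrow>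
          principal_frame_on U (\<lambda>x. column j (Xt x)) (\<lambda>i x. column (Inl i) (At x)) \<and>
          parallel_normal_frame_on U (\<lambda>x. column j (Xt x)) (\<lambda>k x. column (Inr k) (At x)))
     \<and>
     \<comment> \<open>(iv)\<close>
     (\<forall>j U. open_domain U \<and> U \<subseteq> \<Omega> \<and> (\<forall>x\<in>U. \<forall>i. Bt x $ j $ i \<noteq> 0) \<longrightarrow>
          ribaucour_transformation U (\<lambda>x. column j (X x)) U (\<lambda>x. column j (Xt x)) (\<lambda>x. x)
            (frame_morphism (\<lambda>k x. column (Inr k) (A x)) (\<lambda>k x. column (Inr k) (At x))))
     \<and>
     \<comment> \<open>(v)\<close>
     (\<exists>\<phi> :: 'n option \<Rightarrow> 'n option \<Rightarrow> real^'n option \<Rightarrow> real.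
        \<forall>i j. smooth_on {x\<in>\<Omega>. column (Inl i) (At x) \<noteq> column (Inl i) (A x)} (\<phi> i j) \<and>
          (\<forall>x\<in>{x\<in>\<Omega>. column (Inl i) (At x) \<noteq> column (Inl i) (A x)}.
             column j (X x) + \<phi> i j x *\<^sub>R column (Inl i) (A x) =
             column j (Xt x) + \<phi> i j x *\<^sub>R column (Inl i) (At x)))"
proof -
  have opn: "open \<Omega>" using dom by (simp add: open_domain_def)
  have Wt0: "Wt x \<noteq> 0" if "x \<in> \<Omega>" for x
    using hats_defined that by auto
  have v_eq: "vec_W_iZ (Wt x) (Zt x) = matrix_inv (E x (- (\<i> * s))) *v vec_W_iZ W Z" if "x \<in> \<Omega>" for x
    using act that by (simp add: simple_element_action_def)
  note fr = opn correspondsD(3)[OF corr] frame v_eq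
  interpret D: dressing \<Omega> F B G A X s Wt Zt
    by unfold_locales
       (rule opn corr s frame_smooth_Wt[OF fr] frame_smooth_Zt[OF fr] frame_pderiv_Wt[OF fr]
          frame_pderiv_Zt[OF fr] frame_pderiv_B[OF fr] frame_quadric[OF fr _ W Z] Wt0 | assumption)+

  \<comment> \<open>The quadratic relation equates the two norms, so the single factor
    \<open>\<rho>\<close> covers all three normalisations.\<close>
  have hat: "outer (hat_W Wt x) (hat_Z Zt x) = D.\<rho> x *\<^sub>R outer (Wt x) (Zt x)"
      "outer (hat_W Wt x) (hat_W Wt x) = D.\<rho> x *\<^sub>R outer (Wt x) (Wt x)"
      "outer (hat_Z Zt x) (hat_Z Zt x) = D.\<rho> x *\<^sub>R outer (Zt x) (Zt x)" if x: "x \<in> \<Omega>" for x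
  proof -
    have "norm_n1 (Zt x) = norm (Wt x)"
      by (simp add: norm_n1_def norm_eq_sqrt_inner D.quadric[OF x, symmetric])
    moreover have "inverse (norm (Wt x)) * inverse (norm (Wt x)) = D.\<rho> x"
      by (simp add: D.\<rho>_def power2_norm_eq_inner[symmetric] power2_eq_square)
    ultimately show "outer (hat_W Wt x) (hat_Z Zt x) = D.\<rho> x *\<^sub>R outer (Wt x) (Zt x)"
      "outer (hat_W Wt x) (hat_W Wt x) = D.\<rho> x *\<^sub>R outer (Wt x) (Wt x)"
      "outer (hat_Z Zt x) (hat_Z Zt x) = D.\<rho> x *\<^sub>R outer (Zt x) (Zt x)"
      by (simp_all add: hat_W_def hat_Z_def outer_scaleR)
  qed
  have At: "D.At x = At x" and Bt: "D.Bt x = Bt x" and Xt': "D.Xt x = Xt x"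
    and \<xi>t: "D.\<xi>t x = stack (Ft x) (Gt x)" if x: "x \<in> \<Omega>" for x
  proof -
    have a: "stack (Ft x) (Gt x) =
          stack (F x) (G x) - (2 * s) *\<^sub>R off_diag (outer (hat_W Wt x) (hat_Z Zt x) ** J)"
        "At x = A x ** (mat 1 - 2 *\<^sub>R outer (hat_W Wt x) (hat_W Wt x))"
        "Bt x = B x ** (mat 1 - 2 *\<^sub>R (outer (hat_Z Zt x) (hat_Z Zt x) ** J))"
      using act x by (auto simp: simple_element_action_def)
    show "D.At x = At x"
      by (simp add: a(2) hat x matrix_mult_reflection D.At_def D.w_def)
    have J: "(c *\<^sub>R outer u v) ** J = c *\<^sub>R outer u (J *v v)" for c and u :: "real^'z::finite" and v
      by (simp add: vec_eq_iff ac_simps)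
    show "D.Bt x = Bt x"
      by (simp add: a(3) hat x J matrix_mult_reflection D.Bt_def D.z_def D.Y_def)
    show "D.\<xi>t x = stack (Ft x) (Gt x)"
      unfolding a(1) hat[OF x] J D.\<xi>t_def D.\<xi>_def D.Y_def
      by (simp add: vec_eq_iff)
    have "A x ** outer (hat_W Wt x) (hat_Z Zt x) ** transpose (B x) ** J =
        D.\<rho> x *\<^sub>R outer (D.w x) (J *v D.z x)"
      using outer_scaleR[of "D.\<rho> x" "D.w x" 1]
      unfolding hat[OF x] outer_scaleR[of "D.\<rho> x" "Wt x" 1 "Zt x", unfolded scaleR_one mult_1_right, symmetric]
        matrix_mult_outer outer_mult_transpose outer_mult_J
      by (simp add: D.w_def D.z_def matrix_vector_mult_scaleR)
    then show "D.Xt x = Xt x"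
      using Xt x by (simp add: D.Xt_def)
  qed

  have ii: "corresponds \<Omega> Xt Ft Gt Bt At"
  proof (rule corresponds_cong[OF opn _ _ _ _ _ D.corresponds_Xt])
    fix x assume "x \<in> \<Omega>"
    then show "D.Xt x = Xt x" "D.Bt x = Bt x" "D.At x = At x" "(\<chi> i. D.\<xi>t x $ Inl i) = Ft x"
      "(\<chi> k. D.\<xi>t x $ Inr k) = Gt x"
      by (simp_all add: Xt' Bt At \<xi>t vec_eq_iff)
  qed
  have B0: "B x $ j $ i \<noteq> 0" if "x \<in> \<Omega>" for x j i
    using corresponds_immersion_nonzero[OF opn corr _ that] tuple by (simp add: tuple_type_O_n1_def)
  note M = corresponds_curvature_line_param[OF opn corr B0]
  have rank_G: "rank (G x) = CARD('n option)" if "x \<in> \<Omega>" for x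
    using tuple curvature_line_param.nondegenerate_iff[OF M] that by (simp add: tuple_type_O_n1_def)
  have At_column: "column c (At x) = column c (A x) - (2 * D.\<rho> x * Wt x $ c) *\<^sub>R D.w x" if "x \<in> \<Omega>" for c x
    using D.column_At[of c x] At[OF that] by simp

  have i: "tuple_type_O_n1 U Xt" if "open_domain U \<and> U \<subseteq> \<Omega> \<and>
      (\<forall>x\<in>U. (\<forall>j i. Bt x $ j $ i \<noteq> 0) \<and> rank (Gt x) = CARD('n option))" for U
    using that by (intro corresponds_tuple[OF _ corresponds_subset[OF _ ii]]) auto
  have iii: "principal_frame_on \<Omega> (\<lambda>x. column j (X x)) (\<lambda>i x. column (Inl i) (A x))"
    "parallel_normal_frame_on \<Omega> (\<lambda>x. column j (X x)) (\<lambda>k x. column (Inr k) (A x))" for j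
    by (rule curvature_line_param.principal_frame[OF M], assumption,
        rule curvature_line_param.parallel_frame[OF M], assumption)
  have Mt: "curvature_line_param U (\<lambda>x. column j (Xt x)) At (\<lambda>x. \<chi> i. - (sg j * Bt x $ j $ i)) Gt"
    if "open_domain U \<and> U \<subseteq> \<Omega> \<and> (\<forall>x\<in>U. \<forall>i. Bt x $ j $ i \<noteq> 0)" for j U
    using that
    by (intro corresponds_curvature_line_param[OF _ corresponds_subset[OF _ ii]]) (auto simp: open_domain_def)
  have iv: "ribaucour_transformation U (\<lambda>x. column j (X x)) U (\<lambda>x. column j (Xt x)) (\<lambda>x. x)
            (frame_morphism (\<lambda>k x. column (Inr k) (A x)) (\<lambda>k x. column (Inr k) (At x)))"
    if U: "open_domain U \<and> U \<subseteq> \<Omega> \<and> (\<forall>x\<in>U. \<forall>i. Bt x $ j $ i \<noteq> 0)" for j U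
  proof -
    have sub: "x \<in> \<Omega>" if "x \<in> U" for x using U that by blast
    have MU: "curvature_line_param U (\<lambda>x. column j (X x)) A (\<lambda>x. \<chi> i. - (sg j * B x $ j $ i)) G"
      using U by (intro corresponds_curvature_line_param[OF _ corresponds_subset[OF _ corr]] B0)
        (auto simp: open_domain_def)
    have "ribaucour_pair U (\<lambda>x. column j (X x)) (\<lambda>x. column j (Xt x)) A At
        (\<lambda>x. \<chi> i. - (sg j * B x $ j $ i)) (\<lambda>x. \<chi> i. - (sg j * Bt x $ j $ i)) G Gt D.w D.\<rho>
        (\<lambda>x. 2 / s * sg j * D.\<rho> x * D.z x $ j)"
    proof (intro ribaucour_pair.intro ribaucour_pair_axioms.intro MU Mt[OF U])
      fix x assume "x \<in> U"
      then have x: "x \<in> \<Omega>" by (rule sub)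
      show "D.\<rho> x * (D.w x \<bullet> D.w x) = 1" by (rule D.w_norm[OF x])
      show "column c (At x) = column c (A x) - (2 * D.\<rho> x * (D.w x \<bullet> column c (A x))) *\<^sub>R D.w x" for c
        by (simp add: At_column[OF x] D.w_inner[OF x])
      show "column j (Xt x) = column j (X x) + (2 / s * sg j * D.\<rho> x * D.z x $ j) *\<^sub>R D.w x"
        using D.Xt_column[of j x] Xt'[OF x] by simp
      show "rank (G x) = CARD('n option)" by (rule rank_G[OF x])
    qed
    then show ?thesis by (rule ribaucour_pair.ribaucour)
  qed

  have v: "\<exists>\<phi> :: 'n option \<Rightarrow> 'n option \<Rightarrow> real^'n option \<Rightarrow> real.
        \<forall>i j. smooth_on {x\<in>\<Omega>. column (Inl i) (At x) \<noteq> column (Inl i) (A x)} (\<phi> i j) \<and>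
          (\<forall>x\<in>{x\<in>\<Omega>. column (Inl i) (At x) \<noteq> column (Inl i) (A x)}.
             column j (X x) + \<phi> i j x *\<^sub>R column (Inl i) (A x) =
             column j (Xt x) + \<phi> i j x *\<^sub>R column (Inl i) (At x))"
  proof (intro exI allI conjI ballI)
    fix i j
    let ?S = "{x\<in>\<Omega>. column (Inl i) (At x) \<noteq> column (Inl i) (A x)}"
    have "continuous_on \<Omega> (\<lambda>x. Wt x $ Inl i)"
      using smooth_on_nth[OF opn D.smooth_Wt] unfolding smooth_on_def by (metis Ck_on.simps(1))
    then have "open {x\<in>\<Omega>. Wt x $ Inl i \<noteq> 0}"
      using continuous_open_preimage[OF _ opn, of "\<lambda>x. Wt x $ Inl i" "- {0}"] by (simp add: vimage_def Int_def open_Compl[OF closed_singleton])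
    \<comment> \<open>A column is moved by the reflection exactly when its component along
      \<open>w\<close> is nonzero; in this form the set is visibly open.\<close>
    moreover have S: "?S = {x\<in>\<Omega>. Wt x $ Inl i \<noteq> 0}"
      using D.w_norm by (force simp: At_column)
    ultimately have opS: "open ?S" by simp
    \<comment> \<open>The witness is the parameter \<open>\<tau>\<close> of
      \<open>meet_equidistant_reflection\<close> for the displacement coefficient in
      \<open>Xt_column\<close>; the factor \<open>2 * \<rho>\<close> cancels.\<close>
    show "smooth_on ?S (\<lambda>x. (sg j * D.z x $ j) / (s * Wt x $ Inl i))"
    proof (intro smooth_on_divide smooth_on_mult smooth_on_const smooth_on_nth opS)
      show "smooth_on ?S D.z" "smooth_on ?S Wt"
        by (rule smooth_on_subset[OF _ D.smooth_z] smooth_on_subset[OF _ D.smooth_Wt], blast)+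
    qed (use s S in auto)
    fix x assume "x \<in> ?S"
    then have x: "x \<in> \<Omega>" and Wi: "Wt x $ Inl i \<noteq> 0" using S by auto
    show "column j (X x) + ((sg j * D.z x $ j) / (s * Wt x $ Inl i)) *\<^sub>R column (Inl i) (A x) =
        column j (Xt x) + ((sg j * D.z x $ j) / (s * Wt x $ Inl i)) *\<^sub>R column (Inl i) (At x)"
      using D.Xt_column[of j x] Xt'[OF x] s Wi by (simp add: At_column[OF x] scaleR_diff_right)
  qed

  have iii': "principal_frame_on U (\<lambda>x. column j (Xt x)) (\<lambda>i x. column (Inl i) (At x))"
    "parallel_normal_frame_on U (\<lambda>x. column j (Xt x)) (\<lambda>k x. column (Inr k) (At x))"
    if "open_domain U \<and> U \<subseteq> \<Omega> \<and> (\<forall>x\<in>U. \<forall>i. Bt x $ j $ i \<noteq> 0)" for j U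
    by (rule curvature_line_param.principal_frame[OF Mt[OF that]]
        curvature_line_param.parallel_frame[OF Mt[OF that]])+

  show ?thesis
    by (intro conjI allI impI i ii iii iii' iv v) blast+
qed

end
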